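(* Let $A$, $S$, $\mathbb K$, $X$, $G$, $\mathcal A_{\mathbb K}=A\rtimes S$ and $\bar{\mathcal A}=C(X)\rtimes S$ be as in the context. 1) The action $\alpha(\chi)=\alpha\circ\chi$ of $G$ on $X=X(\bar{\mathbb K})$ defines a canonical action of $G$ by automorphisms of the $C^*$-algebra $\bar{\mathcal A}=C(X)\rtimes S$, preserving $C(X)$ globally, and such that for any pure state $\varphi$ of $C(X)$ one has $$\alpha\,\varphi(a)=\varphi(\alpha^{-1}(a))\qquad \forall a\in A,\ \forall \alpha\in G .$$ 2) Suppose that each $A_\beta$ is a finite product $\prod_i \mathbb L_i$ of normal abelian (i.e. finite abelian Galois) extensions $\mathbb L_i$ of $\mathbb K$. Then the subalgebras $A\subset C(X)$ and $\mathcal A_{\mathbb K}\subset\bar{\mathcal A}$ are globally invariant under the action of $G$, and the states $\varphi$ of $C(X)\rtimes S$ induced by pure states of $C(X)$ satisfy $$\alpha\,\varphi(a)=\varphi(\theta(\alpha)(a))\qquad \forall a\in\mathcal A_{\mathbb K},\quad \theta(\alpha)=\alpha^{-1},\quad \forall\alpha\in G^{ab}=G/[G,G].$$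
   Context: $\mathbb K$ is a number field with a fixed embedding $\sigma:\mathbb K\hookrightarrow\mathbb C$; $\bar{\mathbb K}\subset\mathbb C$ is the algebraic closure of $\sigma(\mathbb K)$ in $\mathbb C$, and $G=\mathrm{Gal}(\bar{\mathbb K}/\mathbb K)$. $A=\varinjlim_\beta A_\beta$ is a unital inductive limit (countable system) of reduced finite dimensional commutative $\mathbb K$-algebras $A_\beta$, with $A=\bigcup_\beta A_\beta$. $S$ is a unital abelian semigroup of $\mathbb K$-algebra endomorphisms $\rho:A\to A$ such that, with the idempotent $e=\rho(1)$, $\rho$ is an isomorphism of $A$ onto the compressed algebra $eAe$. The algebraic crossed product $\mathcal A_{\mathbb K}=A\rtimes S$ is generated by $A$ and elements $U_\rho,U_\rho^*$ ($\rho\in S$) with relations $U_\rho^*U_\rho=1$, $U_\rho U_\rho^*=\rho(1)$, $U_{\rho_1\rho_2}=U_{\rho_1}U_{\rho_2}$, $U^*_{\rho_2\rho_1}=U^*_{\rho_1}U^*_{\rho_2}$, $U_\rho x=\rho(x)U_\rho$, $xU_\rho^*=U_\rho^*\rho(x)$ for $x\in A$. It is the linear span of the monomials $U_{\rho_1}^*aU_{\rho_2}$. $X=X(\bar{\mathbb K})=\mathrm{Hom}_{\mathbb K\text{-alg}}(A,\bar{\mathbb K})=\varprojlim_\beta \mathrm{Hom}_{\mathbb K\text{-alg}}(A_\beta,\bar{\mathbb K})$, a totally disconnected compact space. $A$ is embedded in $C(X)$ by $a\mapsto\hat a$, $\hat a(\chi)=\chi(a)$; the $\mathbb C$-linear span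 of $A$ in $C(X)$ is the algebra of locally constant functions. The endomorphisms $\rho$ extend to $C(X)$, and $\bar{\mathcal A}=C(X)\rtimes S$ is the $C^*$-crossed product, i.e. the $C^*$-algebra defined by $C(X)$ and generators $U_\rho$, $U_\rho^*$ with the same relations, $U_\rho^*$ being the adjoint of $U_\rho$. It contains $\mathcal A_{\mathbb K}$. The group $G$ acts on $X$ by $\alpha(\chi)=\alpha\circ\chi$ and on $C(X)$ by $\alpha(h)(\chi)=h(\alpha^{-1}(\chi))$. In the formulas, $\alpha\,\varphi(a)$ means $\alpha$ applied to the number $\varphi(a)\in\bar{\mathbb K}$. A state of $C(X)\rtimes S$ induced by a pure state of $C(X)$ is the composition of that pure state with the canonical conditional expectation $C(X)\rtimes S\to C(X)$ (which sends $U_{\rho_1}^*aU_{\rho_2}$ to $0$ if $\rho_1\ne\rho_2$, and to $\rho^{-1}(\rho(1)a)$ if $\rho_1=\rho_2=\rho$). *)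

theory Defs
  imports
    "HOL-Analysis.Analysis"
    "HOL-Computational_Algebra.Polynomial"
    "HOL-Library.Poly_Mapping"
    "HOL-Algebra.Bij"
    "HOL-Algebra.Generated_Groups"
    "HOL-Algebra.Module"
    "HOL-Algebra.QuotRing"
begin

section \<open>Fields and Galois groups\<close>

definition number_field :: "'k::field_char_0 itself \<Rightarrow> bool" where
  "number_field _ \<longleftrightarrow>
     (\<exists>B::'k set. finite B \<and> Modules.module.span (\<lambda>(q::rat) x. of_rat q * x) B = UNIV)"

definition field_embedding :: "('k::field \<Rightarrow> complex) \<Rightarrow> bool" where
  "field_embedding \<sigma> \<longleftrightarrow> \<sigma> 1 = 1 \<and>
     (\<forall>x y. \<sigma> (x + y) = \<sigma> x + \<sigma> y) \<and> (\<forall>x y. \<sigma> (x * y) = \<sigma> x * \<sigma> y)"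

definition alg_closure_in_C :: "('k::field \<Rightarrow> complex) \<Rightarrow> complex set" where
  "alg_closure_in_C \<sigma> = {z. \<exists>p. p \<noteq> 0 \<and> poly (map_poly \<sigma> p) z = 0}"

text \<open>The group of automorphisms of a field \<open>L \<subseteq> \<complex>\<close> that fix \<open>F\<close> pointwise; its elements are
  extensional functions on \<open>L\<close>.\<close>

definition galois_group :: "complex set \<Rightarrow> complex set \<Rightarrow> (complex \<Rightarrow> complex) monoid" where
  "galois_group L F = BijGroup L \<lparr>carrier :=
     {f \<in> Bij L. (\<forall>x\<in>L. \<forall>y\<in>L. f (x + y) = f x + f y \<and> f (x * y) = f x * f y) \<and>
                 (\<forall>x\<in>F. f x = x)}\<rparr>"

text \<open>\<open>L\<close> is a finite Galois extension of \<open>\<sigma>(K)\<close> inside \<open>\<complex>\<close> with abelian Galois group. Galois is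
  taken in the sense of Artin: the fixed field of the automorphism group is the base field.\<close>

definition abelian_extension :: "('k::field \<Rightarrow> complex) \<Rightarrow> complex set \<Rightarrow> bool" where
  "abelian_extension \<sigma> L \<longleftrightarrow>
     range \<sigma> \<subseteq> L \<and>
     (\<forall>x\<in>L. \<forall>y\<in>L. x - y \<in> L \<and> x * y \<in> L) \<and> (\<forall>x\<in>L. inverse x \<in> L) \<and>
     (\<exists>B. finite B \<and> L = Modules.module.span (\<lambda>c z. \<sigma> c * z) B) \<and>
     (\<forall>x\<in>L. (\<forall>f\<in>carrier (galois_group L (range \<sigma>)). f x = x) \<longrightarrow> x \<in> range \<sigma>) \<and>
     comm_group (galois_group L (range \<sigma>))"


section \<open>The data \<open>K\<close>, \<open>A\<close>, \<open>S\<close>\<close>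

text \<open>The type \<open>'k\<close> is the number field, the type \<open>'a\<close> is the algebra \<open>A\<close> (with scalar
  multiplication \<open>scaleA\<close>), \<open>level \<beta>\<close> is the subalgebra \<open>A\<^sub>\<beta>\<close> for \<open>\<beta> \<in> indices\<close>, and \<open>endos\<close> is
  the semigroup \<open>S\<close>.\<close>

record ('k, 'a, 'i) endomotive_data =
  embK :: "'k \<Rightarrow> complex"
  scaleA :: "'k \<Rightarrow> 'a \<Rightarrow> 'a"
  indices :: "'i set"
  level :: "'i \<Rightarrow> 'a set"
  endos :: "('a \<Rightarrow> 'a) set"

definition reduced_fd_subalgebra :: "('k::field \<Rightarrow> 'a::comm_ring_1 \<Rightarrow> 'a) \<Rightarrow> 'a set \<Rightarrow> bool" where
  "reduced_fd_subalgebra sc B \<longleftrightarrow>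
     1 \<in> B \<and> (\<forall>x\<in>B. \<forall>y\<in>B. x * y \<in> B) \<and>
     (\<exists>F. finite F \<and> B = Modules.module.span sc F) \<and>
     (\<forall>x\<in>B. \<forall>n. x ^ n = 0 \<longrightarrow> x = 0)"

locale endomotive =
  fixes D :: "('k::field_char_0, 'a::comm_ring_1, 'i) endomotive_data"
  assumes number_field: "number_field TYPE('k)"
    and embedding: "field_embedding (embK D)"
    and vector_space: "Vector_Spaces.vector_space (scaleA D)"
    and scale_mult: "\<And>c x y. scaleA D c (x * y) = scaleA D c x * y"
    and countable: "countable (indices D)"
    and directed: "indices D \<noteq> {}"
      "\<And>\<beta> \<gamma>. \<beta> \<in> indices D \<Longrightarrow> \<gamma> \<in> indices D \<Longrightarrow>
         \<exists>\<delta>\<in>indices D. level D \<beta> \<subseteq> level D \<delta> \<and> level D \<gamma> \<subseteq> level D \<delta>"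
    and levels: "\<And>\<beta>. \<beta> \<in> indices D \<Longrightarrow> reduced_fd_subalgebra (scaleA D) (level D \<beta>)"
    and exhaust: "(\<Union>\<beta>\<in>indices D. level D \<beta>) = UNIV"
    and endo_id: "id \<in> endos D"
    and endo_comp: "\<And>\<rho> \<tau>. \<rho> \<in> endos D \<Longrightarrow> \<tau> \<in> endos D \<Longrightarrow> \<rho> \<circ> \<tau> \<in> endos D"
    and endo_commute: "\<And>\<rho> \<tau>. \<rho> \<in> endos D \<Longrightarrow> \<tau> \<in> endos D \<Longrightarrow> \<rho> \<circ> \<tau> = \<tau> \<circ> \<rho>"
    and endo_hom: "\<And>\<rho> x y. \<rho> \<in> endos D \<Longrightarrow> \<rho> (x + y) = \<rho> x + \<rho> y"
      "\<And>\<rho> x y. \<rho> \<in> endos D \<Longrightarrow> \<rho> (x * y) = \<rho> x * \<rho> y"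
      "\<And>\<rho> c x. \<rho> \<in> endos D \<Longrightarrow> \<rho> (scaleA D c x) = scaleA D c (\<rho> x)"
    and endo_corner: "\<And>\<rho>. \<rho> \<in> endos D \<Longrightarrow> bij_betw \<rho> UNIV {\<rho> 1 * a * \<rho> 1 | a. True}"

definition Kbar :: "('k::field, 'a, 'i) endomotive_data \<Rightarrow> complex set" where
  "Kbar D = alg_closure_in_C (embK D)"

definition Gal :: "('k::field, 'a, 'i) endomotive_data \<Rightarrow> (complex \<Rightarrow> complex) monoid" where
  "Gal D = galois_group (Kbar D) (range (embK D))"

definition Gal_ab :: "('k::field, 'a, 'i) endomotive_data \<Rightarrow> (complex \<Rightarrow> complex) set monoid" where
  "Gal_ab D = Gal D Mod derived (Gal D) (carrier (Gal D))"

text \<open>\<open>B\<close> is isomorphic as a \<open>K\<close>-algebra to a finite product of finite abelian Galois extensions of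
  \<open>K\<close>. Every finite extension of \<open>K\<close> embeds in \<open>\<complex>\<close> over \<open>\<sigma>\<close>, so the factors may be taken there.\<close>

definition product_of_abelian_extensions ::
    "('k::field, 'a::comm_ring_1, 'i) endomotive_data \<Rightarrow> 'a set \<Rightarrow> bool" where
  "product_of_abelian_extensions D B \<longleftrightarrow>
     (\<exists>(n::nat) (L :: nat \<Rightarrow> complex set) (\<Phi> :: 'a \<Rightarrow> nat \<Rightarrow> complex).
        (\<forall>j<n. abelian_extension (embK D) (L j)) \<and>
        bij_betw \<Phi> B (PiE {..<n} L) \<and>
        (\<forall>j<n. \<Phi> 1 j = 1 \<and>
           (\<forall>x\<in>B. \<forall>y\<in>B. \<Phi> (x + y) j = \<Phi> x j + \<Phi> y j \<and> \<Phi> (x * y) j = \<Phi> x j * \<Phi> y j) \<and>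
           (\<forall>c. \<forall>x\<in>B. \<Phi> (scaleA D c x) j = embK D c * \<Phi> x j)))"


section \<open>The space \<open>X\<close>\<close>

text \<open>Unital \<open>K\<close>-algebra homomorphisms from a subalgebra \<open>B\<close> of \<open>A\<close> to \<open>Kbar\<close>.\<close>

definition alg_homs :: "('k::field, 'a::comm_ring_1, 'i) endomotive_data \<Rightarrow> 'a set \<Rightarrow> ('a \<Rightarrow> complex) set" where
  "alg_homs D B = {\<xi>. \<xi> \<in> (B \<rightarrow>\<^sub>E Kbar D) \<and> \<xi> 1 = 1 \<and>
     (\<forall>x\<in>B. \<forall>y\<in>B. \<xi> (x + y) = \<xi> x + \<xi> y \<and> \<xi> (x * y) = \<xi> x * \<xi> y) \<and>
     (\<forall>c. \<forall>x\<in>B. \<xi> (scaleA D c x) = embK D c * \<xi> x)}"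

definition X :: "('k::field, 'a::comm_ring_1, 'i) endomotive_data \<Rightarrow> ('a \<Rightarrow> complex) set" where
  "X D = alg_homs D UNIV"

text \<open>The topology of the projective limit of the discrete spaces \<open>alg_homs D (level D \<beta>)\<close>.\<close>

definition X_topology :: "('k::field, 'a::comm_ring_1, 'i) endomotive_data \<Rightarrow> ('a \<Rightarrow> complex) topology" where
  "X_topology D =
     pullback_topology (X D) (\<lambda>\<xi>. \<lambda>\<beta>\<in>indices D. restrict \<xi> (level D \<beta>))
       (product_topology (\<lambda>\<beta>. discrete_topology (alg_homs D (level D \<beta>))) (indices D))"


section \<open>Star algebras, states, automorphisms\<close>

record 'b star_algebra = "(complex, 'b) module" +
  adj :: "'b \<Rightarrow> 'b"
  nrm :: "'b \<Rightarrow> real"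

definition star_aut_group :: "('b, 'm) star_algebra_scheme \<Rightarrow> ('b \<Rightarrow> 'b) monoid" where
  "star_aut_group B = BijGroup (carrier B) \<lparr>carrier :=
     {\<theta> \<in> Bij (carrier B). \<theta> \<in> ring_hom B B \<and>
        (\<forall>x\<in>carrier B. (\<forall>c. \<theta> (c \<odot>\<^bsub>B\<^esub> x) = c \<odot>\<^bsub>B\<^esub> \<theta> x) \<and>
           \<theta> (adj B x) = adj B (\<theta> x) \<and> nrm B (\<theta> x) = nrm B x)}\<rparr>"

definition state :: "('b, 'm) star_algebra_scheme \<Rightarrow> ('b \<Rightarrow> complex) \<Rightarrow> bool" where
  "state B \<phi> \<longleftrightarrow>
     (\<forall>x\<in>carrier B. \<forall>y\<in>carrier B. \<phi> (x \<oplus>\<^bsub>B\<^esub> y) = \<phi> x + \<phi> y) \<and>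
     (\<forall>c. \<forall>x\<in>carrier B. \<phi> (c \<odot>\<^bsub>B\<^esub> x) = c * \<phi> x) \<and>
     (\<forall>x\<in>carrier B. \<phi> (adj B x \<otimes>\<^bsub>B\<^esub> x) \<in> \<real>\<^sub>\<ge>\<^sub>0) \<and>
     \<phi> \<one>\<^bsub>B\<^esub> = 1"

text \<open>A pure state is an extreme point of the set of states.\<close>

definition pure_state :: "('b, 'm) star_algebra_scheme \<Rightarrow> ('b \<Rightarrow> complex) \<Rightarrow> bool" where
  "pure_state B \<phi> \<longleftrightarrow> state B \<phi> \<and>
     (\<forall>\<phi>\<^sub>1 \<phi>\<^sub>2. \<forall>t::real. state B \<phi>\<^sub>1 \<and> state B \<phi>\<^sub>2 \<and> 0 < t \<and> t < 1 \<and>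
        (\<forall>x\<in>carrier B. \<phi> x = of_real t * \<phi>\<^sub>1 x + of_real (1 - t) * \<phi>\<^sub>2 x) \<longrightarrow>
        (\<forall>x\<in>carrier B. \<phi>\<^sub>1 x = \<phi> x \<and> \<phi>\<^sub>2 x = \<phi> x))"


section \<open>The algebra \<open>C(X)\<close>\<close>

text \<open>Functions on \<open>X\<close> are represented by functions that vanish outside \<open>X\<close>.\<close>

definition CX :: "('k::field, 'a::comm_ring_1, 'i) endomotive_data \<Rightarrow> (('a \<Rightarrow> complex) \<Rightarrow> complex) star_algebra" where
  "CX D = \<lparr>carrier = {f. continuous_map (X_topology D) euclidean f \<and> (\<forall>\<xi>. \<xi> \<notin> X D \<longrightarrow> f \<xi> = 0)},
     mult = (\<lambda>f g \<xi>. f \<xi> * g \<xi>), one = (\<lambda>\<xi>. of_bool (\<xi> \<in> X D)),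
     zero = (\<lambda>\<xi>. 0), add = (\<lambda>f g \<xi>. f \<xi> + g \<xi>),
     smult = (\<lambda>c f \<xi>. c * f \<xi>), adj = (\<lambda>f \<xi>. cnj (f \<xi>)),
     nrm = (\<lambda>f. SUP \<xi>\<in>X D. cmod (f \<xi>))\<rparr>"

definition hat :: "('k::field, 'a::comm_ring_1, 'i) endomotive_data \<Rightarrow> 'a \<Rightarrow> ('a \<Rightarrow> complex) \<Rightarrow> complex" where
  "hat D a = (\<lambda>\<xi>. if \<xi> \<in> X D then \<xi> a else 0)"

text \<open>The extension of \<open>\<rho>\<close> to \<open>C(X)\<close>. The value \<open>\<xi> (\<rho> 1)\<close> is \<open>0\<close> or \<open>1\<close>; if it is \<open>1\<close> then
  \<open>\<xi> \<circ> \<rho>\<close> is a point of \<open>X\<close>, and one has \<open>endo_CX D \<rho> (hat D a) = hat D (\<rho> a)\<close>.\<close>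

definition endo_CX ::
    "('k::field, 'a::comm_ring_1, 'i) endomotive_data \<Rightarrow> ('a \<Rightarrow> 'a) \<Rightarrow>
     (('a \<Rightarrow> complex) \<Rightarrow> complex) \<Rightarrow> ('a \<Rightarrow> complex) \<Rightarrow> complex" where
  "endo_CX D \<rho> f = (\<lambda>\<xi>. if \<xi> \<in> X D then \<xi> (\<rho> 1) * f (\<xi> \<circ> \<rho>) else 0)"

definition act_X :: "(complex \<Rightarrow> complex) \<Rightarrow> ('a \<Rightarrow> complex) \<Rightarrow> 'a \<Rightarrow> complex" where
  "act_X \<alpha> \<xi> = \<alpha> \<circ> \<xi>"

definition act_CX ::
    "('k::field, 'a::comm_ring_1, 'i) endomotive_data \<Rightarrow> (complex \<Rightarrow> complex) \<Rightarrow>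
     (('a \<Rightarrow> complex) \<Rightarrow> complex) \<Rightarrow> ('a \<Rightarrow> complex) \<Rightarrow> complex" where
  "act_CX D \<alpha> h = (\<lambda>\<xi>. if \<xi> \<in> X D then h (act_X (inv\<^bsub>Gal D\<^esub> \<alpha>) \<xi>) else 0)"


section \<open>Free algebras and presentations\<close>

datatype 'g fword = Word (letters: "'g list")

instantiation fword :: (type) monoid_add
begin

definition zero_fword :: "'a fword" where "zero_fword = Word []"

definition plus_fword :: "'a fword \<Rightarrow> 'a fword \<Rightarrow> 'a fword" where
  "plus_fword v w = Word (letters v @ letters w)"

instance by standard (simp_all add: zero_fword_def plus_fword_def)

end

text \<open>Concatenation of words is the addition of \<open>fword\<close>, so that finitely supported functions on
  words, with the convolution product, form the free associative unital algebra.\<close>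

definition free_algebra :: "'g set \<Rightarrow> ('g fword \<Rightarrow>\<^sub>0 'k::field) ring" where
  "free_algebra V = \<lparr>carrier = {x. \<forall>w\<in>Poly_Mapping.keys x. set (letters w) \<subseteq> V},
     mult = (*), one = 1, zero = 0, add = (+)\<rparr>"

definition gen :: "'g \<Rightarrow> 'g fword \<Rightarrow>\<^sub>0 'k::field" where
  "gen g = Poly_Mapping.single (Word [g]) 1"

definition scal :: "'k \<Rightarrow> 'g fword \<Rightarrow>\<^sub>0 'k::field" where
  "scal c = Poly_Mapping.single 0 c"

text \<open>The additive map sending \<open>c w\<close>, for a scalar \<open>c\<close> and a word \<open>w\<close>, to \<open>\<tau>(c) h(w)\<close>.\<close>

definition semilinear_ext ::
    "('g fword \<Rightarrow> 'h fword) \<Rightarrow> ('k \<Rightarrow> 'l) \<Rightarrow> ('g fword \<Rightarrow>\<^sub>0 'k::field) \<Rightarrow> 'h fword \<Rightarrow>\<^sub>0 'l::field" where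
  "semilinear_ext h \<tau> x =
     (\<Sum>w\<in>Poly_Mapping.keys x. Poly_Mapping.single (h w) (\<tau> (Poly_Mapping.lookup x w)))"

text \<open>The universal \<open>C\<^sup>*\<close>-algebra on a set \<open>V\<close> of generators, closed under the adjoint \<open>s\<close>,
  subject to the relators \<open>R\<close> in the free algebra: the separated completion of the free
  star algebra for the largest \<open>C\<^sup>*\<close>-seminorm that annihilates \<open>R\<close>. Its elements are classes of
  Cauchy sequences modulo null sequences.\<close>

definition free_star :: "('g \<Rightarrow> 'g) \<Rightarrow> ('g fword \<Rightarrow>\<^sub>0 complex) \<Rightarrow> 'g fword \<Rightarrow>\<^sub>0 complex" where
  "free_star s = semilinear_ext (\<lambda>w. Word (map s (rev (letters w)))) cnj"

definition cstar_seminorm :: "'g set \<Rightarrow> ('g \<Rightarrow> 'g) \<Rightarrow> (('g fword \<Rightarrow>\<^sub>0 complex) \<Rightarrow> real) \<Rightarrow> bool" where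
  "cstar_seminorm V s p \<longleftrightarrow>
     (\<forall>x\<in>carrier (free_algebra V). 0 \<le> p x \<and> p (free_star s x * x) = (p x)\<^sup>2 \<and>
        (\<forall>c. p (scal c * x) = cmod c * p x) \<and>
        (\<forall>y\<in>carrier (free_algebra V). p (x + y) \<le> p x + p y \<and> p (x * y) \<le> p x * p y))"

definition max_cstar_seminorm ::
    "'g set \<Rightarrow> ('g \<Rightarrow> 'g) \<Rightarrow> ('g fword \<Rightarrow>\<^sub>0 complex) set \<Rightarrow> ('g fword \<Rightarrow>\<^sub>0 complex) \<Rightarrow> real" where
  "max_cstar_seminorm V s R x = Sup {p x | p. cstar_seminorm V s p \<and> (\<forall>r\<in>R. p r = 0)}"

definition cauchy_ring ::
    "'g set \<Rightarrow> (('g fword \<Rightarrow>\<^sub>0 complex) \<Rightarrow> real) \<Rightarrow> (nat \<Rightarrow> 'g fword \<Rightarrow>\<^sub>0 complex) ring" where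
  "cauchy_ring V p =
     \<lparr>carrier = {u. (\<forall>n. u n \<in> carrier (free_algebra V)) \<and>
                   (\<forall>e>0. \<exists>N. \<forall>m\<ge>N. \<forall>n\<ge>N. p (u m - u n) < e)},
      mult = (\<lambda>u v n. u n * v n), one = (\<lambda>n. 1), zero = (\<lambda>n. 0), add = (\<lambda>u v n. u n + v n)\<rparr>"

definition null_sequences ::
    "'g set \<Rightarrow> (('g fword \<Rightarrow>\<^sub>0 complex) \<Rightarrow> real) \<Rightarrow> (nat \<Rightarrow> 'g fword \<Rightarrow>\<^sub>0 complex) set" where
  "null_sequences V p = {u \<in> carrier (cauchy_ring V p). (\<lambda>n. p (u n)) \<longlonglongrightarrow> 0}"

definition const_class ::
    "'g set \<Rightarrow> (('g fword \<Rightarrow>\<^sub>0 complex) \<Rightarrow> real) \<Rightarrow> ('g fword \<Rightarrow>\<^sub>0 complex) \<Rightarrow>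
     (nat \<Rightarrow> 'g fword \<Rightarrow>\<^sub>0 complex) set" where
  "const_class V p x = null_sequences V p +>\<^bsub>cauchy_ring V p\<^esub> (\<lambda>n. x)"

definition cstar_presented ::
    "'g set \<Rightarrow> ('g \<Rightarrow> 'g) \<Rightarrow> ('g fword \<Rightarrow>\<^sub>0 complex) set \<Rightarrow>
     (nat \<Rightarrow> 'g fword \<Rightarrow>\<^sub>0 complex) set star_algebra" where
  "cstar_presented V s R =
     (let p = max_cstar_seminorm V s R; Q = cauchy_ring V p Quot null_sequences V p in
      \<lparr>carrier = carrier Q, mult = mult Q, one = one Q, zero = zero Q, add = add Q,
       smult = (\<lambda>c Y. const_class V p (scal c) \<otimes>\<^bsub>Q\<^esub> Y),
       adj = (\<lambda>Y. (\<lambda>u n. free_star s (u n)) ` Y),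
       nrm = (\<lambda>Y. the_elem ((\<lambda>u. lim (\<lambda>n. p (u n))) ` Y))\<rparr>)"


section \<open>Crossed products\<close>

datatype ('c, 's) cp_gen = Coef 'c | U 's | Ustar 's

definition cp_gens :: "('k, 'c, 'm) module_scheme \<Rightarrow> 's set \<Rightarrow> ('c, 's) cp_gen set" where
  "cp_gens R S = Coef ` carrier R \<union> U ` S \<union> Ustar ` S"

text \<open>The relations of the crossed product of \<open>R\<close> by \<open>S\<close>, where \<open>\<rho> \<in> S\<close> acts on \<open>R\<close> by
  \<open>e \<rho>\<close>. The first four rules say that \<open>R\<close> is mapped to the crossed product by a unital algebra
  homomorphism.\<close>

inductive cp_relation ::
    "('k::field, 'c, 'm) module_scheme \<Rightarrow> ('a \<Rightarrow> 'a) set \<Rightarrow> (('a \<Rightarrow> 'a) \<Rightarrow> 'c \<Rightarrow> 'c) \<Rightarrow>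
     (('c, 'a \<Rightarrow> 'a) cp_gen fword \<Rightarrow>\<^sub>0 'k) \<Rightarrow> (('c, 'a \<Rightarrow> 'a) cp_gen fword \<Rightarrow>\<^sub>0 'k) \<Rightarrow> bool"
  for R S e where
  "x \<in> carrier R \<Longrightarrow> y \<in> carrier R \<Longrightarrow>
     cp_relation R S e (gen (Coef (x \<oplus>\<^bsub>R\<^esub> y))) (gen (Coef x) + gen (Coef y))"
| "x \<in> carrier R \<Longrightarrow> y \<in> carrier R \<Longrightarrow>
     cp_relation R S e (gen (Coef (x \<otimes>\<^bsub>R\<^esub> y))) (gen (Coef x) * gen (Coef y))"
| "x \<in> carrier R \<Longrightarrow> cp_relation R S e (gen (Coef (c \<odot>\<^bsub>R\<^esub> x))) (scal c * gen (Coef x))"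
| "cp_relation R S e (gen (Coef \<one>\<^bsub>R\<^esub>)) 1"
| "\<rho> \<in> S \<Longrightarrow> cp_relation R S e (gen (Ustar \<rho>) * gen (U \<rho>)) 1"
| "\<rho> \<in> S \<Longrightarrow> cp_relation R S e (gen (U \<rho>) * gen (Ustar \<rho>)) (gen (Coef (e \<rho> \<one>\<^bsub>R\<^esub>)))"
| "\<rho> \<in> S \<Longrightarrow> \<tau> \<in> S \<Longrightarrow> cp_relation R S e (gen (U (\<rho> \<circ> \<tau>))) (gen (U \<rho>) * gen (U \<tau>))"
| "\<rho> \<in> S \<Longrightarrow> \<tau> \<in> S \<Longrightarrow> cp_relation R S e (gen (Ustar (\<tau> \<circ> \<rho>))) (gen (Ustar \<rho>) * gen (Ustar \<tau>))"
| "\<rho> \<in> S \<Longrightarrow> x \<in> carrier R \<Longrightarrow>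
     cp_relation R S e (gen (U \<rho>) * gen (Coef x)) (gen (Coef (e \<rho> x)) * gen (U \<rho>))"
| "\<rho> \<in> S \<Longrightarrow> x \<in> carrier R \<Longrightarrow>
     cp_relation R S e (gen (Coef x) * gen (Ustar \<rho>)) (gen (Ustar \<rho>) * gen (Coef (e \<rho> x)))"

definition cp_relators ::
    "('k::field, 'c, 'm) module_scheme \<Rightarrow> ('a \<Rightarrow> 'a) set \<Rightarrow> (('a \<Rightarrow> 'a) \<Rightarrow> 'c \<Rightarrow> 'c) \<Rightarrow>
     (('c, 'a \<Rightarrow> 'a) cp_gen fword \<Rightarrow>\<^sub>0 'k) set" where
  "cp_relators R S e = {x - y | x y. cp_relation R S e x y}"

definition A_alg :: "('k::field, 'a::comm_ring_1, 'i) endomotive_data \<Rightarrow> ('k, 'a) module" where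
  "A_alg D = \<lparr>carrier = UNIV, mult = (*), one = 1, zero = 0, add = (+), smult = scaleA D\<rparr>"

text \<open>The algebraic crossed product of \<open>A\<close> by \<open>S\<close> over \<open>K\<close>.\<close>

definition alg_cp ::
    "('k::field, 'a::comm_ring_1, 'i) endomotive_data \<Rightarrow> (('a, 'a \<Rightarrow> 'a) cp_gen fword \<Rightarrow>\<^sub>0 'k) set ring" where
  "alg_cp D = (let F = free_algebra (cp_gens (A_alg D) (endos D)) in
     F Quot (Idl\<^bsub>F\<^esub> (cp_relators (A_alg D) (endos D) (\<lambda>\<rho>. \<rho>))))"

text \<open>The \<open>C\<^sup>*\<close>-crossed product of \<open>C(X)\<close> by \<open>S\<close>.\<close>

type_synonym 'a cp_free = "(('a \<Rightarrow> complex) \<Rightarrow> complex, 'a \<Rightarrow> 'a) cp_gen fword \<Rightarrow>\<^sub>0 complex"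

fun cp_adj :: "(('a \<Rightarrow> complex) \<Rightarrow> complex, 's) cp_gen \<Rightarrow> (('a \<Rightarrow> complex) \<Rightarrow> complex, 's) cp_gen" where
  "cp_adj (Coef f) = Coef (\<lambda>\<xi>. cnj (f \<xi>))"
| "cp_adj (U \<rho>) = Ustar \<rho>"
| "cp_adj (Ustar \<rho>) = U \<rho>"

definition cstar_cp ::
    "('k::field, 'a::comm_ring_1, 'i) endomotive_data \<Rightarrow> (nat \<Rightarrow> 'a cp_free) set star_algebra" where
  "cstar_cp D = cstar_presented (cp_gens (CX D) (endos D)) cp_adj
     (cp_relators (CX D) (endos D) (endo_CX D))"

definition cp_class ::
    "('k::field, 'a::comm_ring_1, 'i) endomotive_data \<Rightarrow> 'a cp_free \<Rightarrow> (nat \<Rightarrow> 'a cp_free) set" where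
  "cp_class D = const_class (cp_gens (CX D) (endos D))
     (max_cstar_seminorm (cp_gens (CX D) (endos D)) cp_adj
        (cp_relators (CX D) (endos D) (endo_CX D)))"

definition \<iota> ::
    "('k::field, 'a::comm_ring_1, 'i) endomotive_data \<Rightarrow> (('a \<Rightarrow> complex) \<Rightarrow> complex) \<Rightarrow>
     (nat \<Rightarrow> 'a cp_free) set" where
  "\<iota> D f = cp_class D (gen (Coef f))"

definition isom ::
    "('k::field, 'a::comm_ring_1, 'i) endomotive_data \<Rightarrow> ('a \<Rightarrow> 'a) \<Rightarrow> (nat \<Rightarrow> 'a cp_free) set" where
  "isom D \<rho> = cp_class D (gen (U \<rho>))"

text \<open>The canonical map from the algebraic to the \<open>C\<^sup>*\<close>-crossed product, and its image.\<close>

definition alg_to_cstar ::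
    "('k::field, 'a::comm_ring_1, 'i) endomotive_data \<Rightarrow>
     (('a, 'a \<Rightarrow> 'a) cp_gen fword \<Rightarrow>\<^sub>0 'k) set \<Rightarrow> (nat \<Rightarrow> 'a cp_free) set" where
  "alg_to_cstar D Y =
     the_elem ((\<lambda>x. cp_class D
       (semilinear_ext (map_fword (map_cp_gen (hat D) id)) (embK D) x)) ` Y)"

definition alg_part ::
    "('k::field, 'a::comm_ring_1, 'i) endomotive_data \<Rightarrow> (nat \<Rightarrow> 'a cp_free) set set" where
  "alg_part D = alg_to_cstar D ` carrier (alg_cp D)"

text \<open>The last conjunct determines \<open>E\<close>, because the monomials span a dense subspace and \<open>E\<close> is
  linear and contractive.\<close>

definition canonical_expectation ::
    "('k::field, 'a::comm_ring_1, 'i) endomotive_data \<Rightarrow>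
     ((nat \<Rightarrow> 'a cp_free) set \<Rightarrow> ('a \<Rightarrow> complex) \<Rightarrow> complex) \<Rightarrow> bool" where
  "canonical_expectation D E \<longleftrightarrow>
     (\<forall>x\<in>carrier (cstar_cp D).
        E x \<in> carrier (CX D) \<and> nrm (CX D) (E x) \<le> nrm (cstar_cp D) x \<and>
        (\<forall>\<xi>. E (adj (cstar_cp D) x \<otimes>\<^bsub>cstar_cp D\<^esub> x) \<xi> \<in> \<real>\<^sub>\<ge>\<^sub>0) \<and>
        (\<forall>c. E (c \<odot>\<^bsub>cstar_cp D\<^esub> x) = c \<odot>\<^bsub>CX D\<^esub> E x) \<and>
        (\<forall>y\<in>carrier (cstar_cp D). E (x \<oplus>\<^bsub>cstar_cp D\<^esub> y) = E x \<oplus>\<^bsub>CX D\<^esub> E y) \<and>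
        (\<forall>f\<in>carrier (CX D). \<forall>g\<in>carrier (CX D).
           E (\<iota> D f \<otimes>\<^bsub>cstar_cp D\<^esub> x \<otimes>\<^bsub>cstar_cp D\<^esub> \<iota> D g) = f \<otimes>\<^bsub>CX D\<^esub> E x \<otimes>\<^bsub>CX D\<^esub> g)) \<and>
     (\<forall>f\<in>carrier (CX D). E (\<iota> D f) = f) \<and>
     (\<forall>\<rho>\<in>endos D. \<forall>\<tau>\<in>endos D. \<forall>f\<in>carrier (CX D).
        E (adj (cstar_cp D) (isom D \<rho>) \<otimes>\<^bsub>cstar_cp D\<^esub> \<iota> D f \<otimes>\<^bsub>cstar_cp D\<^esub> isom D \<tau>) =
          (if \<rho> = \<tau>
           then inv_into (carrier (CX D)) (endo_CX D \<rho>) (endo_CX D \<rho> \<one>\<^bsub>CX D\<^esub> \<otimes>\<^bsub>CX D\<^esub> f)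
           else \<zero>\<^bsub>CX D\<^esub>))"

definition induced_by_pure_state ::
    "('k::field, 'a::comm_ring_1, 'i) endomotive_data \<Rightarrow> ((nat \<Rightarrow> 'a cp_free) set \<Rightarrow> complex) \<Rightarrow> bool" where
  "induced_by_pure_state D \<phi> \<longleftrightarrow>
     (\<exists>E \<omega>. canonical_expectation D E \<and> pure_state (CX D) \<omega> \<and>
        (\<forall>x\<in>carrier (cstar_cp D). \<phi> x = \<omega> (E x)))"

text \<open>\<open>\<Theta>\<close> is an action of the Galois group on the \<open>C\<^sup>*\<close>-crossed product that extends the action on
  \<open>C(X)\<close> and fixes the isometries \<open>U\<^sub>\<rho>\<close> (hence their adjoints).\<close>

definition canonical_action ::
    "('k::field, 'a::comm_ring_1, 'i) endomotive_data \<Rightarrow>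
     ((complex \<Rightarrow> complex) \<Rightarrow> (nat \<Rightarrow> 'a cp_free) set \<Rightarrow> (nat \<Rightarrow> 'a cp_free) set) \<Rightarrow> bool" where
  "canonical_action D \<Theta> \<longleftrightarrow>
     \<Theta> \<in> hom (Gal D) (star_aut_group (cstar_cp D)) \<and>
     (\<forall>\<alpha>\<in>carrier (Gal D).
        (\<forall>f\<in>carrier (CX D). \<Theta> \<alpha> (\<iota> D f) = \<iota> D (act_CX D \<alpha> f)) \<and>
        (\<forall>\<rho>\<in>endos D. \<Theta> \<alpha> (isom D \<rho>) = isom D \<rho>))"

end

theory Submission
  imports Defs
begin

text \<open>
  The levels are finite dimensional. Therefore the topology of \<open>X\<close> is that of pointwise convergence
  with discrete values (\<open>openin_X\<close>), and every \<open>a\<close> in \<open>A\<close> is algebraic over \<open>K\<close>, so that all characters take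
  its value in one finite subset of \<open>Kbar\<close> (\<open>finite_values\<close>). It follows that \<open>X\<close> is compact, and that the
  action of \<open>G\<close> by composition is continuous and commutes with the endomorphisms.

  The C*-crossed product is the completion of a free star algebra
  for the largest C*-seminorm that kills the relators. That seminorm is finite because the
  admissible seminorms are bounded on the generators: \<open>\<parallel>U\<^sub>\<rho>\<parallel> \<le> 1\<close> follows from \<open>U\<^sub>\<rho>\<^sup>* U\<^sub>\<rho> = 1\<close>, and a
  function on \<open>X\<close> is bounded and therefore a linear combination of unitaries. An element of \<open>G\<close>
  permutes the generators, respects the adjoint and maps relators to relators; by maximality it
  preserves the seminorm, so it extends to an isometric automorphism (\<open>induced_aut\<close>). It is the only
  one with the prescribed values because the generators generate a dense subalgebra (\<open>aut_eq_on_dense\<close>).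

  A pure state takes only the values \<open>0\<close> and \<open>1\<close> on projections. The function \<open>hat a\<close> is a
  finite combination of the orthogonal projections onto the sets \<open>\<xi>(a) = z\<close>, so a pure state evaluates
  every function of \<open>\<xi>(a)\<close> at one algebraic number \<open>z\<close> (\<open>pure_state_value\<close>). Applied to the identity
  and to \<open>\<alpha>\<close> this is the intertwining relation on \<open>A\<close>.

  If a level is a product of abelian extensions \<open>L\<^sub>j\<close>, a character passes
  through one factor (\<open>character_factors\<close>), and its restriction to that factor as well as the restriction
  of \<open>\<alpha>\<close> are elements of the abelian group \<open>Gal(L\<^sub>j/K)\<close> (\<open>hom_galois\<close>). They commute, so \<open>\<alpha>(\<xi>(a)) = \<xi>(b)\<close>
  where \<open>b\<close> is obtained by applying \<open>\<alpha>\<close> to the components of \<open>a\<close>. Thus \<open>A\<close> is invariant, \<open>G\<close> acts on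
  \<open>A\<close> and on the algebraic crossed product by commuting automorphisms, and the action passes to the
  abelianization. Finally every element of the algebraic crossed product is a sum of monomials
  \<open>U\<^sub>\<rho>\<^sup>* a U\<^sub>\<tau>\<close> (\<open>word_normal_form\<close>), on which the conditional expectation has values in \<open>A\<close> and
  commutes with \<open>G\<close> (\<open>expectation_galois\<close>); this reduces the statement on induced states to the one
  on pure states of \<open>C(X)\<close>.
\<close>

section \<open>Free algebras and substitution of letters\<close>

abbreviation free_carrier :: "'g set \<Rightarrow> ('g fword \<Rightarrow>\<^sub>0 'k::field) set" where
  "free_carrier V \<equiv> carrier (free_algebra V)"

lemma free_carrier_iff: "x \<in> free_carrier V \<longleftrightarrow> (\<forall>w\<in>Poly_Mapping.keys x. set (letters w) \<subseteq> V)"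
  by (simp add: free_algebra_def)

lemma letters_zero [simp]: "letters 0 = []"
  by (simp add: zero_fword_def)

lemma letters_plus [simp]: "letters (v + w) = letters v @ letters w"
  by (simp add: plus_fword_def)

lemma free_zero [simp]: "0 \<in> free_carrier V"
  by (simp add: free_carrier_iff)

lemma free_single: "set (letters w) \<subseteq> V \<Longrightarrow> Poly_Mapping.single w c \<in> free_carrier V"
  by (auto simp: free_carrier_iff split: if_splits)

lemma free_one [simp]: "1 \<in> free_carrier V"
  by (simp add: free_carrier_iff)

lemma free_gen: "g \<in> V \<Longrightarrow> gen g \<in> free_carrier V"
  by (simp add: gen_def free_single)

lemma free_scal [simp]: "scal c \<in> free_carrier V"
  by (simp add: scal_def free_single)

lemma free_add: "x \<in> free_carrier V \<Longrightarrow> y \<in> free_carrier V \<Longrightarrow> x + y \<in> free_carrier V"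
  using keys_add[of x y] by (force simp: free_carrier_iff)

lemma free_uminus: "x \<in> free_carrier V \<Longrightarrow> - x \<in> free_carrier V"
  by (simp add: free_carrier_iff in_keys_iff)

lemma free_diff: "x \<in> free_carrier V \<Longrightarrow> y \<in> free_carrier V \<Longrightarrow> x - y \<in> free_carrier V"
  using free_add[of x V "- y"] by (simp add: free_uminus)

lemma free_mult: "x \<in> free_carrier V \<Longrightarrow> y \<in> free_carrier V \<Longrightarrow> x * y \<in> free_carrier V"
  using keys_mult[of x y] by (fastforce simp: free_carrier_iff)

lemmas free_closed = free_single free_gen free_add free_uminus free_diff free_mult

lemma poly_mapping_sum_singles:
  assumes "finite A" "Poly_Mapping.keys x \<subseteq> A"
  shows "x = (\<Sum>w\<in>A. Poly_Mapping.single w (Poly_Mapping.lookup x w))"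
proof (rule poly_mapping_eqI)
  fix k
  have "(\<Sum>w\<in>A. Poly_Mapping.lookup (Poly_Mapping.single w (Poly_Mapping.lookup x w)) k)
      = (\<Sum>w\<in>A. if w = k then Poly_Mapping.lookup x k else 0)"
    by (rule sum.cong) (auto simp: lookup_single when_def)
  also have "\<dots> = Poly_Mapping.lookup x k"
    using assms by (auto simp: in_keys_iff)
  finally show "Poly_Mapping.lookup x k
      = Poly_Mapping.lookup (\<Sum>w\<in>A. Poly_Mapping.single w (Poly_Mapping.lookup x w)) k"
    by (simp add: lookup_sum)
qed

lemma free_induct [consumes 1, case_names single add]:
  assumes x: "x \<in> free_carrier V"
    and single: "\<And>w c. set (letters w) \<subseteq> V \<Longrightarrow> P (Poly_Mapping.single w c)"
    and add: "\<And>x y. x \<in> free_carrier V \<Longrightarrow> y \<in> free_carrier V \<Longrightarrow> P x \<Longrightarrow> P y \<Longrightarrow> P (x + y)"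
  shows "P x"
proof -
  have P0: "P 0" using single[of "Word []" 0] by simp
  have "(\<Sum>w\<in>A. Poly_Mapping.single w (Poly_Mapping.lookup x w)) \<in> free_carrier V \<and>
        P (\<Sum>w\<in>A. Poly_Mapping.single w (Poly_Mapping.lookup x w))"
    if "finite A" "A \<subseteq> Poly_Mapping.keys x" for A
    using that
  proof (induction A rule: finite_induct)
    case empty
    then show ?case using P0 by simp
  next
    case (insert w A)
    then have "set (letters w) \<subseteq> V" using x by (auto simp: free_carrier_iff)
    with insert show ?case by (auto intro!: free_add free_single add single simp del: subset_eq)
  qed
  from this[of "Poly_Mapping.keys x"] show ?thesis
    using poly_mapping_sum_singles[of "Poly_Mapping.keys x" x] by simp
qed

lemma in_free_UNIV [simp]: "x \<in> free_carrier UNIV"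
  by (simp add: free_carrier_iff)

lemma ring_free_algebra: "ring (free_algebra V)"
proof (rule ringI)
  show "abelian_group (free_algebra V)"
  proof (rule abelian_groupI)
    fix x assume "x \<in> free_carrier V"
    then show "\<exists>y\<in>free_carrier V. y \<oplus>\<^bsub>free_algebra V\<^esub> x = \<zero>\<^bsub>free_algebra V\<^esub>"
      by (intro bexI[of _ "- x"] free_uminus) (simp_all add: free_algebra_def)
  qed (use free_add[of _ V] in \<open>simp_all add: free_algebra_def add_ac\<close>)
  show "monoid (free_algebra V)"
    by (rule monoidI) (use free_mult[of _ V] free_one[of V] in \<open>simp_all add: free_algebra_def mult.assoc\<close>)
qed (auto simp: free_algebra_def algebra_simps)

lemma scal_mult_single: "scal c * Poly_Mapping.single w d = Poly_Mapping.single w (c * d)"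
  by (simp add: scal_def mult_single)

lemma scal_mult: "scal c * scal d = scal (c * d)"
  by (simp add: scal_def mult_single)

lemma scal_1 [simp]: "scal 1 = 1"
  by (simp add: scal_def)

lemma scal_minus_1: "scal (-1) * x = - x"
  by (simp add: scal_def single_uminus[of 0 1])

lemma single_word_eq: "Poly_Mapping.single w c = scal c * prod_list (map gen (letters w))"
proof -
  have "Poly_Mapping.single (Word gs) (1::'b) = prod_list (map gen gs)" for gs :: "'a list"
  proof (induction gs)
    case Nil
    then show ?case using single_one zero_fword_def by (metis list.map(1) prod_list.Nil)
  next
    case (Cons g gs)
    have "Poly_Mapping.single (Word (g # gs)) (1::'b) = gen g * Poly_Mapping.single (Word gs) 1"
      by (simp add: gen_def mult_single plus_fword_def)
    then show ?case using Cons by simp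
  qed
  from this[of "letters w"] show ?thesis
    using scal_mult_single[of c w 1] by simp
qed

lemma free_prod_list: "set gs \<subseteq> V \<Longrightarrow> prod_list (map gen gs) \<in> free_carrier V"
  by (induction gs) (auto intro: free_closed)

lemma semilinear_ext_superset:
  assumes "finite A" "Poly_Mapping.keys x \<subseteq> A" "\<tau> 0 = 0"
  shows "semilinear_ext h \<tau> x = (\<Sum>w\<in>A. Poly_Mapping.single (h w) (\<tau> (Poly_Mapping.lookup x w)))"
  unfolding semilinear_ext_def
  by (rule sum.mono_neutral_left) (use assms in \<open>auto simp: in_keys_iff\<close>)

lemma semilinear_ext_single:
  "\<tau> 0 = 0 \<Longrightarrow> semilinear_ext h \<tau> (Poly_Mapping.single w c) = Poly_Mapping.single (h w) (\<tau> c)"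
  by (subst semilinear_ext_superset[of "{w}"]) auto

lemma semilinear_ext_add:
  assumes "\<tau> 0 = 0" "\<And>a b. \<tau> (a + b) = \<tau> a + \<tau> b"
  shows "semilinear_ext h \<tau> (x + y) = semilinear_ext h \<tau> x + semilinear_ext h \<tau> y"
proof -
  let ?A = "Poly_Mapping.keys x \<union> Poly_Mapping.keys y"
  show ?thesis
    by (subst (1 2 3) semilinear_ext_superset[of ?A])
      (use keys_add[of x y] assms in \<open>auto simp: lookup_add single_add sum.distrib\<close>)
qed

subsection \<open>Substitution of letters\<close>

text \<open>A map of generators \<open>g\<close> together with a homomorphism of fields \<open>\<tau>\<close> gives a ring homomorphism
  between free algebras. Both the map from the algebraic to the \<open>C\<^sup>*\<close>-crossed product and the
  Galois action arise in this way.\<close>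

abbreviation subst_letters ::
    "('g \<Rightarrow> 'h) \<Rightarrow> ('k \<Rightarrow> 'l) \<Rightarrow> ('g fword \<Rightarrow>\<^sub>0 'k::field) \<Rightarrow> 'h fword \<Rightarrow>\<^sub>0 'l::field" where
  "subst_letters g \<tau> \<equiv> semilinear_ext (map_fword g) \<tau>"

lemma letters_map_fword [simp]: "letters (map_fword g w) = map g (letters w)"
  by (cases w) simp

lemma map_fword_plus: "map_fword g (v + w) = map_fword g v + map_fword g w"
  by (cases v; cases w) (simp add: plus_fword_def)

lemma map_fword_zero [simp]: "map_fword g 0 = 0"
  by (simp add: zero_fword_def)

definition ring_map :: "('k::ring_1 \<Rightarrow> 'l::ring_1) \<Rightarrow> bool" where
  "ring_map \<tau> \<longleftrightarrow> \<tau> 0 = 0 \<and> \<tau> 1 = 1 \<and> (\<forall>a b. \<tau> (a + b) = \<tau> a + \<tau> b) \<and> (\<forall>a b. \<tau> (a * b) = \<tau> a * \<tau> b)"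

lemma ring_map_id: "ring_map (\<lambda>c. c)"
  by (simp add: ring_map_def)

context
  fixes \<tau> :: "'k::field \<Rightarrow> 'l::field"
  assumes \<tau>: "ring_map \<tau>"
begin

lemma subst_single: "subst_letters g \<tau> (Poly_Mapping.single w c) = Poly_Mapping.single (map_fword g w) (\<tau> c)"
  using \<tau> by (simp add: semilinear_ext_single ring_map_def)

lemma subst_add: "subst_letters g \<tau> (x + y) = subst_letters g \<tau> x + subst_letters g \<tau> y"
  using \<tau> by (simp add: semilinear_ext_add ring_map_def)

lemma subst_zero: "subst_letters g \<tau> 0 = 0"
  by (simp add: semilinear_ext_def)

lemma subst_gen: "subst_letters g \<tau> (gen a) = gen (g a)"
  using \<tau> by (simp add: gen_def subst_single ring_map_def)

lemma subst_scal: "subst_letters g \<tau> (scal c) = scal (\<tau> c)"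
  by (simp add: scal_def subst_single)

lemma subst_one: "subst_letters g \<tau> 1 = 1"
  using subst_scal[of g 1] \<tau> by (simp add: ring_map_def)

lemma subst_mult: "subst_letters g \<tau> (x * y) = subst_letters g \<tau> x * subst_letters g \<tau> y"
proof -
  have single: "subst_letters g \<tau> (Poly_Mapping.single v c * y)
      = subst_letters g \<tau> (Poly_Mapping.single v c) * subst_letters g \<tau> y" for v c
  proof -
    have "y \<in> free_carrier UNIV" by simp
    then show ?thesis
    proof (induction y rule: free_induct)
      case (single w d)
      then show ?case using \<tau> by (simp add: mult_single subst_single map_fword_plus ring_map_def)
    qed (simp add: distrib_left subst_add)
  qed
  have "x \<in> free_carrier UNIV" by simp
  then show ?thesis
    by (induction x rule: free_induct) (simp_all add: single distrib_right subst_add)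
qed

lemma subst_uminus: "subst_letters g \<tau> (- x) = - subst_letters g \<tau> x"
  using subst_add[of g x "- x"] by (simp add: subst_zero eq_neg_iff_add_eq_0 add.commute)

lemma subst_diff: "subst_letters g \<tau> (x - y) = subst_letters g \<tau> x - subst_letters g \<tau> y"
  using subst_add[of g x "- y"] by (simp add: subst_uminus)

lemmas subst_simps = subst_add subst_zero subst_gen subst_scal subst_one subst_mult subst_uminus subst_diff

lemma subst_closed:
  assumes "x \<in> free_carrier V" "\<And>a. a \<in> V \<Longrightarrow> g a \<in> W"
  shows "subst_letters g \<tau> x \<in> free_carrier W"
  using assms(1)
proof (induction x rule: free_induct)
  case (single w c)
  then have "set (letters (map_fword g w)) \<subseteq> W" using assms(2) by auto
  then show ?case by (simp add: subst_single free_single)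
qed (simp add: subst_add free_add)

end

lemma subst_comp:
  assumes "ring_map \<tau>" "ring_map \<tau>'" "x \<in> free_carrier V" "\<And>a. a \<in> V \<Longrightarrow> g (g' a) = k a"
    "\<And>c. \<tau> (\<tau>' c) = \<kappa> c" 
  shows "subst_letters g \<tau> (subst_letters g' \<tau>' x) = subst_letters k \<kappa> x"
proof -
  have \<kappa>: "ring_map \<kappa>"
    using assms(1,2) unfolding ring_map_def assms(5)[symmetric] by simp
  from assms(3) show ?thesis
  proof (induction x rule: free_induct)
    case (single w c)
    have "map_fword g (map_fword g' w) = map_fword k w"
      using single assms(4) by (cases w) auto
    then show ?case
      by (simp add: subst_single[OF assms(1)] subst_single[OF assms(2)] subst_single[OF \<kappa>] assms(5))
  qed (simp add: subst_add[OF assms(1)] subst_add[OF assms(2)] subst_add[OF \<kappa>])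
qed

lemma subst_id:
  assumes "x \<in> free_carrier V" "\<And>a. a \<in> V \<Longrightarrow> g a = a"
  shows "subst_letters g (\<lambda>c. c) x = x"
  using assms(1)
proof (induction x rule: free_induct)
  case (single w c)
  have "map_fword g w = w"
    using single assms(2) by (cases w) (auto intro!: map_idI)
  then show ?case by (simp add: subst_single[OF ring_map_id])
qed (simp add: subst_add[OF ring_map_id])

subsection \<open>The star operation\<close>

lemma star_single:
  "free_star s (Poly_Mapping.single w c) = Poly_Mapping.single (Word (map s (rev (letters w)))) (cnj c)"
  by (simp add: free_star_def semilinear_ext_single)

lemma star_add: "free_star s (x + y) = free_star s x + free_star s y"
  by (simp add: free_star_def semilinear_ext_add)

lemma star_zero [simp]: "free_star s 0 = 0"
  by (simp add: free_star_def semilinear_ext_def)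

lemma star_gen: "free_star s (gen a) = gen (s a)"
  by (simp add: gen_def star_single)

lemma star_scal: "free_star s (scal c) = scal (cnj c)"
  by (simp add: scal_def star_single zero_fword_def)

lemma star_one [simp]: "free_star s 1 = 1"
  using star_scal[of s 1] by simp

lemma star_uminus: "free_star s (- x) = - free_star s x"
  using star_add[of s x "- x"] by (simp add: eq_neg_iff_add_eq_0 add.commute)

lemma star_diff: "free_star s (x - y) = free_star s x - free_star s y"
  using star_add[of s x "- y"] by (simp add: star_uminus)

lemma star_closed:
  assumes "x \<in> free_carrier V" "\<And>a. a \<in> V \<Longrightarrow> s a \<in> V"
  shows "free_star s x \<in> free_carrier V"
  using assms(1)
proof (induction x rule: free_induct)
  case (single w c)
  then have "set (map s (rev (letters w))) \<subseteq> V" using assms(2) by auto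
  then show ?case by (simp add: star_single free_single)
qed (simp add: star_add free_add)

lemma star_star:
  assumes "\<And>a. s (s a) = a"
  shows "free_star s (free_star s x) = x"
proof -
  have "x \<in> free_carrier UNIV" by simp
  then show ?thesis
  proof (induction x rule: free_induct)
    case (single w c)
    have "s \<circ> s = id" using assms by auto
    then show ?case by (simp add: star_single rev_map)
  qed (simp add: star_add)
qed

lemma star_subst:
  assumes "x \<in> free_carrier V" "\<And>a. a \<in> V \<Longrightarrow> s (g a) = g (s a)"
  shows "free_star s (subst_letters g (\<lambda>c. c) x) = subst_letters g (\<lambda>c. c) (free_star s x)"
  using assms(1)
proof (induction x rule: free_induct)
  case (single w c)
  have "map s (rev (map g (letters w))) = map g (map s (rev (letters w)))"
    using single assms(2) by (auto simp: rev_map)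
  then show ?case
    by (simp add: star_single subst_single[OF ring_map_id] del: map_map)
qed (simp add: star_add subst_add[OF ring_map_id])

section \<open>C*-algebras given by generators and relations\<close>

lemma cstar_seminorm_one:
  assumes "cstar_seminorm V s p"
  shows "p 1 \<le> 1"
proof -
  have "p (free_star s 1 * 1) = (p 1)\<^sup>2"
    using assms free_one[of V] unfolding cstar_seminorm_def by blast
  then have "p 1 * p 1 = p 1" by (simp add: power2_eq_square)
  then show ?thesis by (auto simp: mult_cancel_right1)
qed

text \<open>The bound on the generators, uniform in the seminorm, is what makes the supremum in the
  definition of the maximal seminorm finite.\<close>

locale star_presentation =
  fixes V :: "'g set" and s :: "'g \<Rightarrow> 'g" and R :: "('g fword \<Rightarrow>\<^sub>0 complex) set"
  assumes s_closed: "\<And>a. a \<in> V \<Longrightarrow> s a \<in> V"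
    and s_invol: "\<And>a. s (s a) = a"
    and gen_bounded: "\<And>a. a \<in> V \<Longrightarrow>
      \<exists>M. \<forall>p. cstar_seminorm V s p \<and> (\<forall>r\<in>R. p r = 0) \<longrightarrow> p (gen a) \<le> M"
begin

definition admissible :: "(('g fword \<Rightarrow>\<^sub>0 complex) \<Rightarrow> real) \<Rightarrow> bool" where
  "admissible p \<longleftrightarrow> cstar_seminorm V s p \<and> (\<forall>r\<in>R. p r = 0)"

definition P :: "('g fword \<Rightarrow>\<^sub>0 complex) \<Rightarrow> real" where
  "P = max_cstar_seminorm V s R"

lemma free_star_closed: "x \<in> free_carrier V \<Longrightarrow> free_star s x \<in> free_carrier V"
  by (rule star_closed) (auto intro: s_closed)

lemma free_star_star: "free_star s (free_star s x) = x"
  by (rule star_star) (rule s_invol)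

lemma adm_zero: "admissible (\<lambda>_. 0)"
  by (simp add: admissible_def cstar_seminorm_def)

lemma admD:
  assumes "admissible p" "x \<in> free_carrier V"
  shows "0 \<le> p x" "p (free_star s x * x) = (p x)\<^sup>2" "p (scal c * x) = cmod c * p x"
    "y \<in> free_carrier V \<Longrightarrow> p (x + y) \<le> p x + p y"
    "y \<in> free_carrier V \<Longrightarrow> p (x * y) \<le> p x * p y"
  using assms unfolding admissible_def cstar_seminorm_def by blast+

lemma adm_bounded:
  assumes "x \<in> free_carrier V"
  shows "\<exists>M. \<forall>p. admissible p \<longrightarrow> p x \<le> M"
  using assms
proof (induction x rule: free_induct)
  case (single w c)
  have "\<exists>M. \<forall>p. admissible p \<longrightarrow> p (prod_list (map gen gs)) \<le> M" if "set gs \<subseteq> V" for gs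
    using that
  proof (induction gs)
    case Nil
    then show ?case using cstar_seminorm_one by (auto simp: admissible_def intro!: exI[of _ 1])
  next
    case (Cons a gs)
    obtain M where M: "\<And>p. admissible p \<Longrightarrow> p (prod_list (map gen gs)) \<le> M" using Cons by auto
    obtain N where N: "\<And>p. admissible p \<Longrightarrow> p (gen a) \<le> N"
      using gen_bounded[of a] Cons.prems unfolding admissible_def by auto
    show ?case
    proof (intro exI[of _ "N * M"] allI impI)
      fix p assume p: "admissible p"
      have a: "gen a \<in> free_carrier V" and gs: "prod_list (map gen gs) \<in> free_carrier V"
        using Cons.prems by (auto intro: free_gen free_prod_list)
      have "p (gen a * prod_list (map gen gs)) \<le> p (gen a) * p (prod_list (map gen gs))"
        using admD(5)[OF p a gs] .
      also have "\<dots> \<le> N * M"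
        using N[OF p] M[OF p] admD(1)[OF p a] admD(1)[OF p gs] by (intro mult_mono) auto
      finally show "p (prod_list (map gen (a # gs))) \<le> N * M" by simp
    qed
  qed
  from this[OF single] obtain M where M: "\<And>p. admissible p \<Longrightarrow> p (prod_list (map gen (letters w))) \<le> M" by auto
  show ?case
  proof (intro exI[of _ "cmod c * M"] allI impI)
    fix p assume p: "admissible p"
    show "p (Poly_Mapping.single w c) \<le> cmod c * M"
      unfolding single_word_eq[of w c] admD(3)[OF p free_prod_list[OF single]]
      using M[OF p] by (rule mult_left_mono) simp
  qed
next
  case (add x y)
  then obtain M N where "\<And>p. admissible p \<Longrightarrow> p x \<le> M" "\<And>p. admissible p \<Longrightarrow> p y \<le> N" by blast
  then have "p (x + y) \<le> M + N" if "admissible p" for p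
    using admD(4)[OF that add(1,2)] that by (smt (verit))
  then show ?case by blast
qed

lemma P_upper:
  assumes "admissible p" "x \<in> free_carrier V"
  shows "p x \<le> P x"
proof -
  obtain M where "\<And>p. admissible p \<Longrightarrow> p x \<le> M" using adm_bounded[OF assms(2)] by blast
  then have "bdd_above {p x | p. admissible p}" by (auto simp: bdd_above_def)
  then show ?thesis unfolding P_def max_cstar_seminorm_def admissible_def[symmetric]
    using assms(1) by (intro cSup_upper) auto
qed

lemma P_least:
  assumes "\<And>p. admissible p \<Longrightarrow> p x \<le> B"
  shows "P x \<le> B"
  unfolding P_def max_cstar_seminorm_def admissible_def[symmetric]
  by (rule cSup_least) (use assms adm_zero in auto)

text \<open>All conditions on a C*-seminorm pass to the supremum; for the C*-identity one compares
  \<open>p x = sqrt (p (x\<^sup>* x))\<close> in both directions.\<close>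

lemma P_adm: "admissible P"
proof -
  have nn: "0 \<le> P x" if "x \<in> free_carrier V" for x
    using P_upper[OF adm_zero that] .
  have star: "P (free_star s x * x) = (P x)\<^sup>2" if x: "x \<in> free_carrier V" for x
  proof (rule antisym)
    have xx: "free_star s x * x \<in> free_carrier V"
      using x by (intro free_mult free_star_closed)
    show "P (free_star s x * x) \<le> (P x)\<^sup>2"
    proof (rule P_least)
      fix p assume p: "admissible p"
      show "p (free_star s x * x) \<le> (P x)\<^sup>2"
        unfolding admD(2)[OF p x] by (intro power_mono P_upper p x admD(1)[OF p x])
    qed
    have "P x \<le> sqrt (P (free_star s x * x))"
    proof (rule P_least)
      fix p assume p: "admissible p"
      show "p x \<le> sqrt (P (free_star s x * x))"
        using P_upper[OF p xx] unfolding admD(2)[OF p x] by (rule real_le_rsqrt)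
    qed
    then show "(P x)\<^sup>2 \<le> P (free_star s x * x)"
      using nn[OF x] nn[OF xx] by (metis power_mono real_sqrt_pow2)
  qed
  have scal: "P (scal c * x) = cmod c * P x" if x: "x \<in> free_carrier V" for c x
  proof (cases "c = 0")
    case True
    have "P 0 \<le> 0"
    proof (rule P_least)
      fix p assume "admissible p"
      then show "p 0 \<le> 0" using admD(3)[of p 0 0] by (simp add: scal_def)
    qed
    then show ?thesis using True nn[of 0] by (simp add: scal_def)
  next
    case False
    have le: "P (scal c * x) \<le> cmod c * P x" if x: "x \<in> free_carrier V" for c x
    proof (rule P_least)
      fix p assume p: "admissible p"
      show "p (scal c * x) \<le> cmod c * P x"
        unfolding admD(3)[OF p x] using P_upper[OF p x] by (rule mult_left_mono) simp
    qed
    have cx: "scal c * x \<in> free_carrier V" using x by (intro free_mult) auto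
    have "P x = P (scal (inverse c) * (scal c * x))"
      using False by (simp add: mult.assoc[symmetric] scal_mult)
    also have "\<dots> \<le> cmod (inverse c) * P (scal c * x)" by (rule le[OF cx])
    finally have "cmod c * P x \<le> cmod c * (cmod (inverse c) * P (scal c * x))"
      by (rule mult_left_mono) simp
    also have "\<dots> = P (scal c * x)"
      using False by (simp add: norm_inverse)
    finally have "cmod c * P x \<le> P (scal c * x)" .
    with le[OF x, of c] show ?thesis by simp
  qed
  have add: "P (x + y) \<le> P x + P y" if x: "x \<in> free_carrier V" and y: "y \<in> free_carrier V" for x y
  proof (rule P_least)
    fix p assume p: "admissible p"
    show "p (x + y) \<le> P x + P y"
      using admD(4)[OF p x y] P_upper[OF p x] P_upper[OF p y] by linarith
  qed
  have mult: "P (x * y) \<le> P x * P y" if x: "x \<in> free_carrier V" and y: "y \<in> free_carrier V" for x y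
  proof (rule P_least)
    fix p assume p: "admissible p"
    have "p x * p y \<le> P x * P y"
      by (intro mult_mono P_upper p x y nn admD(1)[OF p])
    then show "p (x * y) \<le> P x * P y" using admD(5)[OF p x y] by linarith
  qed
  have rel: "P r = 0" if "r \<in> R" for r
  proof (rule antisym)
    show "P r \<le> 0" by (rule P_least) (use that in \<open>simp add: admissible_def\<close>)
    have "bdd_above {p r | p. admissible p}" using that by (auto simp: bdd_above_def admissible_def)
    then show "0 \<le> P r"
      unfolding P_def max_cstar_seminorm_def admissible_def[symmetric]
      using adm_zero by (intro cSup_upper) auto
  qed
  show ?thesis unfolding admissible_def cstar_seminorm_def using nn star scal add mult rel by simp
qed

lemmas P_nonneg = admD(1)[OF P_adm] and P_star_mult = admD(2)[OF P_adm]
  and P_scal = admD(3)[OF P_adm] and P_add = admD(4)[OF P_adm] and P_mult = admD(5)[OF P_adm]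

lemma P_rel: "r \<in> R \<Longrightarrow> P r = 0"
  using P_adm by (simp add: admissible_def)

lemma P_zero [simp]: "P 0 = 0"
  using P_scal[of 0 0] by (simp add: scal_def)

lemma P_uminus: "x \<in> free_carrier V \<Longrightarrow> P (- x) = P x"
  using P_scal[of x "-1"] by (simp add: scal_minus_1)

lemma P_diff_commute: "x \<in> free_carrier V \<Longrightarrow> y \<in> free_carrier V \<Longrightarrow> P (x - y) = P (y - x)"
  using P_uminus[of "x - y"] by (simp add: free_diff)

lemma P_diff_triangle:
  "x \<in> free_carrier V \<Longrightarrow> y \<in> free_carrier V \<Longrightarrow> z \<in> free_carrier V \<Longrightarrow> P (x - z) \<le> P (x - y) + P (y - z)"
  using P_add[of "x - y" "y - z"] by (simp add: free_diff)

lemma P_abs_diff: "x \<in> free_carrier V \<Longrightarrow> y \<in> free_carrier V \<Longrightarrow> \<bar>P x - P y\<bar> \<le> P (x - y)"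
  using P_add[of "x - y" y] P_add[of "y - x" x] P_diff_commute[of x y] by (simp add: free_diff)

text \<open>The C*-identity gives \<open>P(x)\<^sup>2 = P(x\<^sup>* x) \<le> P(x\<^sup>*) P(x)\<close>, hence \<open>P(x) \<le> P(x\<^sup>*)\<close>.\<close>

lemma P_star: "x \<in> free_carrier V \<Longrightarrow> P (free_star s x) = P x"
proof -
  have le: "P x \<le> P (free_star s x)" if x: "x \<in> free_carrier V" for x
  proof (cases "P x = 0")
    case False
    then have "P x > 0" using P_nonneg[OF x] by simp
    moreover have "P x * P x \<le> P (free_star s x) * P x"
      using P_star_mult[OF x] P_mult[OF free_star_closed[OF x] x] by (simp add: power2_eq_square)
    ultimately show ?thesis by simp
  qed (simp add: P_nonneg free_star_closed x)
  assume x: "x \<in> free_carrier V"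
  show ?thesis using le[OF x] le[OF free_star_closed[OF x]] by (simp add: free_star_star)
qed

subsection \<open>Cauchy sequences and their classes\<close>

abbreviation "C \<equiv> carrier (cauchy_ring V P)"

lemma C_iff: "u \<in> C \<longleftrightarrow> (\<forall>n. u n \<in> free_carrier V) \<and> (\<forall>e>0. \<exists>N. \<forall>m\<ge>N. \<forall>n\<ge>N. P (u m - u n) < e)"
  by (simp add: cauchy_ring_def)

lemma C_free: "u \<in> C \<Longrightarrow> u n \<in> free_carrier V"
  by (simp add: C_iff)

text \<open>All closure properties of the Cauchy sequences, and the independence of the operations of
  the choice of representatives, come from estimates of the form of this lemma.\<close>

lemma C_dominated:
  assumes "u \<in> C" "v \<in> C" "\<And>n. w n \<in> free_carrier V"
    "\<And>m n. P (w m - w n) \<le> K * (P (u m - u n) + P (v m - v n))"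
  shows "w \<in> C"
  unfolding C_iff
proof (intro conjI allI impI)
  fix e :: real assume e: "e > 0"
  (* two sequences contribute less than d each, and |K| + 1 avoids a division by zero *)
  define d where "d = e / (2 * (\<bar>K\<bar> + 1))"
  have d: "d > 0" unfolding d_def using e by (simp add: add_nonneg_pos)
  obtain M where M: "\<And>m n. m \<ge> M \<Longrightarrow> n \<ge> M \<Longrightarrow> P (u m - u n) < d" using assms(1) d C_iff by blast
  obtain N where N: "\<And>m n. m \<ge> N \<Longrightarrow> n \<ge> N \<Longrightarrow> P (v m - v n) < d" using assms(2) d C_iff by blast
  show "\<exists>N. \<forall>m\<ge>N. \<forall>n\<ge>N. P (w m - w n) < e"
  proof (intro exI[of _ "max M N"] allI impI)
    fix m n assume mn: "max M N \<le> m" "max M N \<le> n"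
    let ?t = "P (u m - u n) + P (v m - v n)"
    have t: "0 \<le> ?t" "?t < 2 * d"
      using M[of m n] N[of m n] mn P_nonneg assms(1,2) by (auto simp: C_free free_diff)
    have "P (w m - w n) \<le> K * ?t" by (rule assms(4))
    also have "\<dots> \<le> (\<bar>K\<bar> + 1) * ?t" using t(1) by (intro mult_right_mono) auto
    also have "\<dots> < (\<bar>K\<bar> + 1) * (2 * d)" using t(2) by (intro mult_strict_left_mono) auto
    also have "\<dots> = e" unfolding d_def by (simp add: field_simps add_nonneg_eq_0_iff)
    finally show "P (w m - w n) < e" .
  qed
qed (rule assms(3))

lemma C_const: "x \<in> free_carrier V \<Longrightarrow> (\<lambda>n. x) \<in> C"
  by (auto simp: C_iff)

lemma C_add: "u \<in> C \<Longrightarrow> v \<in> C \<Longrightarrow> (\<lambda>n. u n + v n) \<in> C"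
proof (rule C_dominated[where K = 1])
  fix m n assume u: "u \<in> C" and v: "v \<in> C"
  show "u n + v n \<in> free_carrier V" using u v by (simp add: C_free free_add)
  show "P (u m + v m - (u n + v n)) \<le> 1 * (P (u m - u n) + P (v m - v n))"
    using P_add[of "u m - u n" "v m - v n"] u v by (simp add: C_free free_diff add_diff_add)
qed

lemma C_bounded:
  assumes "u \<in> C"
  obtains M where "M > 0" "\<And>n. P (u n) \<le> M"
proof -
  obtain N where N: "\<And>m n. m \<ge> N \<Longrightarrow> n \<ge> N \<Longrightarrow> P (u m - u n) < 1"
    using assms C_iff zero_less_one by blast
  define M where "M = Max ((\<lambda>n. P (u n)) ` {..N}) + 1"
  have M: "P (u n) \<le> M" for n
  proof (cases "n \<le> N")
    case True
    then have "P (u n) \<le> Max ((\<lambda>n. P (u n)) ` {..N})" by (intro Max_ge) auto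
    then show ?thesis unfolding M_def by simp
  next
    case False
    have "P (u n) \<le> P (u N) + P (u n - u N)"
      using P_abs_diff[of "u n" "u N"] assms by (simp add: C_free)
    moreover have "P (u N) \<le> Max ((\<lambda>n. P (u n)) ` {..N})" by (intro Max_ge) auto
    moreover have "P (u n - u N) < 1" using N False by simp
    ultimately show ?thesis unfolding M_def by linarith
  qed
  have "M > 0" unfolding M_def
    using Max_ge[of "(\<lambda>n. P (u n)) ` {..N}" "P (u 0)"] P_nonneg[of "u 0"] C_free[OF assms, of 0]
    by (simp add: add_nonneg_pos order_trans)
  with M that show thesis by blast
qed

lemma P_mult_diff:
  assumes "x \<in> free_carrier V" "y \<in> free_carrier V" "x' \<in> free_carrier V" "y' \<in> free_carrier V"
  shows "P (x * y - x' * y') \<le> P x * P (y - y') + P (x - x') * P y'"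
proof -
  have "x * y - x' * y' = x * (y - y') + (x - x') * y'" by (simp add: algebra_simps)
  then show ?thesis
    using P_add[of "x * (y - y')" "(x - x') * y'"] P_mult[of x "y - y'"] P_mult[of "x - x'" y'] assms
    by (auto simp: free_closed)
qed

lemma C_mult: "u \<in> C \<Longrightarrow> v \<in> C \<Longrightarrow> (\<lambda>n. u n * v n) \<in> C"
proof -
  assume u: "u \<in> C" and v: "v \<in> C"
  obtain M where M: "M > 0" "\<And>n. P (u n) \<le> M" using C_bounded[OF u] by blast
  obtain N where N: "N > 0" "\<And>n. P (v n) \<le> N" using C_bounded[OF v] by blast
  show ?thesis
  proof (rule C_dominated[OF u v, where K = "M + N"])
    fix m n
    show "u n * v n \<in> free_carrier V" using u v by (simp add: C_free free_mult)
    have "P (u m * v m - u n * v n) \<le> P (u m) * P (v m - v n) + P (u m - u n) * P (v n)"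
      using u v by (intro P_mult_diff) (auto simp: C_free)
    also have "\<dots> \<le> (M + N) * P (v m - v n) + P (u m - u n) * (M + N)"
      using M N u v
      by (intro add_mono mult_mono P_nonneg) (auto simp: C_free free_diff less_imp_le intro: add_increasing add_increasing2)
    finally show "P (u m * v m - u n * v n) \<le> (M + N) * (P (u m - u n) + P (v m - v n))"
      by (simp add: algebra_simps)
  qed
qed

lemma C_uminus: "u \<in> C \<Longrightarrow> (\<lambda>n. - u n) \<in> C"
  using C_mult[OF C_const[of "scal (-1)"], of u] by (simp add: scal_minus_1)

lemma C_diff: "u \<in> C \<Longrightarrow> v \<in> C \<Longrightarrow> (\<lambda>n. u n - v n) \<in> C"
  using C_add[OF _ C_uminus, of u v] by simp

lemma C_star: "u \<in> C \<Longrightarrow> (\<lambda>n. free_star s (u n)) \<in> C"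
proof (rule C_dominated[where K = 1])
  fix m n assume u: "u \<in> C"
  show "free_star s (u n) \<in> free_carrier V" using u by (simp add: C_free free_star_closed)
  show "P (free_star s (u m) - free_star s (u n)) \<le> 1 * (P (u m - u n) + P (u m - u n))"
    using u P_star[of "u m - u n"] P_nonneg[of "u m - u n"]
    by (simp add: C_free free_diff star_diff[symmetric])
qed

abbreviation "Null \<equiv> null_sequences V P"

lemma Null_iff: "u \<in> Null \<longleftrightarrow> u \<in> C \<and> (\<lambda>n. P (u n)) \<longlonglongrightarrow> 0"
  by (simp add: null_sequences_def)

lemma Null_dominated:
  assumes "w \<in> C" "u \<in> Null" "\<And>n. P (w n) \<le> K * P (u n)"
  shows "w \<in> Null"
proof -
  have "(\<lambda>n. K * P (u n)) \<longlonglongrightarrow> 0"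
    using assms(2) tendsto_mult_right_zero[of "\<lambda>n. P (u n)"] by (simp add: Null_iff)
  then have "(\<lambda>n. P (w n)) \<longlonglongrightarrow> 0"
    by (rule Lim_null_comparison[rotated])
      (use assms(1,3) in \<open>auto simp: C_free P_nonneg\<close>)
  then show ?thesis using assms(1) by (simp add: Null_iff)
qed

lemma Null_add: "u \<in> Null \<Longrightarrow> v \<in> Null \<Longrightarrow> (\<lambda>n. u n + v n) \<in> Null"
proof -
  assume u: "u \<in> Null" and v: "v \<in> Null"
  have "(\<lambda>n. P (u n) + P (v n)) \<longlonglongrightarrow> 0" using tendsto_add[of "\<lambda>n. P (u n)" 0 _ "\<lambda>n. P (v n)" 0] u v by (simp add: Null_iff)
  then have "(\<lambda>n. P (u n + v n)) \<longlonglongrightarrow> 0"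
    by (rule Lim_null_comparison[rotated])
      (use u v in \<open>auto simp: Null_iff C_free P_nonneg P_add free_add\<close>)
  then show ?thesis using u v by (simp add: Null_iff C_add)
qed

lemma Null_mult:
  assumes u: "u \<in> Null" and v: "v \<in> C"
  shows "(\<lambda>n. u n * v n) \<in> Null" "(\<lambda>n. v n * u n) \<in> Null"
proof -
  obtain M where M: "M > 0" "\<And>n. P (v n) \<le> M" using C_bounded[OF v] by blast
  have uC: "u \<in> C" using u by (simp add: Null_iff)
  have *: "P (u n * v n) \<le> M * P (u n)" "P (v n * u n) \<le> M * P (u n)" for n
  proof -
    have f: "u n \<in> free_carrier V" "v n \<in> free_carrier V" using uC v by (auto simp: C_free)
    have "P (v n) * P (u n) \<le> M * P (u n)" by (intro mult_right_mono M P_nonneg f)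
    then show "P (u n * v n) \<le> M * P (u n)" "P (v n * u n) \<le> M * P (u n)"
      using P_mult[OF f] P_mult[OF f(2,1)] by (auto simp: mult.commute)
  qed
  show "(\<lambda>n. u n * v n) \<in> Null" "(\<lambda>n. v n * u n) \<in> Null"
    by (rule Null_dominated[OF C_mult u *(1)], rule uC, rule v)
      (rule Null_dominated[OF C_mult u *(2)], rule v, rule uC)
qed

lemma Null_uminus: "u \<in> Null \<Longrightarrow> (\<lambda>n. - u n) \<in> Null"
  using Null_mult(2)[OF _ C_const[of "scal (-1)"], of u] by (simp add: scal_minus_1)

lemma ring_cauchy: "ring (cauchy_ring V P)"
proof (rule ringI)
  show "abelian_group (cauchy_ring V P)"
  proof (rule abelian_groupI)
    fix x assume "x \<in> C"
    then show "\<exists>y\<in>C. y \<oplus>\<^bsub>cauchy_ring V P\<^esub> x = \<zero>\<^bsub>cauchy_ring V P\<^esub>"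
      by (intro bexI[of _ "\<lambda>n. - x n"] C_uminus) (simp_all add: cauchy_ring_def)
  next
    fix x y assume "x \<in> C" "y \<in> C"
    then show "x \<oplus>\<^bsub>cauchy_ring V P\<^esub> y \<in> C" using C_add[of x y] by (simp add: cauchy_ring_def)
  next
    show "\<zero>\<^bsub>cauchy_ring V P\<^esub> \<in> C" using C_const[of 0] by (simp add: cauchy_ring_def)
  qed (simp_all add: cauchy_ring_def add_ac)
  show "monoid (cauchy_ring V P)"
  proof (rule monoidI)
    fix x y assume "x \<in> C" "y \<in> C"
    then show "x \<otimes>\<^bsub>cauchy_ring V P\<^esub> y \<in> C" using C_mult[of x y] by (simp add: cauchy_ring_def)
  next
    show "\<one>\<^bsub>cauchy_ring V P\<^esub> \<in> C" using C_const[of 1] by (simp add: cauchy_ring_def)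
  qed (simp_all add: cauchy_ring_def mult.assoc)
qed (simp_all add: cauchy_ring_def algebra_simps)

lemma cauchy_a_inv: "u \<in> C \<Longrightarrow> \<ominus>\<^bsub>cauchy_ring V P\<^esub> u = (\<lambda>n. - u n)"
proof -
  interpret ring "cauchy_ring V P" by (rule ring_cauchy)
  assume "u \<in> C"
  then show ?thesis
    by (intro minus_equality C_uminus) (simp_all add: cauchy_ring_def)
qed

lemma ideal_Null: "ideal Null (cauchy_ring V P)"
proof (rule idealI)
  interpret ring "cauchy_ring V P" by (rule ring_cauchy)
  show "ring (cauchy_ring V P)" by (rule ring_cauchy)
  show "subgroup Null (add_monoid (cauchy_ring V P))"
  proof (rule add.subgroupI)
    show "Null \<subseteq> C" by (auto simp: Null_iff)
    have "(\<lambda>n. 0) \<in> Null" using C_const[of 0] by (simp add: Null_iff)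
    then show "Null \<noteq> {}" by blast
    fix u assume u: "u \<in> Null"
    then show "\<ominus>\<^bsub>cauchy_ring V P\<^esub> u \<in> Null"
      using cauchy_a_inv[of u] Null_uminus[OF u] by (simp add: Null_iff)
    fix v assume v: "v \<in> Null"
    show "u \<oplus>\<^bsub>cauchy_ring V P\<^esub> v \<in> Null"
      using Null_add[OF u v] by (simp add: cauchy_ring_def)
  qed
  fix u v assume "u \<in> Null" "v \<in> C"
  then show "v \<otimes>\<^bsub>cauchy_ring V P\<^esub> u \<in> Null" "u \<otimes>\<^bsub>cauchy_ring V P\<^esub> v \<in> Null"
    using Null_mult by (simp_all add: cauchy_ring_def)
qed

definition cls :: "(nat \<Rightarrow> 'g fword \<Rightarrow>\<^sub>0 complex) \<Rightarrow> (nat \<Rightarrow> 'g fword \<Rightarrow>\<^sub>0 complex) set" where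
  "cls u = Null +>\<^bsub>cauchy_ring V P\<^esub> u"

abbreviation "B \<equiv> cstar_presented V s R"

lemma in_cls_iff: 
  assumes "u \<in> C"
  shows "v \<in> cls u \<longleftrightarrow> v \<in> C \<and> (\<lambda>n. v n - u n) \<in> Null"
proof
  assume "v \<in> cls u"
  then obtain h where h: "h \<in> Null" "v = (\<lambda>n. h n + u n)"
    by (auto simp: cls_def a_r_coset_def' cauchy_ring_def)
  then show "v \<in> C \<and> (\<lambda>n. v n - u n) \<in> Null"
    using C_add[of h u] assms by (simp add: Null_iff)
next
  assume v: "v \<in> C \<and> (\<lambda>n. v n - u n) \<in> Null"
  then show "v \<in> cls u"
    unfolding cls_def a_r_coset_def'
    by (auto simp: cauchy_ring_def intro!: bexI[of _ "\<lambda>n. v n - u n"])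
qed

lemma cls_self: "u \<in> C \<Longrightarrow> u \<in> cls u"
  using C_const[of 0] by (simp add: in_cls_iff Null_iff)

lemma cls_eqI:
  assumes "u \<in> C" "v \<in> C" "(\<lambda>n. u n - v n) \<in> Null"
  shows "cls u = cls v"
proof -
  have sub: "cls u \<subseteq> cls v" if u: "u \<in> C" and v: "v \<in> C" and uv: "(\<lambda>n. u n - v n) \<in> Null" for u v
  proof
    fix w assume "w \<in> cls u"
    then have w: "w \<in> C" "(\<lambda>n. w n - u n) \<in> Null" using u by (auto simp: in_cls_iff)
    then show "w \<in> cls v" using v Null_add[OF w(2) uv] by (simp add: in_cls_iff)
  qed
  show ?thesis
    using sub[OF assms] sub[OF assms(2,1)] Null_uminus[OF assms(3)] by auto
qed

lemma cls_eq_iff: "u \<in> C \<Longrightarrow> v \<in> C \<Longrightarrow> cls u = cls v \<longleftrightarrow> (\<lambda>n. P (u n - v n)) \<longlonglongrightarrow> 0"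
  using cls_eqI[of u v] cls_self[of u] in_cls_iff[of v u] C_diff[of u v] by (auto simp: Null_iff)

lemma cls_const_eq_iff:
  "x \<in> free_carrier V \<Longrightarrow> y \<in> free_carrier V \<Longrightarrow>
    cls (\<lambda>n. x) = cls (\<lambda>n. y) \<longleftrightarrow> P (x - y) = 0"
  using cls_eq_iff[OF C_const C_const, of x y] LIMSEQ_unique[OF tendsto_const, of "P (x - y)" 0]
  by auto

lemma const_class_eq: "const_class V (max_cstar_seminorm V s R) x = cls (\<lambda>n. x)"
  by (simp add: const_class_def cls_def P_def)

lemma B_simps:
  "carrier B = cls ` C"
  "u \<in> C \<Longrightarrow> v \<in> C \<Longrightarrow> cls u \<oplus>\<^bsub>B\<^esub> cls v = cls (\<lambda>n. u n + v n)"
  "u \<in> C \<Longrightarrow> v \<in> C \<Longrightarrow> cls u \<otimes>\<^bsub>B\<^esub> cls v = cls (\<lambda>n. u n * v n)"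
  "u \<in> C \<Longrightarrow> c \<odot>\<^bsub>B\<^esub> cls u = cls (\<lambda>n. scal c * u n)"
  "\<one>\<^bsub>B\<^esub> = cls (\<lambda>n. 1)"
proof -
  interpret ideal Null "cauchy_ring V P" by (rule ideal_Null)
  have Q: "carrier B = carrier (cauchy_ring V P Quot Null)" "add B = add (cauchy_ring V P Quot Null)"
    "mult B = mult (cauchy_ring V P Quot Null)" "one B = one (cauchy_ring V P Quot Null)"
    "c \<odot>\<^bsub>B\<^esub> Y = cls (\<lambda>n. scal c) \<otimes>\<^bsub>cauchy_ring V P Quot Null\<^esub> Y" for c Y
    by (simp_all add: cstar_presented_def Let_def P_def const_class_def cls_def)
  have mult: "cls u \<otimes>\<^bsub>cauchy_ring V P Quot Null\<^esub> cls v = cls (\<lambda>n. u n * v n)"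
    if "u \<in> C" "v \<in> C" for u v
    using rcoset_mult_add[OF that] by (simp add: FactRing_def cls_def) (simp add: cauchy_ring_def)
  show "carrier B = cls ` C"
    by (auto simp: Q FactRing_def A_RCOSETS_def' cls_def a_r_coset_def')
  show "u \<in> C \<Longrightarrow> v \<in> C \<Longrightarrow> cls u \<oplus>\<^bsub>B\<^esub> cls v = cls (\<lambda>n. u n + v n)"
    using a_rcos_sum[of u v] by (simp add: Q FactRing_def cls_def) (simp add: cauchy_ring_def)
  show "u \<in> C \<Longrightarrow> v \<in> C \<Longrightarrow> cls u \<otimes>\<^bsub>B\<^esub> cls v = cls (\<lambda>n. u n * v n)"
    by (simp add: Q mult)
  show "u \<in> C \<Longrightarrow> c \<odot>\<^bsub>B\<^esub> cls u = cls (\<lambda>n. scal c * u n)"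
    by (simp add: Q mult C_const)
  have "(\<lambda>n. 1) \<in> C" using C_const by simp
  show "\<one>\<^bsub>B\<^esub> = cls (\<lambda>n. 1)"
    by (simp add: Q FactRing_def cls_def) (simp add: cauchy_ring_def)
qed

lemma B_adj:
  assumes "u \<in> C"
  shows "adj B (cls u) = cls (\<lambda>n. free_star s (u n))"
proof -
  have sub: "(\<lambda>n. free_star s (v n)) \<in> cls (\<lambda>n. free_star s (u n))" if "v \<in> cls u" "u \<in> C" for u v
  proof -
    have v: "v \<in> C" "(\<lambda>n. v n - u n) \<in> Null" using that by (auto simp: in_cls_iff)
    have "P (free_star s (v n) - free_star s (u n)) \<le> 1 * P (v n - u n)" for n
      using v that P_star[of "v n - u n"] by (simp add: C_free free_diff star_diff)
    then have "(\<lambda>n. free_star s (v n) - free_star s (u n)) \<in> Null"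
      using v that by (intro Null_dominated[OF _ v(2), where K = 1] C_diff C_star) auto
    then show ?thesis using v that by (simp add: in_cls_iff C_star)
  qed
  have "(\<lambda>v n. free_star s (v n)) ` cls u = cls (\<lambda>n. free_star s (u n))"
  proof
    show "cls (\<lambda>n. free_star s (u n)) \<subseteq> (\<lambda>v n. free_star s (v n)) ` cls u"
    proof
      fix w assume "w \<in> cls (\<lambda>n. free_star s (u n))"
      then have "(\<lambda>n. free_star s (w n)) \<in> cls u"
        using sub[of w "\<lambda>n. free_star s (u n)"] assms by (simp add: C_star free_star_star)
      then show "w \<in> (\<lambda>v n. free_star s (v n)) ` cls u"
        by (intro image_eqI[where x = "\<lambda>n. free_star s (w n)"]) (simp_all add: free_star_star)
    qed
  qed (use sub assms in auto)
  then show ?thesis by (simp add: cstar_presented_def Let_def)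
qed

lemma P_convergent:
  assumes "u \<in> C"
  shows "(\<lambda>n. P (u n)) \<longlonglongrightarrow> lim (\<lambda>n. P (u n))"
proof -
  have "Cauchy (\<lambda>n. P (u n))"
  proof (rule metric_CauchyI)
    fix e :: real assume "e > 0"
    then obtain N where N: "\<And>m n. m \<ge> N \<Longrightarrow> n \<ge> N \<Longrightarrow> P (u m - u n) < e" using assms C_iff by blast
    show "\<exists>M. \<forall>m\<ge>M. \<forall>n\<ge>M. dist (P (u m)) (P (u n)) < e"
      unfolding dist_real_def using N P_abs_diff C_free[OF assms]
      by (meson order_le_less_trans)
  qed
  then show ?thesis using Cauchy_convergent convergent_LIMSEQ_iff by blast
qed

lemma B_nrm:
  assumes "u \<in> C"
  shows "nrm B (cls u) = lim (\<lambda>n. P (u n))"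
proof -
  have "lim (\<lambda>n. P (v n)) = lim (\<lambda>n. P (u n))" if "v \<in> cls u" for v
  proof -
    have v: "v \<in> C" "(\<lambda>n. P (v n - u n)) \<longlonglongrightarrow> 0" using that assms by (auto simp: in_cls_iff Null_iff)
    have "norm (P (v n) - P (u n)) \<le> P (v n - u n)" for n
      using P_abs_diff[of "v n" "u n"] v assms by (simp add: C_free)
    then have "(\<lambda>n. P (v n) - P (u n)) \<longlonglongrightarrow> 0"
      by (intro Lim_null_comparison[OF _ v(2)]) simp
    from tendsto_add[OF this P_convergent[OF assms]]
    have "(\<lambda>n. P (v n)) \<longlonglongrightarrow> lim (\<lambda>n. P (u n))" by simp
    then show ?thesis by (rule limI)
  qed
  then have "(\<lambda>v. lim (\<lambda>n. P (v n))) ` cls u = (\<lambda>_. lim (\<lambda>n. P (u n))) ` cls u"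
    by (intro image_cong refl)
  also have "\<dots> = {lim (\<lambda>n. P (u n))}"
    using cls_self[OF assms] by (rule image_constant)
  finally show ?thesis by (simp add: cstar_presented_def Let_def P_def)
qed


subsection \<open>Automorphisms induced by permutations of the generators\<close>

definition letter_map :: "('g \<Rightarrow> 'g) \<Rightarrow> bool" where
  "letter_map g \<longleftrightarrow> g ` V \<subseteq> V \<and> (\<forall>a\<in>V. s (g a) = g (s a)) \<and> (\<forall>r\<in>R. subst_letters g (\<lambda>c. c) r \<in> R)"

abbreviation subst :: "('g \<Rightarrow> 'g) \<Rightarrow> ('g fword \<Rightarrow>\<^sub>0 complex) \<Rightarrow> 'g fword \<Rightarrow>\<^sub>0 complex" where
  "subst g \<equiv> subst_letters g (\<lambda>c. c)"

lemmas sub_simps = subst_simps[OF ring_map_id]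

lemma letter_map_closed: "letter_map g \<Longrightarrow> x \<in> free_carrier V \<Longrightarrow> subst g x \<in> free_carrier V"
  by (rule subst_closed[OF ring_map_id]) (auto simp: letter_map_def)

text \<open>Composing an admissible seminorm with a substitution that preserves the relators gives an
  admissible seminorm, which is dominated by the maximal one.\<close>

lemma P_subst_le:
  assumes g: "letter_map g" and x: "x \<in> free_carrier V"
  shows "P (subst g x) \<le> P x"
proof -
  have "admissible (\<lambda>x. P (subst g x))"
    unfolding admissible_def cstar_seminorm_def
  proof (intro conjI ballI allI)
    fix x :: "'g fword \<Rightarrow>\<^sub>0 complex" assume x: "x \<in> free_carrier V"
    note gx = letter_map_closed[OF g x]
    show "0 \<le> P (subst g x)" by (rule P_nonneg[OF gx])
    have "subst g (free_star s x) = free_star s (subst g x)"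
      using star_subst[OF x, of s g] g by (auto simp: letter_map_def)
    then show "P (subst g (free_star s x * x)) = (P (subst g x))\<^sup>2"
      using P_star_mult[OF gx] by (simp add: sub_simps)
    show "P (subst g (scal c * x)) = cmod c * P (subst g x)" for c
      using P_scal[OF gx] by (simp add: sub_simps)
    fix y :: "'g fword \<Rightarrow>\<^sub>0 complex" assume y: "y \<in> free_carrier V"
    note gy = letter_map_closed[OF g y]
    show "P (subst g (x + y)) \<le> P (subst g x) + P (subst g y)"
      "P (subst g (x * y)) \<le> P (subst g x) * P (subst g y)"
      using P_add[OF gx gy] P_mult[OF gx gy] by (simp_all add: sub_simps)
  next
    fix r assume "r \<in> R"
    then show "P (subst g r) = 0" using g P_rel by (simp add: letter_map_def)
  qed
  from P_upper[OF this x] show ?thesis .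
qed

lemma C_subst:
  assumes g: "letter_map g" and u: "u \<in> C"
  shows "(\<lambda>n. subst g (u n)) \<in> C"
proof (rule C_dominated[OF u u, where K = 1])
  fix m n
  show "subst g (u n) \<in> free_carrier V" using g u by (simp add: C_free letter_map_closed)
  show "P (subst g (u m) - subst g (u n)) \<le> 1 * (P (u m - u n) + P (u m - u n))"
    using P_subst_le[OF g, of "u m - u n"] P_nonneg[of "u m - u n"] u
    by (simp add: sub_simps C_free free_diff)
qed

text \<open>The substitution is applied to an arbitrary representative; it does not matter which one,
  since substitutions that preserve the relators are contractions for the maximal seminorm.\<close>

definition induced :: "('g \<Rightarrow> 'g) \<Rightarrow> (nat \<Rightarrow> 'g fword \<Rightarrow>\<^sub>0 complex) set \<Rightarrow> (nat \<Rightarrow> 'g fword \<Rightarrow>\<^sub>0 complex) set" where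
  "induced g = (\<lambda>Y\<in>carrier B. cls (\<lambda>n. subst g ((SOME u. u \<in> Y) n)))"

lemma induced_cls:
  assumes g: "letter_map g" and u: "u \<in> C"
  shows "induced g (cls u) = cls (\<lambda>n. subst g (u n))"
proof -
  define v where "v = (SOME v. v \<in> cls u)"
  have "v \<in> cls u" unfolding v_def by (rule someI[of "\<lambda>v. v \<in> cls u", OF cls_self[OF u]])
  then have v: "v \<in> C" "(\<lambda>n. v n - u n) \<in> Null" using u by (auto simp: in_cls_iff)
  have "P (subst g (v n) - subst g (u n)) \<le> 1 * P (v n - u n)" for n
    using P_subst_le[OF g, of "v n - u n"] u v by (simp add: sub_simps C_free free_diff)
  then have "(\<lambda>n. subst g (v n) - subst g (u n)) \<in> Null"
    by (intro Null_dominated[OF _ v(2)] C_diff C_subst g u v)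
  then have "cls (\<lambda>n. subst g (v n)) = cls (\<lambda>n. subst g (u n))"
    by (intro cls_eqI C_subst g u v)
  then show ?thesis using u by (simp add: induced_def B_simps v_def)
qed

text \<open>A substitution and its inverse are both contractions, so they are isometric.\<close>

lemma induced_aut:
  assumes g: "letter_map g" and g': "letter_map g'"
    and inv: "\<And>a. a \<in> V \<Longrightarrow> g' (g a) = a" "\<And>a. a \<in> V \<Longrightarrow> g (g' a) = a"
  shows "induced g \<in> carrier (star_aut_group B)"
proof -
  have cancel: "subst g' (subst g x) = x" "subst g (subst g' x) = x" if "x \<in> free_carrier V" for x
    using subst_comp[OF ring_map_id ring_map_id that, of g' g "\<lambda>a. a"]
      subst_comp[OF ring_map_id ring_map_id that, of g g' "\<lambda>a. a"] subst_id[OF that] inv by auto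
  have isometric: "P (subst g x) = P x" if x: "x \<in> free_carrier V" for x
    using P_subst_le[OF g x] P_subst_le[OF g' letter_map_closed[OF g x]] by (simp add: cancel[OF x])
  have bij: "bij_betw (induced g) (carrier B) (carrier B)"
  proof (rule bij_betw_byWitness[where f' = "induced g'"])
    show "\<forall>Y\<in>carrier B. induced g' (induced g Y) = Y" "\<forall>Y\<in>carrier B. induced g (induced g' Y) = Y"
      by (auto simp: B_simps induced_cls g g' C_subst C_free cancel)
    show "induced g ` carrier B \<subseteq> carrier B" "induced g' ` carrier B \<subseteq> carrier B"
      by (auto simp: B_simps induced_cls g g' C_subst)
  qed
  have "induced g \<in> extensional (carrier B)" by (simp add: induced_def)
  with bij have Bij: "induced g \<in> Bij (carrier B)" by (simp add: Bij_def)
  have hom: "induced g \<in> ring_hom B B"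
  proof (rule ring_hom_memI)
    show "induced g \<one>\<^bsub>B\<^esub> = \<one>\<^bsub>B\<^esub>"
      using C_const[of 1] by (simp add: B_simps induced_cls g sub_simps)
  qed (auto simp: B_simps induced_cls g C_subst C_mult C_add sub_simps)
  have "induced g (c \<odot>\<^bsub>B\<^esub> Y) = c \<odot>\<^bsub>B\<^esub> induced g Y" if "Y \<in> carrier B" for c Y
    using that C_mult[OF C_const[of "scal c"]] by (auto simp: B_simps induced_cls g C_subst sub_simps)
  moreover have "induced g (adj B Y) = adj B (induced g Y)" if "Y \<in> carrier B" for Y
  proof -
    obtain u where u: "u \<in> C" "Y = cls u" using \<open>Y \<in> carrier B\<close> by (auto simp: B_simps)
    have "subst g (free_star s (u n)) = free_star s (subst g (u n))" for n
      using star_subst[OF C_free[OF u(1)], of s g n] g by (auto simp: letter_map_def)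
    then show ?thesis using u by (simp add: B_adj induced_cls g C_subst C_star)
  qed
  moreover have "nrm B (induced g Y) = nrm B Y" if "Y \<in> carrier B" for Y
  proof -
    obtain u where u: "u \<in> C" "Y = cls u" using \<open>Y \<in> carrier B\<close> by (auto simp: B_simps)
    then show ?thesis using isometric by (simp add: B_nrm induced_cls g C_subst C_free)
  qed
  ultimately show ?thesis using Bij hom by (simp add: star_aut_group_def)
qed

lemma induced_comp:
  assumes "letter_map g" "letter_map h" "letter_map k" "\<And>a. a \<in> V \<Longrightarrow> g (h a) = k a" "Y \<in> carrier B"
  shows "induced g (induced h Y) = induced k Y"
proof -
  obtain u where u: "u \<in> C" "Y = cls u" using assms(5) by (auto simp: B_simps)
  have "subst g (subst h (u n)) = subst k (u n)" for n
    by (rule subst_comp[OF ring_map_id ring_map_id C_free[OF u(1)]]) (use assms(4) in auto)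
  then show ?thesis using u assms by (simp add: induced_cls C_subst)
qed

subsection \<open>Automorphisms are determined on the generators\<close>

lemma nrm_diff_eq_0:
  assumes "u \<in> C" "v \<in> C" "nrm B (cls (\<lambda>n. u n - v n)) \<le> 0"
  shows "cls u = cls v"
proof -
  have uv: "(\<lambda>n. u n - v n) \<in> C" using assms by (simp add: C_diff)
  have "lim (\<lambda>n. P (u n - v n)) \<ge> 0"
    using P_convergent[OF uv] by (rule LIMSEQ_le_const) (use P_nonneg[OF C_free[OF uv]] in blast)
  then have "lim (\<lambda>n. P (u n - v n)) = 0"
    using assms(3) B_nrm[OF uv] by simp
  then show ?thesis using P_convergent[OF uv] assms by (simp add: cls_eq_iff)
qed

text \<open>The classes of constant sequences are dense: if \<open>c\<close> is the class of the constant sequence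
  \<open>u\<^sub>N\<close>, then \<open>\<theta>[u]\<close> and \<open>\<theta>'[u]\<close> both have distance \<open>\<parallel>[u] - c\<parallel>\<close> from \<open>\<theta> c = \<theta>' c\<close>.\<close>

lemma aut_eq_on_dense:
  assumes \<theta>: "\<theta> \<in> carrier (star_aut_group B)" and \<theta>': "\<theta>' \<in> carrier (star_aut_group B)"
    and gens: "\<And>a. a \<in> V \<Longrightarrow> \<theta> (cls (\<lambda>n. gen a)) = \<theta>' (cls (\<lambda>n. gen a))"
  shows "\<theta> = \<theta>'"
proof -
  have auts: "\<theta> (Y \<oplus>\<^bsub>B\<^esub> Z) = \<theta> Y \<oplus>\<^bsub>B\<^esub> \<theta> Z" "\<theta> (Y \<otimes>\<^bsub>B\<^esub> Z) = \<theta> Y \<otimes>\<^bsub>B\<^esub> \<theta> Z"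
    "\<theta> \<one>\<^bsub>B\<^esub> = \<one>\<^bsub>B\<^esub>" "\<theta> (c \<odot>\<^bsub>B\<^esub> Y) = c \<odot>\<^bsub>B\<^esub> \<theta> Y" "nrm B (\<theta> Y) = nrm B Y" "\<theta> Y \<in> carrier B"
    if "\<theta> \<in> carrier (star_aut_group B)" "Y \<in> carrier B" "Z \<in> carrier B" for \<theta> Y Z c
    using that by (auto simp: star_aut_group_def ring_hom_def)
  have free: "\<theta> (cls (\<lambda>n. x)) = \<theta>' (cls (\<lambda>n. x))" if "x \<in> free_carrier V" for x
    using that
  proof (induction x rule: free_induct)
    case (single w c)
    have word: "\<theta> (cls (\<lambda>n. prod_list (map gen gs))) = \<theta>' (cls (\<lambda>n. prod_list (map gen gs)))" if "set gs \<subseteq> V" for gs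
      using that
    proof (induction gs)
      case Nil
      show ?case using auts(3)[OF \<theta>, of undefined] auts(3)[OF \<theta>', of undefined] \<theta> \<theta>' B_simps(5)
        by (simp add: star_aut_group_def ring_hom_def)
    next
      case (Cons a gs)
      have a: "(\<lambda>n. gen a) \<in> C" and gs: "(\<lambda>n. prod_list (map gen gs)) \<in> C"
        using Cons.prems by (auto intro!: C_const free_gen free_prod_list)
      have *: "cls (\<lambda>n. prod_list (map gen (a # gs))) = cls (\<lambda>n. gen a) \<otimes>\<^bsub>B\<^esub> cls (\<lambda>n. prod_list (map gen gs))"
        using B_simps(3)[OF a gs] by simp
      show ?case unfolding *
        using auts(2)[OF \<theta>] auts(2)[OF \<theta>'] a gs gens[of a] Cons by (simp add: B_simps(1))
    qed
    have w: "(\<lambda>n. prod_list (map gen (letters w))) \<in> C"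
      using single by (intro C_const free_prod_list)
    have *: "cls (\<lambda>n. Poly_Mapping.single w c) = c \<odot>\<^bsub>B\<^esub> cls (\<lambda>n. prod_list (map gen (letters w)))"
      using B_simps(4)[OF w] by (simp add: single_word_eq[of w c])
    show ?case unfolding *
      using auts(4)[OF \<theta>, of "cls (\<lambda>n. prod_list (map gen (letters w)))" "cls (\<lambda>n. prod_list (map gen (letters w)))" c]
        auts(4)[OF \<theta>', of "cls (\<lambda>n. prod_list (map gen (letters w)))" "cls (\<lambda>n. prod_list (map gen (letters w)))" c]
        w word[OF single] by (simp add: B_simps(1))
  next
    case (add x y)
    then show ?case
      using auts(1)[OF \<theta>, of "cls (\<lambda>n. x)" "cls (\<lambda>n. y)"] auts(1)[OF \<theta>', of "cls (\<lambda>n. x)" "cls (\<lambda>n. y)"]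
      by (simp add: B_simps C_const)
  qed
  have "\<theta> (cls u) = \<theta>' (cls u)" if u: "u \<in> C" for u
  proof -
    obtain v where v: "v \<in> C" "\<theta> (cls u) = cls v"
      using auts(6)[OF \<theta>, of "cls u" "cls u"] u by (auto simp: B_simps(1))
    obtain v' where v': "v' \<in> C" "\<theta>' (cls u) = cls v'"
      using auts(6)[OF \<theta>', of "cls u" "cls u"] u by (auto simp: B_simps(1))
    have approx: "nrm B (cls (\<lambda>n. v n - v' n)) \<le> 2 * e" if e: "e > 0" for e
    proof -
      obtain N where N: "\<And>m n. m \<ge> N \<Longrightarrow> n \<ge> N \<Longrightarrow> P (u m - u n) < e" using u e C_iff by blast
      have x: "u N \<in> free_carrier V" using u by (rule C_free)
      obtain w where w: "w \<in> C" "\<theta> (cls (\<lambda>n. u N)) = cls w"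
        using auts(6)[OF \<theta>, of "cls (\<lambda>n. u N)" "cls u"] C_const[OF x] u by (auto simp: B_simps(1))
      have near: "lim (\<lambda>n. P (v n - w n)) \<le> e"
        if "\<theta> \<in> carrier (star_aut_group B)" "v \<in> C" "\<theta> (cls u) = cls v" "\<theta> (cls (\<lambda>n. u N)) = cls w" for \<theta> v
      proof -
        have minus: "cls (\<lambda>n. a n - b n) = cls a \<oplus>\<^bsub>B\<^esub> (-1) \<odot>\<^bsub>B\<^esub> cls b" if "a \<in> C" "b \<in> C" for a b
          using that C_uminus[of b] by (simp add: B_simps scal_minus_1)
        have mem: "cls u \<in> carrier B" "cls (\<lambda>n. u N) \<in> carrier B" "(-1) \<odot>\<^bsub>B\<^esub> cls (\<lambda>n. u N) \<in> carrier B"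
          using u C_const[OF x] C_uminus[OF C_const[OF x]] by (auto simp: B_simps scal_minus_1)
        have "cls (\<lambda>n. v n - w n) = \<theta> (cls (\<lambda>n. u n - u N))"
          unfolding minus[OF that(2) w(1)] minus[OF u C_const[OF x]]
            auts(1)[OF that(1) mem(1,3)] auts(4)[OF that(1) mem(2,2)] that(3,4) ..
        then have "nrm B (cls (\<lambda>n. v n - w n)) = nrm B (cls (\<lambda>n. u n - u N))"
          using auts(5)[OF that(1), of "cls (\<lambda>n. u n - u N)" "cls (\<lambda>n. u n - u N)"] C_diff[OF u C_const[OF x]]
          by (simp add: B_simps(1))
        then have "lim (\<lambda>n. P (v n - w n)) = lim (\<lambda>n. P (u n - u N))"
          using B_nrm C_diff[OF u C_const[OF x]] C_diff[OF that(2) w(1)] by simp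
        also have "\<dots> \<le> e"
          using P_convergent[OF C_diff[OF u C_const[OF x]]]
          by (rule LIMSEQ_le_const2) (use N in \<open>auto intro!: exI[of _ N] less_imp_le\<close>)
        finally show ?thesis .
      qed
      have "lim (\<lambda>n. P (v n - v' n)) \<le> lim (\<lambda>n. P (v n - w n)) + lim (\<lambda>n. P (v' n - w n))"
      proof (rule LIMSEQ_le[OF P_convergent[OF C_diff[OF v(1) v'(1)]]
            tendsto_add[OF P_convergent[OF C_diff[OF v(1) w(1)]] P_convergent[OF C_diff[OF v'(1) w(1)]]]])
        show "\<exists>N. \<forall>n\<ge>N. P (v n - v' n) \<le> P (v n - w n) + P (v' n - w n)"
          using P_diff_triangle[of "v _" "w _" "v' _"] P_diff_commute[of "w _" "v' _"] v v' w
          by (auto simp: C_free)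
      qed
      also have "\<dots> \<le> e + e"
        using near[OF \<theta> v w(2)] near[OF \<theta>' v'] free[OF x] w(2) by (intro add_mono) auto
      finally show ?thesis using B_nrm[OF C_diff[OF v(1) v'(1)]] by simp
    qed
    have "nrm B (cls (\<lambda>n. v n - v' n)) \<le> 0"
      by (rule field_le_epsilon) (use approx[of "_ / 2"] in auto)
    then show ?thesis using nrm_diff_eq_0[OF v(1) v'(1)] v v' by simp
  qed
  moreover have "\<theta> \<in> extensional (carrier B)" "\<theta>' \<in> extensional (carrier B)"
    using \<theta> \<theta>' by (auto simp: star_aut_group_def Bij_def)
  ultimately show ?thesis by (intro extensionalityI[of _ "carrier B"]) (auto simp: B_simps(1))
qed

end

section \<open>Algebraic numbers and Galois groups\<close>

subsection \<open>Field embeddings\<close>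

context
  fixes \<sigma> :: "'k::field \<Rightarrow> complex"
  assumes \<sigma>: "field_embedding \<sigma>"
begin

lemma emb_add: "\<sigma> (x + y) = \<sigma> x + \<sigma> y" and emb_mult: "\<sigma> (x * y) = \<sigma> x * \<sigma> y" and emb_1: "\<sigma> 1 = 1"
  using \<sigma> by (auto simp: field_embedding_def)

lemma emb_0: "\<sigma> 0 = 0"
  using emb_add[of 0 0] by simp

lemma emb_uminus: "\<sigma> (- x) = - \<sigma> x"
  using emb_add[of x "- x"] by (simp add: emb_0 eq_neg_iff_add_eq_0 add.commute)

lemma emb_ring_map: "ring_map \<sigma>"
  by (simp add: ring_map_def emb_0 emb_1 emb_add emb_mult)

lemma emb_inverse: "\<sigma> (inverse x) = inverse (\<sigma> x)"
proof (cases "x = 0")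
  case False
  then have "\<sigma> x * \<sigma> (inverse x) = 1" using emb_mult[of x "inverse x"] by (simp add: emb_1)
  then show ?thesis by (metis inverse_unique)
qed (simp add: emb_0)

lemma emb_eq_0_iff: "\<sigma> x = 0 \<longleftrightarrow> x = 0"
proof
  assume "\<sigma> x = 0"
  show "x = 0"
  proof (rule ccontr)
    assume "x \<noteq> 0"
    then have "\<sigma> (x * inverse x) = 1" by (simp add: emb_1)
    then show False using \<open>\<sigma> x = 0\<close> by (simp add: emb_mult)
  qed
qed (simp add: emb_0)

lemma emb_vector_space: "vector_space (\<lambda>c z. \<sigma> c * z)"
  by unfold_locales (simp_all add: emb_add emb_mult emb_1 algebra_simps)

lemma poly_emb: "poly (map_poly \<sigma> p) z = (\<Sum>i\<le>degree p. \<sigma> (coeff p i) * z ^ i)"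
proof -
  have "degree (map_poly \<sigma> p) = degree p"
    by (rule degree_map_poly) (simp add: emb_eq_0_iff)
  then show ?thesis by (simp add: poly_altdef coeff_map_poly emb_0)
qed

end

text \<open>Applied to the powers of an element of a finite dimensional algebra, this gives a polynomial
  equation for the element.\<close>

lemma (in vector_space) sequence_dependent:
  fixes x :: "nat \<Rightarrow> 'b"
  assumes F: "finite F" and x: "\<And>i. x i \<in> span F"
  shows "\<exists>p. p \<noteq> 0 \<and> (\<Sum>i\<le>degree p. scale (coeff p i) (x i)) = 0"
proof -
  define N where "N = card F"
  have "\<exists>c. (\<exists>i\<le>N. c i \<noteq> 0) \<and> (\<Sum>i\<le>N. scale (c i) (x i)) = 0"
  proof (cases "inj_on x {..N}")
    case True
    have "dependent (x ` {..N})"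
    proof (rule ccontr)
      assume "independent (x ` {..N})"
      then have "card (x ` {..N}) \<le> card F"
        using independent_span_bound[OF F] x by blast
      then show False using card_image[OF True] by (simp add: N_def)
    qed
    then obtain u and v where u: "v \<in> x ` {..N}" "u v \<noteq> 0" "(\<Sum>v\<in>x ` {..N}. scale (u v) v) = 0"
      using dependent_finite[of "x ` {..N}"] by auto
    then show ?thesis
      by (intro exI[of _ "u \<circ> x"]) (auto simp: sum.reindex[OF True])
  next
    case False
    then obtain i j where ij: "i \<le> N" "j \<le> N" "i \<noteq> j" "x i = x j" by (auto simp: inj_on_def)
    (* a repetition x i = x j gives the relation with coefficients 1 and -1 *)
    define c where "c = (\<lambda>k. if k = i then 1 else if k = j then -1 else (0::'a))"
    have "(\<Sum>k\<le>N. scale (c k) (x k)) = (\<Sum>k\<in>{i, j}. scale (c k) (x k))"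
      using ij by (intro sum.mono_neutral_right) (auto simp: c_def)
    also have "\<dots> = 0" using ij by (auto simp: c_def)
    finally show ?thesis using ij by (intro exI[of _ c]) (auto simp: c_def intro!: exI[of _ i])
  qed
  then obtain c where c: "\<exists>i\<le>N. c i \<noteq> 0" "(\<Sum>i\<le>N. scale (c i) (x i)) = 0" by blast
  define p where "p = (\<Sum>i\<le>N. monom (c i) i)"
  have coeff: "coeff p i = (if i \<le> N then c i else 0)" for i
    by (simp add: p_def coeff_sum)
  then have "p \<noteq> 0" using c(1) by (metis coeff_0)
  have "degree p \<le> N" by (rule degree_le) (simp add: coeff)
  then have "(\<Sum>i\<le>degree p. scale (coeff p i) (x i)) = (\<Sum>i\<le>N. scale (coeff p i) (x i))"
    by (intro sum.mono_neutral_left) (auto simp: coeff_eq_0)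
  also have "\<dots> = 0" using c(2) by (simp add: coeff)
  finally show ?thesis using \<open>p \<noteq> 0\<close> by blast
qed

context
  fixes \<sigma> :: "'k::field \<Rightarrow> complex"
  assumes \<sigma>: "field_embedding \<sigma>"
begin

interpretation vs: vector_space "\<lambda>c z. \<sigma> c * z"
  by (rule emb_vector_space[OF \<sigma>])

lemma algebraic_iff: "z \<in> alg_closure_in_C \<sigma> \<longleftrightarrow> (\<exists>p. p \<noteq> 0 \<and> (\<Sum>i\<le>degree p. \<sigma> (coeff p i) * z ^ i) = 0)"
  by (simp add: alg_closure_in_C_def poly_emb[OF \<sigma>])

lemma finite_dim_algebraic:
  assumes "finite F" "\<And>i. z ^ i \<in> vs.span F"
  shows "z \<in> alg_closure_in_C \<sigma>"
  using vs.sequence_dependent[OF assms] by (simp add: algebraic_iff)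

lemma algebraic_finite_dim:
  assumes "z \<in> alg_closure_in_C \<sigma>"
  shows "\<exists>F. finite F \<and> (\<forall>i. z ^ i \<in> vs.span F)"
proof -
  obtain p where p: "p \<noteq> 0" "(\<Sum>i\<le>degree p. \<sigma> (coeff p i) * z ^ i) = 0"
    using assms by (auto simp: algebraic_iff)
  define m where "m = degree p"
  define F where "F = (\<lambda>i. z ^ i) ` {..<m}"
  define a where "a = lead_coeff p"
  have a: "\<sigma> a \<noteq> 0" using p(1) by (simp add: a_def emb_eq_0_iff[OF \<sigma>])
  have "\<sigma> a * z ^ m + (\<Sum>i<m. \<sigma> (coeff p i) * z ^ i) = 0"
    using p(2) by (simp add: lessThan_Suc_atMost[symmetric] m_def a_def add.commute)
  then have "\<sigma> a * z ^ m = - (\<Sum>i<m. \<sigma> (coeff p i) * z ^ i)"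
    by (simp add: eq_neg_iff_add_eq_0)
  then have "inverse (\<sigma> a) * (\<sigma> a * z ^ m) = inverse (\<sigma> a) * - (\<Sum>i<m. \<sigma> (coeff p i) * z ^ i)"
    by (rule arg_cong)
  then have "z ^ m = \<sigma> (- inverse a) * (\<Sum>i<m. \<sigma> (coeff p i) * z ^ i)"
    using a by (simp add: emb_uminus[OF \<sigma>] emb_inverse[OF \<sigma>] mult.assoc[symmetric])
  moreover have "(\<Sum>i<m. \<sigma> (coeff p i) * z ^ i) \<in> vs.span F"
    by (intro vs.span_sum vs.span_scale vs.span_base) (auto simp: F_def)
  ultimately have zm: "z ^ m \<in> vs.span F" by (simp only: vs.span_scale)
  have shift: "z * y \<in> vs.span F" if "y \<in> vs.span F" for y
    using that
  proof (induction rule: vs.span_induct_alt)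
    case base
    then show ?case by (simp add: vs.span_zero)
  next
    case (step c x y)
    from step(1) obtain i where i: "i < m" "x = z ^ i" by (auto simp: F_def)
    have "z * x \<in> vs.span F"
    proof (cases "Suc i = m")
      case True
      then show ?thesis using zm i by auto
    next
      case False
      then show ?thesis using i by (intro vs.span_base) (auto simp: F_def intro!: image_eqI[of _ _ "Suc i"])
    qed
    then have "\<sigma> c * (z * x) + z * y \<in> vs.span F" using step(2) by (intro vs.span_add vs.span_scale)
    then show ?case by (simp add: algebra_simps)
  qed
  have "z ^ i \<in> vs.span F" for i
  proof (induction i)
    case 0
    show ?case
    proof (cases "m = 0")
      case True
      then show ?thesis using zm by simp
    next
      case False
      then show ?thesis by (intro vs.span_base) (auto simp: F_def intro!: image_eqI[of _ _ 0])
    qed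
  next
    case (Suc i)
    then show ?case by (simp add: shift)
  qed
  then show ?thesis by (intro exI[of _ F]) (simp add: F_def)
qed

text \<open>Sums and products of algebraic numbers \<open>x\<close>, \<open>y\<close> have all their powers in the finite
  dimensional span of the products of powers of \<open>x\<close> and \<open>y\<close>.\<close>

lemma algebraic_add_mult:
  assumes "x \<in> alg_closure_in_C \<sigma>" "y \<in> alg_closure_in_C \<sigma>"
  shows "x + y \<in> alg_closure_in_C \<sigma>" "x * y \<in> alg_closure_in_C \<sigma>"
proof -
  obtain F G where F: "finite F" "\<And>i. x ^ i \<in> vs.span F" and G: "finite G" "\<And>i. y ^ i \<in> vs.span G"
    using algebraic_finite_dim assms by meson
  define H where "H = (\<lambda>(a, b). a * b) ` (F \<times> G)"
  have H: "finite H" using F G by (simp add: H_def)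
  have prod: "a * b \<in> vs.span H" if "a \<in> vs.span F" "b \<in> vs.span G" for a b
    using that(1)
  proof (induction rule: vs.span_induct_alt)
    case base
    then show ?case by (simp add: vs.span_zero)
  next
    case (step c f a)
    have "f * b \<in> vs.span H" using that(2)
    proof (induction rule: vs.span_induct_alt)
      case base
      then show ?case by (simp add: vs.span_zero)
    next
      case (step d g b)
      then have "f * g \<in> H" using \<open>f \<in> F\<close> by (auto simp: H_def)
      then have "\<sigma> d * (f * g) + f * b \<in> vs.span H"
        using step(2) by (intro vs.span_add vs.span_scale) (rule vs.span_base)
      then show ?case by (simp add: algebra_simps)
    qed
    then have "\<sigma> c * (f * b) + a * b \<in> vs.span H" using step(2) by (intro vs.span_add vs.span_scale)
    then show ?case by (simp add: algebra_simps)
  qed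
  have "(x + y) ^ k * (x ^ i * y ^ j) \<in> vs.span H" for k i j
  proof (induction k arbitrary: i j)
    case 0
    then show ?case using prod F G by simp
  next
    case (Suc k)
    have "(x + y) ^ k * (x ^ Suc i * y ^ j) + (x + y) ^ k * (x ^ i * y ^ Suc j) \<in> vs.span H"
      by (intro vs.span_add Suc)
    then show ?case by (simp add: algebra_simps)
  qed
  from this[of _ 0 0] show "x + y \<in> alg_closure_in_C \<sigma>"
    by (intro finite_dim_algebraic[OF H]) simp
  show "x * y \<in> alg_closure_in_C \<sigma>"
    by (rule finite_dim_algebraic[OF H]) (simp add: power_mult_distrib prod F G)
qed

end

subsection \<open>The groups of automorphisms\<close>

text \<open>\<open>L\<close> has to be closed under addition and multiplication: elements of \<open>galois_group L F\<close> are
  undefined outside \<open>L\<close>, so otherwise a composition need not be additive.\<close>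

lemma group_galois_group:
  assumes L: "\<And>x y. x \<in> L \<Longrightarrow> y \<in> L \<Longrightarrow> x + y \<in> L" "\<And>x y. x \<in> L \<Longrightarrow> y \<in> L \<Longrightarrow> x * y \<in> L" and F: "F \<subseteq> L"
  shows "group (galois_group L F)"
proof -
  let ?H = "carrier (galois_group L F)"
  have eq: "galois_group L F = BijGroup L \<lparr>carrier := ?H\<rparr>" by (simp add: galois_group_def)
  have H: "f \<in> ?H \<longleftrightarrow> f \<in> Bij L \<and> (\<forall>x\<in>L. \<forall>y\<in>L. f (x + y) = f x + f y \<and> f (x * y) = f x * f y) \<and> (\<forall>x\<in>F. f x = x)" for f
    by (simp add: galois_group_def)
  have sub: "subgroup ?H (BijGroup L)"
  proof (rule group.subgroupI[OF group_BijGroup])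
    show "?H \<subseteq> carrier (BijGroup L)" by (auto simp: H BijGroup_def)
    have "(\<lambda>x\<in>L. x) \<in> ?H" using L F by (auto simp: H id_Bij)
    then show "?H \<noteq> {}" by blast
  next
    fix f assume f: "f \<in> ?H"
    then have Bij: "f \<in> Bij L" by (simp add: H)
    have dist: "inv_into L f (x + y) = inv_into L f x + inv_into L f y" 
      "inv_into L f (x * y) = inv_into L f x * inv_into L f y" if "x \<in> L" "y \<in> L" for x y
      using Bij_inv_into_lemma[of L f "(+)" x y] Bij_inv_into_lemma[of L f "(*)" x y] that f L
      by (auto simp: H)
    have "inv_into L f x = x" if "x \<in> F" for x
      using that f F Bij by (metis (no_types, lifting) Bij_def H IntD2 bij_betw_inv_into_left mem_Collect_eq subsetD)
    then show "inv\<^bsub>BijGroup L\<^esub> f \<in> ?H"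
      unfolding inv_BijGroup[OF Bij] H using dist L F restrict_inv_into_Bij[OF Bij] by auto
  next
    fix f g assume f: "f \<in> ?H" and g: "g \<in> ?H"
    then have *: "f \<in> Bij L" "g \<in> Bij L" "g \<in> L \<rightarrow> L" by (auto simp: H Bij_imp_funcset)
    then have "f \<otimes>\<^bsub>BijGroup L\<^esub> g = compose L f g" by (simp add: BijGroup_def)
    moreover have "compose L f g \<in> ?H"
      using f g F L * by (auto simp: H compose_Bij compose_eq Pi_iff subset_iff)
    ultimately show "f \<otimes>\<^bsub>BijGroup L\<^esub> g \<in> ?H" by simp
  qed
  show "group (galois_group L F)"
    by (subst eq) (rule subgroup.subgroup_is_group[OF sub group_BijGroup])
qed

text \<open>This covers elements of \<open>Gal(L/K)\<close>, automorphisms of \<open>Kbar\<close> and embeddings of \<open>L\<close> into \<open>\<complex>\<close>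
  at once; for a Galois extension the last two turn out to map \<open>L\<close> to itself as well.\<close>

definition field_hom_on :: "('k \<Rightarrow> complex) \<Rightarrow> complex set \<Rightarrow> (complex \<Rightarrow> complex) \<Rightarrow> bool" where
  "field_hom_on \<sigma> L \<tau> \<longleftrightarrow> (\<forall>x\<in>L. \<forall>y\<in>L. \<tau> (x + y) = \<tau> x + \<tau> y \<and> \<tau> (x * y) = \<tau> x * \<tau> y) \<and>
     (\<forall>c. \<tau> (\<sigma> c) = \<sigma> c)"

context
  fixes \<sigma> :: "'k::field \<Rightarrow> complex" and L :: "complex set"
  assumes \<sigma>: "field_embedding \<sigma>" and L: "abelian_extension \<sigma> L"
begin

interpretation vs: vector_space "\<lambda>c z. \<sigma> c * z"
  by (rule emb_vector_space[OF \<sigma>])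

lemma ext_base: "\<sigma> c \<in> L"
  using L by (auto simp: abelian_extension_def)

lemma ext_0: "0 \<in> L" and ext_1: "1 \<in> L"
  using ext_base[of 0] ext_base[of 1] by (simp_all add: emb_0[OF \<sigma>] emb_1[OF \<sigma>])

lemma ext_diff: "x \<in> L \<Longrightarrow> y \<in> L \<Longrightarrow> x - y \<in> L" and ext_mult: "x \<in> L \<Longrightarrow> y \<in> L \<Longrightarrow> x * y \<in> L"
  using L unfolding abelian_extension_def by blast+

lemma ext_uminus: "x \<in> L \<Longrightarrow> - x \<in> L"
  using ext_diff[OF ext_0, of x] by simp

lemma ext_add: "x \<in> L \<Longrightarrow> y \<in> L \<Longrightarrow> x + y \<in> L"
  using ext_diff[of x "- y"] by (simp add: ext_uminus)

lemma ext_inverse: "x \<in> L \<Longrightarrow> inverse x \<in> L"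
  using L unfolding abelian_extension_def by blast

lemma ext_power: "x \<in> L \<Longrightarrow> x ^ n \<in> L"
  by (induction n) (auto intro: ext_1 ext_mult)

lemma ext_sum: "(\<And>i. i \<in> I \<Longrightarrow> f i \<in> L) \<Longrightarrow> sum f I \<in> L"
  by (induction I rule: infinite_finite_induct) (auto intro: ext_0 ext_add)

lemma ext_algebraic: "L \<subseteq> alg_closure_in_C \<sigma>"
proof
  fix x assume x: "x \<in> L"
  obtain F where F: "finite F" "L = vs.span F" using L unfolding abelian_extension_def by blast
  show "x \<in> alg_closure_in_C \<sigma>"
    by (rule finite_dim_algebraic[OF \<sigma> F(1)]) (use ext_power[OF x] F(2) in simp)
qed

lemma hom_0: "field_hom_on \<sigma> L \<tau> \<Longrightarrow> \<tau> 0 = 0"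
  using emb_0[OF \<sigma>] by (metis field_hom_on_def)

lemma hom_1: "field_hom_on \<sigma> L \<tau> \<Longrightarrow> \<tau> 1 = 1"
  using emb_1[OF \<sigma>] by (metis field_hom_on_def)

lemma hom_add: "field_hom_on \<sigma> L \<tau> \<Longrightarrow> x \<in> L \<Longrightarrow> y \<in> L \<Longrightarrow> \<tau> (x + y) = \<tau> x + \<tau> y"
  and hom_mult: "field_hom_on \<sigma> L \<tau> \<Longrightarrow> x \<in> L \<Longrightarrow> y \<in> L \<Longrightarrow> \<tau> (x * y) = \<tau> x * \<tau> y"
  by (auto simp: field_hom_on_def)

lemma hom_base: "field_hom_on \<sigma> L \<tau> \<Longrightarrow> \<tau> (\<sigma> c) = \<sigma> c"
  by (simp add: field_hom_on_def)

lemma hom_uminus: "field_hom_on \<sigma> L \<tau> \<Longrightarrow> x \<in> L \<Longrightarrow> \<tau> (- x) = - \<tau> x"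
  using hom_add[of \<tau> x "- x"] hom_0[of \<tau>] by (simp add: ext_uminus eq_neg_iff_add_eq_0 add.commute)

lemma hom_sum:
  "field_hom_on \<sigma> L \<tau> \<Longrightarrow> (\<And>i. i \<in> I \<Longrightarrow> f i \<in> L) \<Longrightarrow> \<tau> (sum f I) = (\<Sum>i\<in>I. \<tau> (f i))"
  by (induction I rule: infinite_finite_induct) (auto simp: hom_0 hom_add ext_sum)

lemma hom_power: "field_hom_on \<sigma> L \<tau> \<Longrightarrow> x \<in> L \<Longrightarrow> \<tau> (x ^ n) = \<tau> x ^ n"
  by (induction n) (simp_all add: hom_1 hom_mult ext_power)

lemma hom_inj:
  assumes "field_hom_on \<sigma> L \<tau>"
  shows "inj_on \<tau> L"
proof (rule inj_onI)
  fix x y assume xy: "x \<in> L" "y \<in> L" "\<tau> x = \<tau> y"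
  show "x = y"
  proof (rule ccontr)
    assume "x \<noteq> y"
    then have "(x - y) * inverse (x - y) = 1" by simp
    then have "\<tau> (x - y) * \<tau> (inverse (x - y)) = 1"
      using hom_mult[OF assms, of "x - y" "inverse (x - y)"] xy hom_1[OF assms]
      by (simp add: ext_diff ext_inverse)
    moreover have "\<tau> (x - y) = 0"
      using hom_add[OF assms, of x "- y"] hom_uminus[OF assms, of y] xy by (simp add: ext_uminus)
    ultimately show False by simp
  qed
qed

lemma galois_hom: "f \<in> carrier (galois_group L (range \<sigma>)) \<Longrightarrow> field_hom_on \<sigma> L f"
  by (auto simp: galois_group_def field_hom_on_def)

lemma galois_closed: "f \<in> carrier (galois_group L (range \<sigma>)) \<Longrightarrow> x \<in> L \<Longrightarrow> f x \<in> L"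
  using Bij_imp_funcset[of f L] by (auto simp: galois_group_def)

lemma group_ext: "group (galois_group L (range \<sigma>))"
  by (rule group_galois_group) (auto intro: ext_add ext_mult ext_base)

text \<open>Roots of a polynomial over the base field are mapped to roots of it, so orbits are finite.\<close>

lemma hom_root:
  assumes "field_hom_on \<sigma> L \<tau>" "x \<in> L" "poly (map_poly \<sigma> p) x = 0"
  shows "poly (map_poly \<sigma> p) (\<tau> x) = 0"
proof -
  have "\<tau> (\<Sum>i\<le>degree p. \<sigma> (coeff p i) * x ^ i) = (\<Sum>i\<le>degree p. \<tau> (\<sigma> (coeff p i) * x ^ i))"
    using assms by (intro hom_sum) (auto intro: ext_mult ext_base ext_power)
  also have "\<dots> = (\<Sum>i\<le>degree p. \<sigma> (coeff p i) * \<tau> x ^ i)"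
    by (intro sum.cong refl)
      (simp add: hom_mult[OF assms(1)] hom_power[OF assms(1,2)] hom_base[OF assms(1)] ext_base ext_power[OF assms(2)])
  finally show ?thesis using assms(3) hom_0[OF assms(1)] by (simp add: poly_emb[OF \<sigma>])
qed

lemma orbit_finite:
  assumes "x \<in> L"
  shows "finite ((\<lambda>f. f x) ` carrier (galois_group L (range \<sigma>)))"
proof -
  obtain p where p: "p \<noteq> 0" "poly (map_poly \<sigma> p) x = 0"
    using assms ext_algebraic by (auto simp: alg_closure_in_C_def)
  have "map_poly \<sigma> p \<noteq> 0"
    using p(1) coeff_map_poly[of \<sigma>, OF emb_0[OF \<sigma>]] by (metis coeff_0 emb_eq_0_iff[OF \<sigma>] poly_eqI)
  then have "finite {z. poly (map_poly \<sigma> p) z = 0}" by (rule poly_roots_finite)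
  moreover have "(\<lambda>f. f x) ` carrier (galois_group L (range \<sigma>)) \<subseteq> {z. poly (map_poly \<sigma> p) z = 0}"
    using hom_root[OF galois_hom assms p(2)] by auto
  ultimately show ?thesis by (rule finite_subset[rotated])
qed

text \<open>The coefficients of \<open>\<Prod>(T - y)\<close> are polynomials in the roots with integer coefficients, so a
  homomorphism that moves the roots to \<open>\<tau> ` S\<close> moves the coefficients accordingly.\<close>

lemma hom_root_product:
  assumes \<tau>: "field_hom_on \<sigma> L \<tau>" and S: "finite S" "S \<subseteq> L"
  shows "coeff (\<Prod>y\<in>S. [:- y, 1:]) i \<in> L \<and>
    \<tau> (coeff (\<Prod>y\<in>S. [:- y, 1:]) i) = coeff (\<Prod>y\<in>\<tau> ` S. [:- y, 1:]) i"
  using S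
proof (induction S arbitrary: i rule: finite_induct)
  case empty
  then show ?case using hom_0[OF \<tau>] hom_1[OF \<tau>] by (simp add: ext_0 ext_1 coeff_1)
next
  case (insert y S)
  define q where "q = (\<Prod>y\<in>S. [:- y, 1:])"
  define q' where "q' = (\<Prod>y\<in>\<tau> ` S. [:- y, 1:])"
  have IH: "coeff q i \<in> L" "\<tau> (coeff q i) = coeff q' i" for i
    using insert by (auto simp: q_def q'_def)
  have "\<tau> y \<notin> \<tau> ` S"
    using insert inj_on_image_mem_iff[OF hom_inj[OF \<tau>], of y S] by auto
  then have eqs: "(\<Prod>y\<in>insert y S. [:- y, 1:]) = [:- y, 1:] * q"
    "(\<Prod>y\<in>\<tau> ` insert y S. [:- y, 1:]) = [:- \<tau> y, 1:] * q'"
    using insert by (simp_all add: q_def q'_def)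
  have coeff: "coeff ([:- z, 1:] * r) i = - z * coeff r i + (if i = 0 then 0 else coeff r (i - 1))" for z :: complex and r
    by (cases i) (simp_all add: algebra_simps)
  have y: "y \<in> L" using insert by simp
  have "\<tau> (- y * coeff q i) = - \<tau> y * coeff q' i"
    using hom_mult[OF \<tau> ext_uminus[OF y] IH(1)] hom_uminus[OF \<tau> y] IH(2) by simp
  moreover have "- y * coeff q i \<in> L" using y IH by (intro ext_mult ext_uminus)
  ultimately show ?case
    unfolding eqs coeff
    using IH hom_add[OF \<tau>, of "- y * coeff q i" "coeff q (i - 1)"] ext_add[of "- y * coeff q i" "coeff q (i - 1)"]
    by (cases "i = 0") (simp_all add: ext_0)
qed

text \<open>A homomorphism \<open>\<tau>\<close> of a Galois extension into \<open>\<complex>\<close> maps \<open>x\<close> to a conjugate: the product of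
  the \<open>T - y\<close> over the orbit of \<open>x\<close> has coefficients fixed by the Galois group, hence in the base
  field, so \<open>\<tau> x\<close> is again a root of it.\<close>

lemma hom_in_orbit:
  assumes \<tau>: "field_hom_on \<sigma> L \<tau>" and x: "x \<in> L"
  shows "\<tau> x \<in> (\<lambda>f. f x) ` carrier (galois_group L (range \<sigma>))"
proof -
  let ?G = "galois_group L (range \<sigma>)"
  interpret G: group ?G by (rule group_ext)
  define Orb where "Orb = (\<lambda>f. f x) ` carrier ?G"
  have Orb: "finite Orb" "Orb \<subseteq> L"
    using orbit_finite[OF x] galois_closed x by (auto simp: Orb_def)
  define q where "q = (\<Prod>y\<in>Orb. [:- y, 1:])"
  have "coeff q i \<in> range \<sigma>" for i
  proof -
    have "f (coeff q i) = coeff q i" if f: "f \<in> carrier ?G" for f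
    proof -
      have "f ` Orb = Orb"
      proof (rule card_subset_eq[OF Orb(1)])
        show "f ` Orb \<subseteq> Orb"
        proof safe
          fix y assume "y \<in> Orb"
          then obtain g where g: "g \<in> carrier ?G" "y = g x" by (auto simp: Orb_def)
          have "f \<otimes>\<^bsub>?G\<^esub> g = compose L f g"
            using f g by (simp add: galois_group_def BijGroup_def)
          then have "f y = (f \<otimes>\<^bsub>?G\<^esub> g) x" using g x by (simp add: compose_eq)
          then show "f y \<in> Orb" using f g unfolding Orb_def by blast
        qed
        show "card (f ` Orb) = card Orb"
          using hom_inj[OF galois_hom[OF f]] Orb(2) by (intro card_image) (rule inj_on_subset)
      qed
      then show ?thesis using hom_root_product[OF galois_hom[OF f] Orb, of i] by (simp add: q_def)
    qed
    moreover have "coeff q i \<in> L" using hom_root_product[OF \<tau> Orb, of i] by (simp add: q_def)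
    ultimately show ?thesis using L unfolding abelian_extension_def by blast
  qed
  then have fixed: "\<tau> (coeff q i) = coeff q i" "coeff q i \<in> L" for i
    by (metis rangeE hom_base[OF \<tau>] ext_base)+
  have "x \<in> Orb"
    using G.one_closed x by (auto simp: Orb_def galois_group_def BijGroup_def intro!: image_eqI[of _ _ "\<lambda>x\<in>L. x"])
  then have "poly q x = 0" using Orb(1) by (auto simp: q_def poly_prod)
  then have "0 = \<tau> (\<Sum>i\<le>degree q. coeff q i * x ^ i)" using hom_0[OF \<tau>] by (simp add: poly_altdef)
  also have "\<dots> = (\<Sum>i\<le>degree q. \<tau> (coeff q i * x ^ i))"
    by (rule hom_sum[OF \<tau>]) (intro ext_mult fixed ext_power x)
  also have "\<dots> = poly q (\<tau> x)"
    unfolding poly_altdef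
    by (intro sum.cong refl) (simp add: hom_mult[OF \<tau>] hom_power[OF \<tau>] fixed ext_power x)
  finally have "(\<Prod>y\<in>Orb. \<tau> x - y) = 0" by (simp add: q_def poly_prod)
  then show ?thesis using Orb(1) by (auto simp: Orb_def)
qed

text \<open>Surjectivity: the finite set of roots in \<open>L\<close> of a polynomial over the base field is mapped
  injectively into itself, and every element of \<open>L\<close> lies in such a set.\<close>

lemma hom_galois:
  assumes \<tau>: "field_hom_on \<sigma> L \<tau>"
  shows "restrict \<tau> L \<in> carrier (galois_group L (range \<sigma>))"
proof -
  let ?G = "galois_group L (range \<sigma>)"
  have closed: "\<tau> x \<in> L" if "x \<in> L" for x
    using hom_in_orbit[OF \<tau> that] galois_closed that by auto
  have "x \<in> \<tau> ` L" if x: "x \<in> L" for x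
  proof -
    define p where "p = (SOME p. p \<noteq> 0 \<and> poly (map_poly \<sigma> p) x = 0)"
    have "\<exists>p. p \<noteq> 0 \<and> poly (map_poly \<sigma> p) x = 0"
      using x ext_algebraic by (auto simp: alg_closure_in_C_def)
    then have p: "p \<noteq> 0" "poly (map_poly \<sigma> p) x = 0" unfolding p_def by (metis (mono_tags, lifting) someI_ex)+
    define Z where "Z = {z\<in>L. poly (map_poly \<sigma> p) z = 0}"
    have "map_poly \<sigma> p \<noteq> 0"
      using p(1) coeff_map_poly[of \<sigma>, OF emb_0[OF \<sigma>]] by (metis coeff_0 emb_eq_0_iff[OF \<sigma>] poly_eqI)
    then have Z: "finite Z"
      unfolding Z_def by (intro finite_subset[OF _ poly_roots_finite]) auto
    have "\<tau> ` Z = Z"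
    proof (rule card_subset_eq[OF Z])
      show "\<tau> ` Z \<subseteq> Z" using hom_root[OF \<tau>] closed by (auto simp: Z_def)
      show "card (\<tau> ` Z) = card Z"
        using hom_inj[OF \<tau>] by (intro card_image) (auto simp: Z_def intro: inj_on_subset)
    qed
    then show ?thesis using x p by (auto simp: Z_def)
  qed
  then have "bij_betw \<tau> L L" using closed hom_inj[OF \<tau>] by (auto simp: bij_betw_def)
  then have "restrict \<tau> L \<in> Bij L" by (simp add: Bij_def)
  then show ?thesis using \<tau> by (auto simp: galois_group_def field_hom_on_def ext_add ext_mult ext_base)
qed

lemma hom_closed: "field_hom_on \<sigma> L \<tau> \<Longrightarrow> x \<in> L \<Longrightarrow> \<tau> x \<in> L"
  using galois_closed[OF hom_galois] by fastforce

text \<open>Homomorphisms of an abelian extension into \<open>\<complex>\<close> are elements of its abelian Galois group.\<close>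

lemma hom_commute:
  assumes "field_hom_on \<sigma> L \<tau>" "field_hom_on \<sigma> L \<upsilon>" "x \<in> L"
  shows "\<tau> (\<upsilon> x) = \<upsilon> (\<tau> x)"
proof -
  let ?G = "galois_group L (range \<sigma>)"
  interpret comm_group ?G using L by (simp add: abelian_extension_def)
  note t = hom_galois[OF assms(1)] and u = hom_galois[OF assms(2)]
  have "restrict \<tau> L \<otimes>\<^bsub>?G\<^esub> restrict \<upsilon> L = restrict \<upsilon> L \<otimes>\<^bsub>?G\<^esub> restrict \<tau> L"
    using t u by (rule m_comm)
  moreover have "f \<otimes>\<^bsub>?G\<^esub> g = compose L f g" if "f \<in> carrier ?G" "g \<in> carrier ?G" for f g
    using that by (simp add: galois_group_def BijGroup_def)
  ultimately have "compose L (restrict \<tau> L) (restrict \<upsilon> L) x = compose L (restrict \<upsilon> L) (restrict \<tau> L) x"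
    using t u by simp
  then show ?thesis using assms by (simp add: compose_eq hom_closed)
qed

end

section \<open>The space of characters\<close>

context endomotive
begin

abbreviation \<sigma> where "\<sigma> \<equiv> embK D"
abbreviation S where "S \<equiv> endos D"

lemmas \<sigma>_0 = emb_0[OF embedding] and \<sigma>_1 = emb_1[OF embedding]
  and \<sigma>_uminus = emb_uminus[OF embedding] and \<sigma>_ring = emb_ring_map[OF embedding]

interpretation av: vector_space "scaleA D"
  by (rule vector_space)

definition khom :: "('a \<Rightarrow> complex) \<Rightarrow> bool" where
  "khom \<xi> \<longleftrightarrow> \<xi> 1 = 1 \<and> (\<forall>x y. \<xi> (x + y) = \<xi> x + \<xi> y \<and> \<xi> (x * y) = \<xi> x * \<xi> y) \<and>
     (\<forall>c x. \<xi> (scaleA D c x) = \<sigma> c * \<xi> x)"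

lemma khomD:
  assumes "khom \<xi>"
  shows "\<xi> 1 = 1" "\<xi> (x + y) = \<xi> x + \<xi> y" "\<xi> (x * y) = \<xi> x * \<xi> y" "\<xi> (scaleA D c x) = \<sigma> c * \<xi> x"
  using assms by (auto simp: khom_def)

lemma khom_0: "khom \<xi> \<Longrightarrow> \<xi> 0 = 0"
  using khomD(2)[of \<xi> 0 0] by simp

lemma khom_sum: "khom \<xi> \<Longrightarrow> \<xi> (sum f I) = (\<Sum>i\<in>I. \<xi> (f i))"
  by (induction I rule: infinite_finite_induct) (auto simp: khom_0 khomD)

lemma khom_power: "khom \<xi> \<Longrightarrow> \<xi> (x ^ n) = \<xi> x ^ n"
  by (induction n) (auto simp: khomD)

lemma level_span: "\<beta> \<in> indices D \<Longrightarrow> \<exists>F. finite F \<and> level D \<beta> = av.span F"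
  using levels[of \<beta>] by (simp add: reduced_fd_subalgebra_def)

lemma level_mult: "\<beta> \<in> indices D \<Longrightarrow> x \<in> level D \<beta> \<Longrightarrow> y \<in> level D \<beta> \<Longrightarrow> x * y \<in> level D \<beta>"
  and level_1: "\<beta> \<in> indices D \<Longrightarrow> 1 \<in> level D \<beta>"
  using levels[of \<beta>] by (auto simp: reduced_fd_subalgebra_def)

lemma level_add: "\<beta> \<in> indices D \<Longrightarrow> x \<in> level D \<beta> \<Longrightarrow> y \<in> level D \<beta> \<Longrightarrow> x + y \<in> level D \<beta>"
  and level_scale: "\<beta> \<in> indices D \<Longrightarrow> x \<in> level D \<beta> \<Longrightarrow> scaleA D c x \<in> level D \<beta>"
  and level_0: "\<beta> \<in> indices D \<Longrightarrow> 0 \<in> level D \<beta>"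
  using level_span[of \<beta>] av.span_add av.span_scale av.span_zero by metis+

lemma in_level: obtains \<beta> where "\<beta> \<in> indices D" "x \<in> level D \<beta>"
  using exhaust by blast

lemma finite_in_level:
  assumes "finite F"
  shows "\<exists>\<beta>\<in>indices D. F \<subseteq> level D \<beta>"
  using assms
proof (induction F rule: finite_induct)
  case empty
  then show ?case using directed(1) by auto
next
  case (insert x F)
  then obtain \<beta> where \<beta>: "\<beta> \<in> indices D" "F \<subseteq> level D \<beta>" by blast
  obtain \<gamma> where \<gamma>: "\<gamma> \<in> indices D" "x \<in> level D \<gamma>" by (rule in_level)
  obtain \<delta> where "\<delta> \<in> indices D" "level D \<beta> \<subseteq> level D \<delta>" "level D \<gamma> \<subseteq> level D \<delta>"
    using directed(2)[OF \<beta>(1) \<gamma>(1)] by blast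
  then show ?case using \<beta> \<gamma> by blast
qed

text \<open>Every element of \<open>A\<close> is algebraic over \<open>K\<close>, so all characters take its value in one finite
  set of algebraic numbers. This is what makes \<open>X\<close> compact and totally disconnected.\<close>

lemma finite_values: "\<exists>Z. finite Z \<and> Z \<subseteq> Kbar D \<and> (\<forall>\<xi>. khom \<xi> \<longrightarrow> \<xi> a \<in> Z)"
proof -
  obtain \<beta> where \<beta>: "\<beta> \<in> indices D" "a \<in> level D \<beta>" by (rule in_level)
  obtain F where F: "finite F" "level D \<beta> = av.span F" using level_span[OF \<beta>(1)] by blast
  have "a ^ i \<in> level D \<beta>" for i
    by (induction i) (auto intro: level_1 level_mult \<beta>)
  then obtain p where p: "p \<noteq> 0" "(\<Sum>i\<le>degree p. scaleA D (coeff p i) (a ^ i)) = 0"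
    using av.sequence_dependent[OF F(1), of "\<lambda>i. a ^ i"] F(2) by auto
  define Z where "Z = {z. poly (map_poly \<sigma> p) z = 0}"
  have "map_poly \<sigma> p \<noteq> 0"
    using p(1) coeff_map_poly[of \<sigma>, OF \<sigma>_0] by (metis coeff_0 emb_eq_0_iff[OF embedding] poly_eqI)
  then have "finite Z" unfolding Z_def by (rule poly_roots_finite)
  moreover have "Z \<subseteq> Kbar D" using p(1) by (auto simp: Z_def Kbar_def alg_closure_in_C_def)
  moreover have "\<xi> a \<in> Z" if "khom \<xi>" for \<xi>
  proof -
    have "\<xi> (\<Sum>i\<le>degree p. scaleA D (coeff p i) (a ^ i)) = 0" using p(2) khom_0[OF that] by simp
    then show ?thesis
      by (simp add: Z_def poly_emb[OF embedding] khom_sum[OF that] khomD[OF that] khom_power[OF that])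
  qed
  ultimately show ?thesis by blast
qed

definition vals :: "'a \<Rightarrow> complex set" where
  "vals a = (SOME Z. finite Z \<and> Z \<subseteq> Kbar D \<and> (\<forall>\<xi>. khom \<xi> \<longrightarrow> \<xi> a \<in> Z))"

lemma vals: "finite (vals a)" "vals a \<subseteq> Kbar D" "khom \<xi> \<Longrightarrow> \<xi> a \<in> vals a"
  using someI_ex[OF finite_values[of a]] unfolding vals_def[symmetric] by auto

lemma X_iff: "\<xi> \<in> X D \<longleftrightarrow> khom \<xi>"
  using vals(2,3) by (auto simp: X_def alg_homs_def khom_def[of \<xi>] PiE_iff) (metis khom_def subsetD)

lemma X_Kbar: "\<xi> \<in> X D \<Longrightarrow> \<xi> a \<in> Kbar D"
  using vals X_iff by blast

lemma restrict_X: "\<xi> \<in> X D \<Longrightarrow> \<beta> \<in> indices D \<Longrightarrow> restrict \<xi> (level D \<beta>) \<in> alg_homs D (level D \<beta>)"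
  using X_Kbar[of \<xi>]
  by (auto simp: alg_homs_def X_iff khomD level_1 level_add level_mult level_scale)

subsection \<open>The topology\<close>

abbreviation nbhd :: "('a \<Rightarrow> complex) \<Rightarrow> 'a set \<Rightarrow> ('a \<Rightarrow> complex) set" where
  "nbhd \<xi> F \<equiv> {\<eta> \<in> X D. \<forall>a\<in>F. \<eta> a = \<xi> a}"

lemma topspace_X: "topspace (X_topology D) = X D"
  using restrict_X by (auto simp: X_topology_def topspace_pullback_topology)

lemma open_nbhd_level:
  assumes "\<xi> \<in> X D" "\<beta> \<in> indices D"
  shows "openin (X_topology D) (nbhd \<xi> (level D \<beta>))"
proof -
  let ?T = "\<lambda>\<beta>. discrete_topology (alg_homs D (level D \<beta>))"
  define W where "W = (\<lambda>\<gamma>. if \<gamma> = \<beta> then {restrict \<xi> (level D \<beta>)} else topspace (?T \<gamma>))"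
  have "openin (product_topology ?T (indices D)) (PiE (indices D) W)"
    by (rule product_topology_basis) (use restrict_X[OF assms] in \<open>auto simp: W_def\<close>)
  moreover have "nbhd \<xi> (level D \<beta>) = (\<lambda>\<xi>. \<lambda>\<beta>\<in>indices D. restrict \<xi> (level D \<beta>)) -` PiE (indices D) W \<inter> X D"
    using assms restrict_X
    by (fastforce simp: W_def PiE_iff fun_eq_iff restrict_apply split: if_splits)
  ultimately show ?thesis unfolding X_topology_def openin_pullback_topology by blast
qed

text \<open>A level is spanned by finitely many elements, and finitely many elements lie in a common
  level. So the topology is that of pointwise convergence on \<open>A\<close> with discrete values.\<close>

lemma openin_X:
  "openin (X_topology D) N \<longleftrightarrow> N \<subseteq> X D \<and> (\<forall>\<xi>\<in>N. \<exists>F. finite F \<and> nbhd \<xi> F \<subseteq> N)"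
proof
  assume N: "openin (X_topology D) N"
  let ?r = "\<lambda>\<xi>. \<lambda>\<beta>\<in>indices D. restrict \<xi> (level D \<beta>)"
  let ?T = "\<lambda>\<beta>. discrete_topology (alg_homs D (level D \<beta>))"
  obtain W where W: "openin (product_topology ?T (indices D)) W" "N = ?r -` W \<inter> X D"
    using N unfolding X_topology_def openin_pullback_topology by blast
  have "\<exists>F. finite F \<and> nbhd \<xi> F \<subseteq> N" if "\<xi> \<in> N" for \<xi>
  proof -
    have "?r \<xi> \<in> W" using that W by auto
    then obtain V where V: "finite {i \<in> indices D. V i \<noteq> topspace (?T i)}"
      "?r \<xi> \<in> PiE (indices D) V" "PiE (indices D) V \<subseteq> W"
      using W(1) unfolding openin_product_topology_alt by meson
    define J where "J = {i \<in> indices D. V i \<noteq> topspace (?T i)}"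
    obtain G where G: "\<And>i. i \<in> indices D \<Longrightarrow> finite (G i) \<and> level D i = av.span (G i)"
      using level_span by metis
    define F where "F = (\<Union>i\<in>J. G i)"
    have "nbhd \<xi> F \<subseteq> N"
    proof
      fix \<eta> assume \<eta>: "\<eta> \<in> nbhd \<xi> F"
      have \<xi>X: "khom \<xi>" using that W X_iff by auto
      have \<eta>X: "khom \<eta>" using \<eta> X_iff by auto
      have agree: "\<eta> x = \<xi> x" if "i \<in> J" "x \<in> level D i" for i x
      proof -
        have "x \<in> av.span (G i)" using G[of i] that by (auto simp: J_def)
        then show ?thesis
        proof (induction rule: av.span_induct_alt)
          case base
          then show ?case using \<xi>X \<eta>X by (simp add: khom_0)
        next
          case (step c x y)
          then have "\<eta> x = \<xi> x" using \<eta> \<open>i \<in> J\<close> by (auto simp: F_def)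
          then show ?case using step \<xi>X \<eta>X by (simp add: khomD)
        qed
      qed
      have "?r \<eta> \<in> PiE (indices D) V"
      proof (rule PiE_I)
        fix i assume i: "i \<in> indices D"
        show "?r \<eta> i \<in> V i"
        proof (cases "i \<in> J")
          case True
          then have "restrict \<eta> (level D i) = restrict \<xi> (level D i)" using agree by auto
          moreover have "?r \<xi> i \<in> V i" using V(2) i by (rule PiE_mem)
          ultimately show ?thesis using i by simp
        next
          case False
          then show ?thesis using i \<eta> restrict_X[of \<eta> i] by (simp add: J_def)
        qed
      qed auto
      then have "?r \<eta> \<in> W" using V(3) by blast
      then show "\<eta> \<in> N" using W(2) \<eta> by blast
    qed
    moreover have "finite F" using V(1) G by (auto simp: F_def J_def)
    ultimately show ?thesis by blast
  qed
  then show "N \<subseteq> X D \<and> (\<forall>\<xi>\<in>N. \<exists>F. finite F \<and> nbhd \<xi> F \<subseteq> N)" using W(2) by auto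
next
  assume N: "N \<subseteq> X D \<and> (\<forall>\<xi>\<in>N. \<exists>F. finite F \<and> nbhd \<xi> F \<subseteq> N)"
  show "openin (X_topology D) N"
  proof (subst openin_subopen, intro ballI)
    fix \<xi> assume \<xi>: "\<xi> \<in> N"
    then obtain F where F: "finite F" "nbhd \<xi> F \<subseteq> N" using N by blast
    obtain \<beta> where "\<beta> \<in> indices D" "F \<subseteq> level D \<beta>" using finite_in_level[OF F(1)] by blast
    moreover from this have "nbhd \<xi> (level D \<beta>) \<subseteq> N" using F(2) by blast
    ultimately show "\<exists>T. openin (X_topology D) T \<and> \<xi> \<in> T \<and> T \<subseteq> N"
      using open_nbhd_level[of \<xi> \<beta>] \<xi> N by (intro exI[of _ "nbhd \<xi> (level D \<beta>)"]) auto
  qed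
qed

lemma open_nbhd: "finite F \<Longrightarrow> openin (X_topology D) (nbhd \<xi> F)"
  unfolding openin_X by auto

lemma CX_simps [simp]:
  "f \<otimes>\<^bsub>CX D\<^esub> g = (\<lambda>\<xi>. f \<xi> * g \<xi>)" "f \<oplus>\<^bsub>CX D\<^esub> g = (\<lambda>\<xi>. f \<xi> + g \<xi>)"
  "c \<odot>\<^bsub>CX D\<^esub> f = (\<lambda>\<xi>. c * f \<xi>)" "\<one>\<^bsub>CX D\<^esub> = (\<lambda>\<xi>. of_bool (\<xi> \<in> X D))" "\<zero>\<^bsub>CX D\<^esub> = (\<lambda>\<xi>. 0)"
  "adj (CX D) f = (\<lambda>\<xi>. cnj (f \<xi>))"
  by (simp_all add: CX_def)

text \<open>Continuity in terms of finite subsets of \<open>A\<close>: precomposition of the characters with an endomorphism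
  or postcomposition with an automorphism transports such sets directly.\<close>

lemma CX_iff:
  "f \<in> carrier (CX D) \<longleftrightarrow> (\<forall>\<xi>. \<xi> \<notin> X D \<longrightarrow> f \<xi> = 0) \<and>
     (\<forall>\<xi>\<in>X D. \<forall>e>0. \<exists>F. finite F \<and> (\<forall>\<eta>\<in>nbhd \<xi> F. dist (f \<eta>) (f \<xi>) < e))"
proof -
  have "continuous_map (X_topology D) euclidean f \<longleftrightarrow>
      (\<forall>\<xi>\<in>X D. \<forall>e>0. \<exists>N. openin (X_topology D) N \<and> \<xi> \<in> N \<and> (\<forall>\<eta>\<in>N. dist (f \<eta>) (f \<xi>) < e))"
    using Met_TC.continuous_map_to_metric[of "X_topology D" f] by (simp add: topspace_X dist_commute)
  also have "\<dots> \<longleftrightarrow> (\<forall>\<xi>\<in>X D. \<forall>e>0. \<exists>F. finite F \<and> (\<forall>\<eta>\<in>nbhd \<xi> F. dist (f \<eta>) (f \<xi>) < e))"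
    (is "(\<forall>\<xi>\<in>X D. \<forall>e>0. ?P \<xi> e) \<longleftrightarrow> (\<forall>\<xi>\<in>X D. \<forall>e>0. ?Q \<xi> e)")
  proof (intro ball_cong refl all_cong)
    fix \<xi> and e :: real assume \<xi>: "\<xi> \<in> X D"
    show "?P \<xi> e \<longleftrightarrow> ?Q \<xi> e"
    proof
      assume "?P \<xi> e"
      then obtain N where N: "openin (X_topology D) N" "\<xi> \<in> N" "\<forall>\<eta>\<in>N. dist (f \<eta>) (f \<xi>) < e" by blast
      then obtain F where "finite F" "nbhd \<xi> F \<subseteq> N" unfolding openin_X by blast
      then show "?Q \<xi> e" using N(3) by blast
    next
      assume "?Q \<xi> e"
      then obtain F where "finite F" "\<forall>\<eta>\<in>nbhd \<xi> F. dist (f \<eta>) (f \<xi>) < e" by blast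
      then show "?P \<xi> e" using open_nbhd[of F \<xi>] \<xi> by (intro exI[of _ "nbhd \<xi> F"]) simp
    qed
  qed
  finally show ?thesis by (auto simp: CX_def)
qed

lemma CX_outside: "f \<in> carrier (CX D) \<Longrightarrow> \<xi> \<notin> X D \<Longrightarrow> f \<xi> = 0"
  by (simp add: CX_iff)

lemma CX_compose2:
  fixes G :: "complex \<times> complex \<Rightarrow> complex"
  assumes f: "f \<in> carrier (CX D)" and g: "g \<in> carrier (CX D)" and G: "continuous_on UNIV G"
  shows "(\<lambda>\<xi>. if \<xi> \<in> X D then G (f \<xi>, g \<xi>) else 0) \<in> carrier (CX D)"
  unfolding CX_iff
proof (intro conjI ballI allI impI)
  fix \<xi> and e :: real assume \<xi>: "\<xi> \<in> X D" and e: "e > 0"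
  obtain d where d: "d > 0" "\<And>z. dist z (f \<xi>, g \<xi>) < d \<Longrightarrow> dist (G z) (G (f \<xi>, g \<xi>)) < e"
    using G e unfolding continuous_on_iff by (metis UNIV_I)
  then have "d / 2 > 0" by simp
  then obtain F1 F2 where F: "finite F1" "\<forall>\<eta>\<in>nbhd \<xi> F1. dist (f \<eta>) (f \<xi>) < d / 2"
    "finite F2" "\<forall>\<eta>\<in>nbhd \<xi> F2. dist (g \<eta>) (g \<xi>) < d / 2"
    using f g \<xi> unfolding CX_iff by meson
  have "dist (G (f \<eta>, g \<eta>)) (G (f \<xi>, g \<xi>)) < e" if "\<eta> \<in> nbhd \<xi> (F1 \<union> F2)" for \<eta>
  proof (rule d(2))
    have "dist (f \<eta>, g \<eta>) (f \<xi>, g \<xi>) \<le> dist (f \<eta>) (f \<xi>) + dist (g \<eta>) (g \<xi>)"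
      unfolding dist_Pair_Pair by (rule sqrt_sum_squares_le_sum) auto
    then show "dist (f \<eta>, g \<eta>) (f \<xi>, g \<xi>) < d" using F(2,4) that by fastforce
  qed
  then show "\<exists>F. finite F \<and> (\<forall>\<eta>\<in>nbhd \<xi> F. dist (if \<eta> \<in> X D then G (f \<eta>, g \<eta>) else 0) (if \<xi> \<in> X D then G (f \<xi>, g \<xi>) else 0) < e)"
    using F(1,3) \<xi> by (intro exI[of _ "F1 \<union> F2"]) auto
qed simp

lemma CX_locally_constant:
  assumes "\<And>\<xi>. \<xi> \<notin> X D \<Longrightarrow> f \<xi> = 0"
    "\<And>\<xi>. \<xi> \<in> X D \<Longrightarrow> \<exists>F. finite F \<and> (\<forall>\<eta>\<in>nbhd \<xi> F. f \<eta> = f \<xi>)"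
  shows "f \<in> carrier (CX D)"
  unfolding CX_iff
proof (intro conjI allI impI ballI)
  fix \<xi> and e :: real assume "\<xi> \<in> X D" and e: "e > 0"
  then obtain F where "finite F" "\<forall>\<eta>\<in>nbhd \<xi> F. f \<eta> = f \<xi>" using assms(2) by blast
  then show "\<exists>F. finite F \<and> (\<forall>\<eta>\<in>nbhd \<xi> F. dist (f \<eta>) (f \<xi>) < e)"
    using e by (intro exI[of _ F]) simp
qed (rule assms(1))

lemma hat_CX: "hat D a \<in> carrier (CX D)"
  by (rule CX_locally_constant) (auto simp: hat_def intro!: exI[of _ "{a}"])

lemma CX_one: "(\<lambda>\<xi>. of_bool (\<xi> \<in> X D)) \<in> carrier (CX D)"
  by (rule CX_locally_constant) (auto intro!: exI[of _ "{}"])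

lemma CX_zero: "(\<lambda>\<xi>. 0) \<in> carrier (CX D)"
  by (rule CX_locally_constant) (auto intro!: exI[of _ "{}"])

lemma CX_add: "f \<in> carrier (CX D) \<Longrightarrow> g \<in> carrier (CX D) \<Longrightarrow> (\<lambda>\<xi>. f \<xi> + g \<xi>) \<in> carrier (CX D)"
proof -
  assume "f \<in> carrier (CX D)" "g \<in> carrier (CX D)"
  then have "(\<lambda>\<xi>. f \<xi> + g \<xi>) = (\<lambda>\<xi>. if \<xi> \<in> X D then (\<lambda>z. fst z + snd z) (f \<xi>, g \<xi>) else 0)"
    by (auto simp: CX_iff)
  then show ?thesis
    using CX_compose2[OF \<open>f \<in> _\<close> \<open>g \<in> _\<close>, of "\<lambda>z. fst z + snd z"] by (simp add: continuous_intros)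
qed

lemma CX_mult: "f \<in> carrier (CX D) \<Longrightarrow> g \<in> carrier (CX D) \<Longrightarrow> (\<lambda>\<xi>. f \<xi> * g \<xi>) \<in> carrier (CX D)"
proof -
  assume "f \<in> carrier (CX D)" "g \<in> carrier (CX D)"
  then have "(\<lambda>\<xi>. f \<xi> * g \<xi>) = (\<lambda>\<xi>. if \<xi> \<in> X D then (\<lambda>z. fst z * snd z) (f \<xi>, g \<xi>) else 0)"
    by (auto simp: CX_iff)
  then show ?thesis
    using CX_compose2[OF \<open>f \<in> _\<close> \<open>g \<in> _\<close>, of "\<lambda>z. fst z * snd z"] by (simp add: continuous_intros)
qed

lemma CX_compose:
  assumes f: "f \<in> carrier (CX D)" and G: "continuous_on UNIV G"
  shows "(\<lambda>\<xi>. if \<xi> \<in> X D then G (f \<xi>) else 0) \<in> carrier (CX D)"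
proof -
  have "continuous_on UNIV (\<lambda>z :: complex \<times> complex. G (fst z))"
    by (rule continuous_on_compose2[OF G]) (auto intro: continuous_intros)
  from CX_compose2[OF f f this] show ?thesis by (simp cong: if_cong)
qed

lemma CX_cnj: "f \<in> carrier (CX D) \<Longrightarrow> (\<lambda>\<xi>. cnj (f \<xi>)) \<in> carrier (CX D)"
proof -
  assume f: "f \<in> carrier (CX D)"
  then have "(\<lambda>\<xi>. cnj (f \<xi>)) = (\<lambda>\<xi>. if \<xi> \<in> X D then cnj (f \<xi>) else 0)" by (auto simp: CX_iff)
  then show ?thesis using CX_compose[OF f, of cnj] by (simp add: continuous_intros)
qed

lemma CX_smult: "f \<in> carrier (CX D) \<Longrightarrow> (\<lambda>\<xi>. c * f \<xi>) \<in> carrier (CX D)"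
proof -
  assume f: "f \<in> carrier (CX D)"
  then have "(\<lambda>\<xi>. c * f \<xi>) = (\<lambda>\<xi>. if \<xi> \<in> X D then c * f \<xi> else 0)" by (auto simp: CX_iff)
  then show ?thesis using CX_compose[OF f, of "\<lambda>z. c * z"] by (simp add: continuous_intros)
qed

subsection \<open>Compactness\<close>

text \<open>\<open>X\<close> is closed in the product of the finite sets \<open>vals a\<close>, since each condition on a character
  involves finitely many coordinates. By Tychonoff, finitely many of the neighbourhoods on which
  \<open>f\<close> varies by less than \<open>1\<close> cover \<open>X\<close>.\<close>

lemma CX_bounded:
  assumes f: "f \<in> carrier (CX D)"
  shows "\<exists>M>0. \<forall>\<xi>. cmod (f \<xi>) \<le> M"
proof -
  let ?Y = "product_topology (\<lambda>a. discrete_topology (vals a)) UNIV"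
  have top: "topspace ?Y = PiE UNIV vals" by simp
  have "compact_space ?Y"
    by (simp add: compact_space_product_topology compact_space_discrete_topology vals)
  have op: "openin ?Y {\<eta> \<in> PiE UNIV vals. \<forall>a\<in>F. \<eta> a = \<xi> a}" if "finite F" "\<xi> \<in> PiE UNIV vals" for F \<xi>
  proof -
    define W where "W = (\<lambda>a. if a \<in> F then {\<xi> a} else topspace (discrete_topology (vals a)))"
    have "openin ?Y (PiE UNIV W)"
    proof (rule product_topology_basis)
      show "openin (discrete_topology (vals a)) (W a)" for a
        using that by (auto simp: W_def)
      show "finite {a. W a \<noteq> topspace (discrete_topology (vals a))}"
        using that(1) by (rule finite_subset[rotated]) (auto simp: W_def)
    qed
    moreover have "PiE UNIV W = {\<eta> \<in> PiE UNIV vals. \<forall>a\<in>F. \<eta> a = \<xi> a}"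
      using that by (fastforce simp: W_def PiE_iff split: if_splits)
    ultimately show ?thesis by simp
  qed
  have XY: "X D \<subseteq> PiE UNIV vals" using vals(3) X_iff by auto
  have "openin ?Y (PiE UNIV vals - X D)"
  proof (subst openin_subopen, intro ballI)
    fix \<xi> assume \<xi>: "\<xi> \<in> PiE UNIV vals - X D"
    then have "\<not> khom \<xi>" by (simp add: X_iff)
    then consider "\<xi> 1 \<noteq> 1" | x y where "\<xi> (x + y) \<noteq> \<xi> x + \<xi> y" | x y where "\<xi> (x * y) \<noteq> \<xi> x * \<xi> y"
      | c x where "\<xi> (scaleA D c x) \<noteq> \<sigma> c * \<xi> x"
      unfolding khom_def by blast
    then have "\<exists>F. finite F \<and> (\<forall>\<eta>. (\<forall>a\<in>F. \<eta> a = \<xi> a) \<longrightarrow> \<not> khom \<eta>)"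
    proof cases
      case 1 then show ?thesis by (intro exI[of _ "{1}"]) (auto simp: khom_def)
    next
      case (2 x y) then show ?thesis by (intro exI[of _ "{x, y, x + y}"]) (auto dest: khomD(2)[of _ x y])
    next
      case (3 x y) then show ?thesis by (intro exI[of _ "{x, y, x * y}"]) (auto dest: khomD(3)[of _ x y])
    next
      case (4 c x) then show ?thesis by (intro exI[of _ "{x, scaleA D c x}"]) (auto dest: khomD(4)[of _ c x])
    qed
    then obtain F where F: "finite F" "\<And>\<eta>. (\<forall>a\<in>F. \<eta> a = \<xi> a) \<Longrightarrow> \<not> khom \<eta>" by blast
    show "\<exists>T. openin ?Y T \<and> \<xi> \<in> T \<and> T \<subseteq> PiE UNIV vals - X D"
      using op[OF F(1), of \<xi>] \<xi> F(2)
      by (intro exI[of _ "{\<eta> \<in> PiE UNIV vals. \<forall>a\<in>F. \<eta> a = \<xi> a}"]) (auto simp: X_iff)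
  qed
  then have "closedin ?Y (X D)" using XY by (simp add: closedin_def)
  with \<open>compact_space ?Y\<close> have cpt: "compactin ?Y (X D)" by (rule closedin_compact_space)
  have "\<forall>\<xi>\<in>X D. \<exists>F. finite F \<and> (\<forall>\<eta>\<in>nbhd \<xi> F. dist (f \<eta>) (f \<xi>) < 1)"
    using f zero_less_one[where ?'a = real] unfolding CX_iff by blast
  from bchoice[OF this] obtain F where "\<forall>\<xi>\<in>X D. finite (F \<xi>) \<and> (\<forall>\<eta>\<in>nbhd \<xi> (F \<xi>). dist (f \<eta>) (f \<xi>) < 1)" ..
  then have F: "\<And>\<xi>. \<xi> \<in> X D \<Longrightarrow> finite (F \<xi>)" "\<And>\<xi> \<eta>. \<xi> \<in> X D \<Longrightarrow> \<eta> \<in> nbhd \<xi> (F \<xi>) \<Longrightarrow> dist (f \<eta>) (f \<xi>) < 1"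
    by blast+
  define N where "N = (\<lambda>\<xi>. {\<eta> \<in> PiE UNIV vals. \<forall>a\<in>F \<xi>. \<eta> a = \<xi> a})"
  have "\<exists>\<F>. finite \<F> \<and> \<F> \<subseteq> N ` X D \<and> X D \<subseteq> \<Union>\<F>"
  proof -
    have "\<forall>W\<in>N ` X D. openin ?Y W" using op F(1) XY by (auto simp: N_def)
    moreover have "X D \<subseteq> \<Union>(N ` X D)" using XY by (auto simp: N_def)
    ultimately show ?thesis using cpt unfolding compactin_def by blast
  qed
  then obtain T where T: "finite T" "T \<subseteq> X D" "X D \<subseteq> (\<Union>\<xi>\<in>T. N \<xi>)"
    by (metis finite_subset_image)
  define M where "M = (\<Sum>\<xi>\<in>T. cmod (f \<xi>)) + 1"
  have pos: "M > 0" unfolding M_def by (simp add: add_nonneg_pos sum_nonneg)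
  have "cmod (f \<eta>) \<le> M" for \<eta>
  proof (cases "\<eta> \<in> X D")
    case True
    then obtain \<xi> where \<xi>: "\<xi> \<in> T" "\<eta> \<in> N \<xi>" using T(3) by auto
    then have "dist (f \<eta>) (f \<xi>) < 1" using F(2)[of \<xi> \<eta>] T(2) True by (auto simp: N_def)
    moreover have "cmod (f \<xi>) \<le> (\<Sum>\<xi>\<in>T. cmod (f \<xi>))" using T(1) \<xi>(1) by (intro member_le_sum) auto
    ultimately show ?thesis
      unfolding M_def dist_norm using norm_triangle_ineq2[of "f \<eta>" "f \<xi>"] by linarith
  next
    case False
    then show ?thesis using pos f by (simp add: CX_iff)
  qed
  then show ?thesis using pos by blast
qed

end

section \<open>The Galois action on the crossed product\<close>

context endomotive
begin

subsection \<open>Endomorphisms\<close>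

text \<open>\<open>\<xi>(\<rho>(1))\<close> is an idempotent of a field.\<close>

lemma comp_X:
  assumes \<xi>: "\<xi> \<in> X D" and \<rho>: "\<rho> \<in> S" and nz: "\<xi> (\<rho> 1) \<noteq> 0"
  shows "\<xi> (\<rho> 1) = 1" "\<xi> \<circ> \<rho> \<in> X D"
proof -
  have "\<xi> (\<rho> 1) * \<xi> (\<rho> 1) = \<xi> (\<rho> 1)"
    using \<xi> endo_hom(2)[OF \<rho>, of 1 1] khomD(3)[of \<xi> "\<rho> 1" "\<rho> 1"] by (simp add: X_iff)
  then show one: "\<xi> (\<rho> 1) = 1" using nz by simp
  then show "\<xi> \<circ> \<rho> \<in> X D" using \<xi> by (simp add: X_iff khom_def endo_hom[OF \<rho>])
qed

lemma endo_CX_closed: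
  assumes \<rho>: "\<rho> \<in> S" and f: "f \<in> carrier (CX D)"
  shows "endo_CX D \<rho> f \<in> carrier (CX D)"
  unfolding CX_iff
proof (intro conjI allI impI ballI)
  fix \<xi> and e :: real assume \<xi>: "\<xi> \<in> X D" and e: "e > 0"
  show "\<exists>F. finite F \<and> (\<forall>\<eta>\<in>nbhd \<xi> F. dist (endo_CX D \<rho> f \<eta>) (endo_CX D \<rho> f \<xi>) < e)"
  proof (cases "\<xi> (\<rho> 1) = 0")
    case True
    then show ?thesis using e by (intro exI[of _ "{\<rho> 1}"]) (auto simp: endo_CX_def)
  next
    case False
    note \<xi>\<rho> = comp_X[OF \<xi> \<rho> False]
    obtain F where F: "finite F" "\<forall>\<eta>\<in>nbhd (\<xi> \<circ> \<rho>) F. dist (f \<eta>) (f (\<xi> \<circ> \<rho>)) < e"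
      using f e \<xi>\<rho>(2) unfolding CX_iff by blast
    have "dist (endo_CX D \<rho> f \<eta>) (endo_CX D \<rho> f \<xi>) < e" if \<eta>: "\<eta> \<in> nbhd \<xi> (insert (\<rho> 1) (\<rho> ` F))" for \<eta>
    proof -
      have "\<eta> (\<rho> 1) = 1" using \<eta> \<xi>\<rho>(1) by simp
      moreover from this have "\<eta> \<circ> \<rho> \<in> nbhd (\<xi> \<circ> \<rho>) F"
        using comp_X(2)[of \<eta> \<rho>] \<rho> \<eta> by simp
      ultimately show ?thesis using F(2) \<eta> \<xi> \<xi>\<rho>(1) by (simp add: endo_CX_def)
    qed
    then show ?thesis using F(1) by (intro exI[of _ "insert (\<rho> 1) (\<rho> ` F)"]) auto
  qed
qed (simp add: endo_CX_def)

lemma endo_CX_hat: "\<rho> \<in> S \<Longrightarrow> endo_CX D \<rho> (hat D a) = hat D (\<rho> a)"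
proof
  fix \<xi> assume \<rho>: "\<rho> \<in> S"
  show "endo_CX D \<rho> (hat D a) \<xi> = hat D (\<rho> a) \<xi>"
  proof (cases "\<xi> \<in> X D")
    case True
    have "\<rho> a = \<rho> 1 * \<rho> a" using endo_hom(2)[OF \<rho>, of 1 a] by simp
    then have *: "\<xi> (\<rho> a) = \<xi> (\<rho> 1) * \<xi> (\<rho> a)" using True by (metis X_iff khomD(3))
    show ?thesis
    proof (cases "\<xi> (\<rho> 1) = 0")
      case True
      then show ?thesis using * by (simp add: endo_CX_def hat_def)
    next
      case False
      then show ?thesis using comp_X[OF \<open>\<xi> \<in> X D\<close> \<rho>] True by (simp add: endo_CX_def hat_def)
    qed
  qed (simp add: endo_CX_def hat_def)
qed

text \<open>\<open>\<rho>\<close> is injective on \<open>C(X)\<close> since every character \<open>\<eta>\<close> is of the form \<open>\<xi> \<circ> \<rho>\<close>: take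
  \<open>\<xi> a = \<eta> (\<rho>\<^sup>-\<^sup>1 (\<rho>(1) a \<rho>(1)))\<close>.\<close>

lemma comp_X_surj:
  assumes \<eta>: "\<eta> \<in> X D" and \<rho>: "\<rho> \<in> S"
  shows "\<exists>\<xi>\<in>X D. \<xi> (\<rho> 1) = 1 \<and> \<xi> \<circ> \<rho> = \<eta>"
proof -
  have inj: "inj \<rho>" using endo_corner[OF \<rho>] by (simp add: bij_betw_def)
  have e: "\<rho> 1 * \<rho> 1 = \<rho> 1" using endo_hom(2)[OF \<rho>, of 1 1] by simp
  define r where "r = (\<lambda>a. inv_into UNIV \<rho> (\<rho> 1 * a * \<rho> 1))"
  have "\<rho> 1 * a * \<rho> 1 \<in> range \<rho>" for a
    using endo_corner[OF \<rho>] by (auto simp: bij_betw_def)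
  then have \<rho>r: "\<rho> (r a) = \<rho> 1 * a" for a
    using e by (simp add: r_def f_inv_into_f) (metis mult.assoc mult.commute)
  have r: "r b = c" if "\<rho> 1 * b = \<rho> c" for b c
    using inj \<rho>r[of b] that by (simp add: injD)
  have "khom (\<eta> \<circ> r)"
  proof -
    have "r 1 = 1" by (rule r) simp
    moreover have "r (x + y) = r x + r y" for x y
      by (rule r) (simp add: endo_hom[OF \<rho>] \<rho>r distrib_left)
    moreover have "r (x * y) = r x * r y" for x y
      by (rule r) (simp add: endo_hom[OF \<rho>] \<rho>r, metis e mult.assoc mult.commute)
    moreover have "r (scaleA D c x) = scaleA D c (r x)" for c x
      by (rule r) (simp add: endo_hom[OF \<rho>] \<rho>r, metis scale_mult mult.commute)
    ultimately show ?thesis using \<eta> by (simp add: X_iff khom_def)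
  qed
  moreover have "r (\<rho> a) = a" for a
    by (rule r) (use endo_hom(2)[OF \<rho>, of 1 a] in simp)
  ultimately show ?thesis
    using \<eta> by (intro bexI[of _ "\<eta> \<circ> r"]) (auto simp: X_iff khomD)
qed

lemma endo_CX_inj: "\<rho> \<in> S \<Longrightarrow> inj_on (endo_CX D \<rho>) (carrier (CX D))"
proof (rule inj_onI, rule ext)
  fix f g \<eta> assume \<rho>: "\<rho> \<in> S" and fg: "f \<in> carrier (CX D)" "g \<in> carrier (CX D)" "endo_CX D \<rho> f = endo_CX D \<rho> g"
  show "f \<eta> = g \<eta>"
  proof (cases "\<eta> \<in> X D")
    case True
    then obtain \<xi> where "\<xi> \<in> X D" "\<xi> (\<rho> 1) = 1" "\<xi> \<circ> \<rho> = \<eta>" using comp_X_surj[OF _ \<rho>] by blast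
    then show ?thesis using fun_cong[OF fg(3), of \<xi>] by (simp add: endo_CX_def)
  qed (use fg in \<open>simp add: CX_outside\<close>)
qed

subsection \<open>The Galois group\<close>

lemma Kbar_closed: "x \<in> Kbar D \<Longrightarrow> y \<in> Kbar D \<Longrightarrow> x + y \<in> Kbar D" "x \<in> Kbar D \<Longrightarrow> y \<in> Kbar D \<Longrightarrow> x * y \<in> Kbar D"
  unfolding Kbar_def by (rule algebraic_add_mult[OF embedding]; assumption)+

lemma Kbar_base: "\<sigma> c \<in> Kbar D"
proof -
  have "poly (map_poly \<sigma> [:- c, 1:]) (\<sigma> c) = 0"
    by (simp add: map_poly_pCons \<sigma>_0 \<sigma>_1 \<sigma>_uminus)
  then show ?thesis
    unfolding Kbar_def alg_closure_in_C_def by (intro CollectI exI[of _ "[:- c, 1:]"]) simp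
qed

lemma group_Gal: "group (Gal D)"
  unfolding Gal_def by (rule group_galois_group) (auto intro: Kbar_closed Kbar_base)

interpretation G: group "Gal D" by (rule group_Gal)

lemma Gal_iff: "\<alpha> \<in> carrier (Gal D) \<longleftrightarrow> \<alpha> \<in> Bij (Kbar D) \<and>
    (\<forall>x\<in>Kbar D. \<forall>y\<in>Kbar D. \<alpha> (x + y) = \<alpha> x + \<alpha> y \<and> \<alpha> (x * y) = \<alpha> x * \<alpha> y) \<and> (\<forall>c. \<alpha> (\<sigma> c) = \<sigma> c)"
  by (auto simp: Gal_def galois_group_def)

lemma GalD:
  assumes "\<alpha> \<in> carrier (Gal D)"
  shows "x \<in> Kbar D \<Longrightarrow> \<alpha> x \<in> Kbar D"
    "x \<in> Kbar D \<Longrightarrow> y \<in> Kbar D \<Longrightarrow> \<alpha> (x + y) = \<alpha> x + \<alpha> y"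
    "x \<in> Kbar D \<Longrightarrow> y \<in> Kbar D \<Longrightarrow> \<alpha> (x * y) = \<alpha> x * \<alpha> y"
    "\<alpha> (\<sigma> c) = \<sigma> c" "\<alpha> 0 = 0" "\<alpha> 1 = 1"
proof -
  have base: "\<alpha> (\<sigma> c) = \<sigma> c" for c using assms by (simp add: Gal_iff)
  show "\<alpha> (\<sigma> c) = \<sigma> c" "\<alpha> 0 = 0" "\<alpha> 1 = 1" using base[of c] base[of 0] base[of 1] by (simp_all add: \<sigma>_0 \<sigma>_1)
qed (use assms Bij_imp_funcset in \<open>auto simp: Gal_iff\<close>)

lemma Gal_mult: "\<alpha> \<in> carrier (Gal D) \<Longrightarrow> \<beta> \<in> carrier (Gal D) \<Longrightarrow> x \<in> Kbar D \<Longrightarrow> (\<alpha> \<otimes>\<^bsub>Gal D\<^esub> \<beta>) x = \<alpha> (\<beta> x)"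
  by (simp add: Gal_def galois_group_def BijGroup_def compose_eq)

lemma Gal_one: "x \<in> Kbar D \<Longrightarrow> \<one>\<^bsub>Gal D\<^esub> x = x"
  by (simp add: Gal_def galois_group_def BijGroup_def)

lemma act_X_closed: "\<alpha> \<in> carrier (Gal D) \<Longrightarrow> \<xi> \<in> X D \<Longrightarrow> act_X \<alpha> \<xi> \<in> X D"
  using X_Kbar[of \<xi>] Kbar_base by (simp add: X_iff khom_def act_X_def GalD)

lemma act_CX_apply: "\<xi> \<in> X D \<Longrightarrow> act_CX D \<alpha> h \<xi> = h (act_X (inv\<^bsub>Gal D\<^esub> \<alpha>) \<xi>)"
  by (simp add: act_CX_def)

lemma act_CX_closed:
  assumes \<alpha>: "\<alpha> \<in> carrier (Gal D)" and f: "f \<in> carrier (CX D)"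
  shows "act_CX D \<alpha> f \<in> carrier (CX D)"
  unfolding CX_iff
proof (intro conjI allI impI ballI)
  fix \<xi> and e :: real assume \<xi>: "\<xi> \<in> X D" and e: "e > 0"
  let ?b = "inv\<^bsub>Gal D\<^esub> \<alpha>"
  have b: "?b \<in> carrier (Gal D)" using \<alpha> by simp
  obtain F where F: "finite F" "\<forall>\<eta>\<in>nbhd (act_X ?b \<xi>) F. dist (f \<eta>) (f (act_X ?b \<xi>)) < e"
    using f e act_X_closed[OF b \<xi>] unfolding CX_iff by blast
  have "dist (act_CX D \<alpha> f \<eta>) (act_CX D \<alpha> f \<xi>) < e" if \<eta>: "\<eta> \<in> nbhd \<xi> F" for \<eta>
  proof -
    have "act_X ?b \<eta> \<in> nbhd (act_X ?b \<xi>) F"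
      using \<eta> act_X_closed[OF b, of \<eta>] by (auto simp: act_X_def)
    then show ?thesis using F(2) \<eta> \<xi> by (simp add: act_CX_apply)
  qed
  then show "\<exists>F. finite F \<and> (\<forall>\<eta>\<in>nbhd \<xi> F. dist (act_CX D \<alpha> f \<eta>) (act_CX D \<alpha> f \<xi>) < e)"
    using F(1) by blast
qed (simp add: act_CX_def)

lemma act_CX_mult:
  assumes "\<alpha> \<in> carrier (Gal D)" "\<beta> \<in> carrier (Gal D)"
  shows "act_CX D \<alpha> (act_CX D \<beta> f) = act_CX D (\<alpha> \<otimes>\<^bsub>Gal D\<^esub> \<beta>) f"
proof
  fix \<xi> show "act_CX D \<alpha> (act_CX D \<beta> f) \<xi> = act_CX D (\<alpha> \<otimes>\<^bsub>Gal D\<^esub> \<beta>) f \<xi>"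
  proof (cases "\<xi> \<in> X D")
    case True
    have "act_X (inv\<^bsub>Gal D\<^esub> \<beta>) (act_X (inv\<^bsub>Gal D\<^esub> \<alpha>) \<xi>) = act_X (inv\<^bsub>Gal D\<^esub> (\<alpha> \<otimes>\<^bsub>Gal D\<^esub> \<beta>)) \<xi>"
      using assms X_Kbar[OF True] by (auto simp: act_X_def G.inv_mult_group Gal_mult)
    then show ?thesis using assms True act_X_closed[of "inv\<^bsub>Gal D\<^esub> \<alpha>" \<xi>] by (simp add: act_CX_apply)
  qed (simp add: act_CX_def)
qed

lemma act_CX_one:
  assumes "f \<in> carrier (CX D)"
  shows "act_CX D \<one>\<^bsub>Gal D\<^esub> f = f"
proof
  fix \<xi> show "act_CX D \<one>\<^bsub>Gal D\<^esub> f \<xi> = f \<xi>"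
  proof (cases "\<xi> \<in> X D")
    case True
    have "act_X \<one>\<^bsub>Gal D\<^esub> \<xi> = \<xi>" using X_Kbar[OF True] by (auto simp: act_X_def Gal_one)
    then show ?thesis using True by (simp add: act_CX_apply)
  qed (use assms in \<open>simp add: act_CX_def CX_outside\<close>)
qed

lemma act_CX_inverse:
  assumes "\<alpha> \<in> carrier (Gal D)" "f \<in> carrier (CX D)"
  shows "act_CX D \<alpha> (act_CX D (inv\<^bsub>Gal D\<^esub> \<alpha>) f) = f" "act_CX D (inv\<^bsub>Gal D\<^esub> \<alpha>) (act_CX D \<alpha> f) = f"
  using assms by (simp_all add: act_CX_mult act_CX_one)

text \<open>The idempotent \<open>\<xi>(\<rho>(1))\<close> is \<open>0\<close> or \<open>1\<close>, so it is fixed by the Galois group.\<close>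

lemma act_CX_endo:
  assumes \<alpha>: "\<alpha> \<in> carrier (Gal D)" and \<rho>: "\<rho> \<in> S"
  shows "act_CX D \<alpha> (endo_CX D \<rho> f) = endo_CX D \<rho> (act_CX D \<alpha> f)"
proof
  fix \<xi>
  let ?b = "inv\<^bsub>Gal D\<^esub> \<alpha>"
  have b: "?b \<in> carrier (Gal D)" using \<alpha> by simp
  show "act_CX D \<alpha> (endo_CX D \<rho> f) \<xi> = endo_CX D \<rho> (act_CX D \<alpha> f) \<xi>"
  proof (cases "\<xi> \<in> X D")
    case True
    have comp: "act_X ?b \<xi> \<circ> \<rho> = act_X ?b (\<xi> \<circ> \<rho>)" by (simp add: act_X_def comp_assoc)
    show ?thesis
    proof (cases "\<xi> (\<rho> 1) = 0")
      case True
      then show ?thesis using b by (simp add: act_CX_def endo_CX_def act_X_def GalD)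
    next
      case False
      note comp_X[OF \<open>\<xi> \<in> X D\<close> \<rho> False]
      then show ?thesis
        using b True act_X_closed[OF b True] comp by (simp add: act_CX_def endo_CX_def act_X_def GalD)
    qed
  qed (simp add: act_CX_def endo_CX_def)
qed

subsection \<open>The presentation of the crossed product\<close>

abbreviation "gens \<equiv> cp_gens (CX D) S"
abbreviation "rel \<equiv> cp_relation (CX D) S (endo_CX D)"
abbreviation "rels \<equiv> cp_relators (CX D) S (endo_CX D)"

lemma gens_iff [simp]: "Coef f \<in> gens \<longleftrightarrow> f \<in> carrier (CX D)" "U \<rho> \<in> gens \<longleftrightarrow> \<rho> \<in> S" "Ustar \<rho> \<in> gens \<longleftrightarrow> \<rho> \<in> S"
  by (auto simp: cp_gens_def)

lemma cp_adj_invol: "cp_adj (cp_adj a) = a"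
  by (cases a) auto

lemma cp_adj_closed: "a \<in> gens \<Longrightarrow> cp_adj a \<in> gens"
  by (cases a) (auto simp: CX_cnj)

text \<open>The triangle inequality for a seminorm is only available inside the free algebra on the
  generators, so this is needed to pass from \<open>p (x - y) = 0\<close> to \<open>p x = p y\<close>.\<close>

lemma rel_closed:
  assumes "rel x y"
  shows "x \<in> free_carrier gens" "y \<in> free_carrier gens"
  using assms
  by (cases; auto intro!: free_gen free_add free_mult CX_add CX_mult CX_smult CX_one endo_CX_closed endo_comp)+

text \<open>The C*-seminorms that annihilate the relators are bounded on the generators. On the isometries
  the bound is \<open>1\<close>. A real function \<open>h\<close> with values in \<open>[-1, 1]\<close> is the mean of the unitary
  \<open>h + i sqrt (1 - h\<^sup>2)\<close> and its adjoint, so it has seminorm at most \<open>1\<close>; a general function is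
  bounded because \<open>X\<close> is compact, so it is a linear combination of two such.\<close>

context
  fixes p assumes p: "cstar_seminorm gens cp_adj p" "\<forall>r\<in>rels. p r = 0"
begin

lemma p_props:
  assumes "x \<in> free_carrier gens"
  shows "0 \<le> p x" "p (free_star cp_adj x * x) = (p x)\<^sup>2" "p (scal c * x) = cmod c * p x"
    "y \<in> free_carrier gens \<Longrightarrow> p (x + y) \<le> p x + p y"
    "y \<in> free_carrier gens \<Longrightarrow> p (x * y) \<le> p x * p y"
  using assms p(1) unfolding cstar_seminorm_def by blast+

lemma p_rel:
  assumes "rel x y"
  shows "p x = p y"
proof -
  note xy = rel_closed[OF assms]
  have "x - y \<in> rels" using assms by (auto simp: cp_relators_def)
  then have z1: "p (x - y) = 0" using p(2) by blast
  have "p (y - x) = p (scal (-1) * (x - y))" by (simp add: scal_minus_1)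
  then have z2: "p (y - x) = 0" using z1 p_props(3)[OF free_diff[OF xy], of "-1"] by simp
  show ?thesis
    using p_props(4)[OF free_diff[OF xy] xy(2)] p_props(4)[OF free_diff[OF xy(2,1)] xy(1)] z1 z2 by simp
qed

lemma p_U: assumes "\<rho> \<in> S" shows "p (gen (U \<rho>)) \<le> 1" "p (gen (Ustar \<rho>)) \<le> 1"
proof -
  have g: "gen (U \<rho>) \<in> free_carrier gens" "gen (Ustar \<rho>) \<in> free_carrier gens"
    using assms by (auto intro: free_gen)
  have "(p (gen (U \<rho>)))\<^sup>2 = p 1"
    using p_props(2)[OF g(1)] p_rel[OF cp_relation.intros(5)[OF assms]] by (simp add: star_gen)
  then have "(p (gen (U \<rho>)))\<^sup>2 \<le> 1\<^sup>2" using cstar_seminorm_one[OF p(1)] by simp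
  then show U: "p (gen (U \<rho>)) \<le> 1" by (rule power2_le_imp_le) simp
  have "(p (gen (Ustar \<rho>)))\<^sup>2 \<le> p (gen (U \<rho>)) * p (gen (Ustar \<rho>))"
    using p_props(2)[OF g(2)] p_props(5)[OF g] by (simp add: star_gen)
  also have "\<dots> \<le> 1 * p (gen (Ustar \<rho>))" using U p_props(1)[OF g(2)] by (rule mult_right_mono)
  finally have le: "p (gen (Ustar \<rho>)) * p (gen (Ustar \<rho>)) \<le> 1 * p (gen (Ustar \<rho>))"
    by (simp only: power2_eq_square)
  show "p (gen (Ustar \<rho>)) \<le> 1"
  proof (rule ccontr)
    assume gt: "\<not> p (gen (Ustar \<rho>)) \<le> 1"
    then have "1 * p (gen (Ustar \<rho>)) < p (gen (Ustar \<rho>)) * p (gen (Ustar \<rho>))"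
      by (intro mult_strict_right_mono) auto
    then show False using le by simp
  qed
qed

lemma p_unitary:
  assumes u: "u \<in> carrier (CX D)" "\<And>\<xi>. \<xi> \<in> X D \<Longrightarrow> cnj (u \<xi>) * u \<xi> = 1"
  shows "p (gen (Coef u)) \<le> 1"
proof -
  let ?v = "\<lambda>\<xi>. cnj (u \<xi>)"
  have v: "?v \<in> carrier (CX D)" by (rule CX_cnj[OF u(1)])
  have "?v \<otimes>\<^bsub>CX D\<^esub> u = \<one>\<^bsub>CX D\<^esub>" using u by (auto simp: CX_outside)
  then have "(p (gen (Coef u)))\<^sup>2 = p (gen (Coef \<one>\<^bsub>CX D\<^esub>))"
    using p_props(2)[OF free_gen, of "Coef u"] p_rel[OF cp_relation.intros(2)[OF v u(1)]] u(1)
    by (simp add: star_gen del: CX_simps)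
  also have "\<dots> = p 1" by (rule p_rel[OF cp_relation.intros(4)])
  finally have "(p (gen (Coef u)))\<^sup>2 \<le> 1\<^sup>2" using cstar_seminorm_one[OF p(1)] by simp
  then show ?thesis by (rule power2_le_imp_le) simp
qed

lemma p_smult: "f \<in> carrier (CX D) \<Longrightarrow> p (gen (Coef (\<lambda>\<xi>. c * f \<xi>))) = cmod c * p (gen (Coef f))"
  using p_rel[OF cp_relation.intros(3), of f c] p_props(3)[OF free_gen, of "Coef f" c] by simp

lemma p_add: "f \<in> carrier (CX D) \<Longrightarrow> g \<in> carrier (CX D) \<Longrightarrow>
    p (gen (Coef (\<lambda>\<xi>. f \<xi> + g \<xi>))) \<le> p (gen (Coef f)) + p (gen (Coef g))"
  using p_rel[OF cp_relation.intros(1), of f g] p_props(4)[OF free_gen free_gen, of "Coef f" "Coef g"] by simp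

lemma p_real:
  assumes h: "h \<in> carrier (CX D)" "\<And>\<xi>. h \<xi> = of_real (r \<xi>)" "\<And>\<xi>. \<bar>r \<xi>\<bar> \<le> 1"
  shows "p (gen (Coef h)) \<le> 1"
proof -
  define G where "G = (\<lambda>z. z + \<i> * of_real (sqrt (1 - (Re z)\<^sup>2)))"
  define u where "u = (\<lambda>\<xi>. if \<xi> \<in> X D then G (h \<xi>) else 0)"
  have u: "u \<in> carrier (CX D)"
    unfolding u_def by (rule CX_compose[OF h(1)]) (auto simp: G_def intro!: continuous_intros)
  have unit: "cnj (G (h \<xi>)) * G (h \<xi>) = 1" for \<xi>
  proof -
    have "(r \<xi>)\<^sup>2 \<le> 1" using h(3)[of \<xi>] by (simp add: abs_square_le_1)
    then have "(cmod (G (h \<xi>)))\<^sup>2 = 1" by (simp add: G_def h(2) cmod_power2)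
    then show ?thesis by (metis complex_norm_square mult.commute of_real_1)
  qed
  have "p (gen (Coef u)) \<le> 1" "p (gen (Coef (\<lambda>\<xi>. cnj (u \<xi>)))) \<le> 1"
    using p_unitary[OF u] p_unitary[OF CX_cnj[OF u]] unit by (auto simp: u_def mult.commute)
  then have "p (gen (Coef (\<lambda>\<xi>. u \<xi> + cnj (u \<xi>)))) \<le> 2"
    using p_add[OF u CX_cnj[OF u]] by simp
  moreover have "(\<lambda>\<xi>. u \<xi> + cnj (u \<xi>)) = (\<lambda>\<xi>. 2 * h \<xi>)"
    using CX_outside[OF h(1)] by (auto simp: u_def G_def h(2) complex_eq_iff)
  ultimately show ?thesis using p_smult[OF h(1), of 2] by simp
qed

lemma p_function:
  assumes f: "f \<in> carrier (CX D)" and M: "M > 0" "\<And>\<xi>. cmod (f \<xi>) \<le> M"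
  shows "p (gen (Coef f)) \<le> 2 * M"
proof -
  define h where "h = (\<lambda>\<xi>. complex_of_real (Re (f \<xi>) / M))"
  define k where "k = (\<lambda>\<xi>. complex_of_real (Im (f \<xi>) / M))"
  have eqs: "h = (\<lambda>\<xi>. if \<xi> \<in> X D then complex_of_real (Re (f \<xi>) / M) else 0)"
    "k = (\<lambda>\<xi>. if \<xi> \<in> X D then complex_of_real (Im (f \<xi>) / M) else 0)"
    using CX_outside[OF f] by (auto simp: h_def k_def)
  have hk: "h \<in> carrier (CX D)" "k \<in> carrier (CX D)"
    unfolding eqs using M by (auto intro!: CX_compose[OF f] continuous_intros)
  have "\<bar>Re (f \<xi>) / M\<bar> \<le> 1" "\<bar>Im (f \<xi>) / M\<bar> \<le> 1" for \<xi>
    using M(1) order.trans[OF abs_Re_le_cmod M(2)[of \<xi>]] order.trans[OF abs_Im_le_cmod M(2)[of \<xi>]]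
    by (simp_all add: divide_le_eq_1)
  then have "p (gen (Coef h)) \<le> 1" "p (gen (Coef k)) \<le> 1"
    using p_real[OF hk(1), of "\<lambda>\<xi>. Re (f \<xi>) / M"] p_real[OF hk(2), of "\<lambda>\<xi>. Im (f \<xi>) / M"]
    by (simp_all add: h_def k_def)
  moreover have "f = (\<lambda>\<xi>. of_real M * h \<xi> + (\<i> * of_real M) * k \<xi>)"
    using M(1) by (auto simp: h_def k_def complex_eq_iff)
  then have "p (gen (Coef f)) \<le> M * p (gen (Coef h)) + M * p (gen (Coef k))"
    using p_add[OF CX_smult[OF hk(1)] CX_smult[OF hk(2)], of "of_real M" "\<i> * of_real M"]
      p_smult[OF hk(1), of "of_real M"] p_smult[OF hk(2), of "\<i> * of_real M"] M(1)
    by (simp add: norm_mult)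
  ultimately show ?thesis using M(1) mult_left_mono[of _ 1 M] by (smt (verit))
qed

end

sublocale cp: star_presentation gens cp_adj rels
proof
  fix a assume a: "a \<in> gens"
  show "\<exists>M. \<forall>p. cstar_seminorm gens cp_adj p \<and> (\<forall>r\<in>rels. p r = 0) \<longrightarrow> p (gen a) \<le> M"
  proof (cases a)
    case (Coef f)
    then have f: "f \<in> carrier (CX D)" using a by simp
    obtain M where "M > 0" "\<And>\<xi>. cmod (f \<xi>) \<le> M" using CX_bounded[OF f] by blast
    then show ?thesis using p_function[OF _ _ f] Coef by (intro exI[of _ "2 * M"]) blast
  next
    case (U \<rho>)
    then show ?thesis using p_U(1) a by (intro exI[of _ 1]) auto
  next
    case (Ustar \<rho>)
    then show ?thesis using p_U(2) a by (intro exI[of _ 1]) auto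
  qed
qed (auto intro: cp_adj_closed cp_adj_invol)

abbreviation "CP \<equiv> cstar_cp D"

lemma CP_eq: "CP = cp.B"
  by (simp add: cstar_cp_def)

lemma cp_class_eq: "cp_class D x = cp.cls (\<lambda>n. x)"
  by (simp add: cp_class_def cp.const_class_eq)

subsection \<open>The action\<close>

definition act_gen :: "(complex \<Rightarrow> complex) \<Rightarrow> (('a \<Rightarrow> complex) \<Rightarrow> complex, 'a \<Rightarrow> 'a) cp_gen \<Rightarrow>
    (('a \<Rightarrow> complex) \<Rightarrow> complex, 'a \<Rightarrow> 'a) cp_gen" where
  "act_gen \<alpha> = map_cp_gen (act_CX D \<alpha>) id"

lemma act_gen_simps [simp]:
  "act_gen \<alpha> (Coef f) = Coef (act_CX D \<alpha> f)" "act_gen \<alpha> (U \<rho>) = U \<rho>" "act_gen \<alpha> (Ustar \<rho>) = Ustar \<rho>"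
  by (simp_all add: act_gen_def)

text \<open>The Galois action on \<open>C(X)\<close> is by algebra automorphisms commuting with the endomorphisms, so it
  carries each relation to a relation of the same kind.\<close>

lemma act_rel:
  assumes \<alpha>: "\<alpha> \<in> carrier (Gal D)" and "rel x y"
  shows "rel (cp.subst (act_gen \<alpha>) x) (cp.subst (act_gen \<alpha>) y)"
proof -
  have act: "act_CX D \<alpha> (f \<oplus>\<^bsub>CX D\<^esub> g) = act_CX D \<alpha> f \<oplus>\<^bsub>CX D\<^esub> act_CX D \<alpha> g"
    "act_CX D \<alpha> (f \<otimes>\<^bsub>CX D\<^esub> g) = act_CX D \<alpha> f \<otimes>\<^bsub>CX D\<^esub> act_CX D \<alpha> g"
    "act_CX D \<alpha> (c \<odot>\<^bsub>CX D\<^esub> f) = c \<odot>\<^bsub>CX D\<^esub> act_CX D \<alpha> f"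
    "act_CX D \<alpha> \<one>\<^bsub>CX D\<^esub> = \<one>\<^bsub>CX D\<^esub>" for f g c
    using act_X_closed[of "inv\<^bsub>Gal D\<^esub> \<alpha>"] \<alpha> by (auto simp: act_CX_def fun_eq_iff)
  note endo = act_CX_endo[OF \<alpha>] and closed = act_CX_closed[OF \<alpha>]
  show ?thesis
    using \<open>rel x y\<close>
    by cases (simp_all add: cp.sub_simps act endo cp_relation.intros closed del: CX_simps)
qed

lemma act_letter_map:
  assumes \<alpha>: "\<alpha> \<in> carrier (Gal D)"
  shows "cp.letter_map (act_gen \<alpha>)"
  unfolding cp.letter_map_def
proof (intro conjI ballI)
  show "act_gen \<alpha> ` gens \<subseteq> gens" using act_CX_closed[OF \<alpha>] by (auto simp: cp_gens_def)
  show "cp_adj (act_gen \<alpha> a) = act_gen \<alpha> (cp_adj a)" for a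
    by (cases a) (auto simp: act_CX_def)
  show "cp.subst (act_gen \<alpha>) r \<in> rels" if "r \<in> rels" for r
  proof -
    obtain x y where "r = x - y" "rel x y" using \<open>r \<in> rels\<close> by (auto simp: cp_relators_def)
    then show ?thesis using act_rel[OF \<alpha>, of x y] by (simp add: cp_relators_def cp.sub_simps) blast
  qed
qed

lemma act_gen_mult:
  assumes "\<alpha> \<in> carrier (Gal D)" "\<beta> \<in> carrier (Gal D)"
  shows "act_gen \<alpha> (act_gen \<beta> a) = act_gen (\<alpha> \<otimes>\<^bsub>Gal D\<^esub> \<beta>) a"
  using assms by (cases a) (simp_all add: act_CX_mult)

lemma act_gen_inverse:
  assumes "\<alpha> \<in> carrier (Gal D)" "a \<in> gens"
  shows "act_gen \<alpha> (act_gen (inv\<^bsub>Gal D\<^esub> \<alpha>) a) = a" "act_gen (inv\<^bsub>Gal D\<^esub> \<alpha>) (act_gen \<alpha> a) = a"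
  using assms by (cases a; simp add: act_CX_inverse)+

definition \<Theta> :: "(complex \<Rightarrow> complex) \<Rightarrow> (nat \<Rightarrow> 'a cp_free) set \<Rightarrow> (nat \<Rightarrow> 'a cp_free) set" where
  "\<Theta> \<alpha> = cp.induced (act_gen \<alpha>)"

lemma \<Theta>_class:
  assumes "\<alpha> \<in> carrier (Gal D)" "x \<in> free_carrier gens"
  shows "\<Theta> \<alpha> (cp_class D x) = cp_class D (cp.subst (act_gen \<alpha>) x)"
  unfolding \<Theta>_def cp_class_eq
  by (rule cp.induced_cls[OF act_letter_map[OF assms(1)] cp.C_const[OF assms(2)]])

lemma \<Theta>_aut: "\<alpha> \<in> carrier (Gal D) \<Longrightarrow> \<Theta> \<alpha> \<in> carrier (star_aut_group CP)"
  unfolding \<Theta>_def CP_eq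
  by (rule cp.induced_aut[where g' = "act_gen (inv\<^bsub>Gal D\<^esub> \<alpha>)"])
    (auto intro: act_letter_map simp: act_gen_inverse)

lemma \<Theta>_mult:
  assumes "\<alpha> \<in> carrier (Gal D)" "\<beta> \<in> carrier (Gal D)" "Y \<in> carrier CP"
  shows "\<Theta> (\<alpha> \<otimes>\<^bsub>Gal D\<^esub> \<beta>) Y = \<Theta> \<alpha> (\<Theta> \<beta> Y)"
  unfolding \<Theta>_def
  by (rule cp.induced_comp[symmetric])
    (use assms in \<open>auto intro: act_letter_map simp: act_gen_mult CP_eq\<close>)

lemma star_aut_mult:
  assumes "\<theta> \<in> carrier (star_aut_group B)" "\<theta>' \<in> carrier (star_aut_group B)"
  shows "\<theta> \<otimes>\<^bsub>star_aut_group B\<^esub> \<theta>' = compose (carrier B) \<theta> \<theta>'"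
  using assms by (simp add: star_aut_group_def BijGroup_def)

theorem canonical_action_\<Theta>: "canonical_action D \<Theta>"
  unfolding canonical_action_def
proof (intro conjI ballI)
  show "\<Theta> \<in> hom (Gal D) (star_aut_group CP)"
  proof (rule homI)
    fix \<alpha> \<beta> assume ab: "\<alpha> \<in> carrier (Gal D)" "\<beta> \<in> carrier (Gal D)"
    have ext: "\<Theta> \<gamma> \<in> extensional (carrier CP)" for \<gamma>
      by (simp add: \<Theta>_def cp.induced_def CP_eq)
    have "\<Theta> (\<alpha> \<otimes>\<^bsub>Gal D\<^esub> \<beta>) = compose (carrier CP) (\<Theta> \<alpha>) (\<Theta> \<beta>)"
      by (rule extensionalityI[OF ext compose_extensional]) (simp add: compose_eq \<Theta>_mult ab)
    then show "\<Theta> (\<alpha> \<otimes>\<^bsub>Gal D\<^esub> \<beta>) = \<Theta> \<alpha> \<otimes>\<^bsub>star_aut_group CP\<^esub> \<Theta> \<beta>"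
      using ab by (simp add: star_aut_mult \<Theta>_aut)
  qed (rule \<Theta>_aut)
next
  fix \<alpha> f assume "\<alpha> \<in> carrier (Gal D)" "f \<in> carrier (CX D)"
  then show "\<Theta> \<alpha> (\<iota> D f) = \<iota> D (act_CX D \<alpha> f)"
    by (simp add: \<iota>_def \<Theta>_class free_gen cp.sub_simps)
next
  fix \<alpha> \<rho> assume "\<alpha> \<in> carrier (Gal D)" "\<rho> \<in> S"
  then show "\<Theta> \<alpha> (isom D \<rho>) = isom D \<rho>"
    by (simp add: isom_def \<Theta>_class free_gen cp.sub_simps)
qed

lemma adj_isom: "\<rho> \<in> S \<Longrightarrow> adj CP (isom D \<rho>) = cp_class D (gen (Ustar \<rho>))"
  by (simp add: isom_def cp_class_eq CP_eq cp.B_adj cp.C_const free_gen star_gen)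

text \<open>A canonical action is prescribed on \<open>C(X)\<close> and the isometries, hence on their adjoints, and
  these generate a dense subalgebra.\<close>

theorem canonical_action_unique:
  assumes T: "canonical_action D T" and \<alpha>: "\<alpha> \<in> carrier (Gal D)"
  shows "T \<alpha> = \<Theta> \<alpha>"
proof -
  have aut: "T \<alpha> \<in> carrier (star_aut_group CP)"
    using T \<alpha> by (auto simp: canonical_action_def hom_def)
  have gens: "T \<alpha> (\<iota> D f) = \<Theta> \<alpha> (\<iota> D f)" "T \<alpha> (isom D \<rho>) = \<Theta> \<alpha> (isom D \<rho>)"
    if "f \<in> carrier (CX D)" "\<rho> \<in> S" for f \<rho>
    using T canonical_action_\<Theta> \<alpha> that by (auto simp: canonical_action_def)
  have isom: "isom D \<rho> \<in> carrier CP" if "\<rho> \<in> S" for \<rho>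
    using that by (simp add: isom_def cp_class_eq CP_eq cp.B_simps cp.C_const free_gen)
  have adj: "\<theta> (adj CP Y) = adj CP (\<theta> Y)" if "\<theta> \<in> carrier (star_aut_group CP)" "Y \<in> carrier CP" for \<theta> Y
    using that by (simp add: star_aut_group_def)
  show ?thesis
  proof (rule cp.aut_eq_on_dense[OF aut[unfolded CP_eq] \<Theta>_aut[OF \<alpha>, unfolded CP_eq]])
    fix a assume a: "a \<in> gens"
    have "T \<alpha> (cp_class D (gen a)) = \<Theta> \<alpha> (cp_class D (gen a))"
    proof (cases a)
      case (Coef f)
      then show ?thesis using gens(1)[of f id] a endo_id by (simp add: \<iota>_def)
    next
      case (U \<rho>)
      then show ?thesis using gens(2)[OF CX_zero, of \<rho>] a by (simp add: isom_def)
    next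
      case (Ustar \<rho>)
      then have \<rho>: "\<rho> \<in> S" using a by simp
      show ?thesis
        using adj[OF aut isom[OF \<rho>]] adj[OF \<Theta>_aut[OF \<alpha>] isom[OF \<rho>]] gens(2)[OF CX_zero \<rho>]
        by (simp add: Ustar adj_isom[OF \<rho>])
    qed
    then show "T \<alpha> (cp.cls (\<lambda>n. gen a)) = \<Theta> \<alpha> (cp.cls (\<lambda>n. gen a))" by (simp add: cp_class_eq)
  qed
qed

lemma \<Theta>_CX:
  assumes \<alpha>: "\<alpha> \<in> carrier (Gal D)"
  shows "\<Theta> \<alpha> ` (\<iota> D ` carrier (CX D)) = \<iota> D ` carrier (CX D)"
proof -
  have "act_CX D \<alpha> ` carrier (CX D) = carrier (CX D)"
  proof
    show "carrier (CX D) \<subseteq> act_CX D \<alpha> ` carrier (CX D)"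
    proof
      fix f assume "f \<in> carrier (CX D)"
      then show "f \<in> act_CX D \<alpha> ` carrier (CX D)"
        using \<alpha> by (intro image_eqI[of _ _ "act_CX D (inv\<^bsub>Gal D\<^esub> \<alpha>) f"]) (simp_all add: act_CX_inverse act_CX_closed)
    qed
  qed (use act_CX_closed[OF \<alpha>] in auto)
  moreover have "\<Theta> \<alpha> ` \<iota> D ` carrier (CX D) = \<iota> D ` act_CX D \<alpha> ` carrier (CX D)"
    unfolding image_image
    by (rule image_cong) (use canonical_action_\<Theta> \<alpha> in \<open>simp_all add: canonical_action_def\<close>)
  ultimately show ?thesis by simp
qed

end

section \<open>Pure states\<close>

context endomotive
begin

interpretation G: group "Gal D" by (rule group_Gal)

lemma CX_sum: "(\<And>i. i \<in> I \<Longrightarrow> f i \<in> carrier (CX D)) \<Longrightarrow> (\<lambda>\<xi>. \<Sum>i\<in>I. f i \<xi>) \<in> carrier (CX D)"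
  by (induction I rule: infinite_finite_induct) (auto intro: CX_zero CX_add)

lemma CX_minus: "f \<in> carrier (CX D) \<Longrightarrow> g \<in> carrier (CX D) \<Longrightarrow> (\<lambda>\<xi>. f \<xi> - g \<xi>) \<in> carrier (CX D)"
  using CX_add[of f "\<lambda>\<xi>. -1 * g \<xi>"] CX_smult[of g "-1"] by simp

lemma stateD:
  assumes "state (CX D) \<omega>" "f \<in> carrier (CX D)"
  shows "g \<in> carrier (CX D) \<Longrightarrow> \<omega> (\<lambda>\<xi>. f \<xi> + g \<xi>) = \<omega> f + \<omega> g"
    "\<omega> (\<lambda>\<xi>. c * f \<xi>) = c * \<omega> f" "\<omega> (\<lambda>\<xi>. cnj (f \<xi>) * f \<xi>) \<in> \<real>\<^sub>\<ge>\<^sub>0" "\<omega> (\<lambda>\<xi>. of_bool (\<xi> \<in> X D)) = 1"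
  using assms by (auto simp: state_def)

lemma state_sum:
  assumes "state (CX D) \<omega>" "\<And>i. i \<in> I \<Longrightarrow> f i \<in> carrier (CX D)"
  shows "\<omega> (\<lambda>\<xi>. \<Sum>i\<in>I. f i \<xi>) = (\<Sum>i\<in>I. \<omega> (f i))"
proof -
  have zero: "\<omega> (\<lambda>\<xi>. 0) = 0" using stateD(2)[OF assms(1) CX_zero, of 0] by simp
  show ?thesis using assms(2)
    by (induction I rule: infinite_finite_induct) (simp_all add: zero stateD(1)[OF assms(1) _ CX_sum])
qed

lemma state_projection_nonneg:
  assumes "state (CX D) \<omega>" "e \<in> carrier (CX D)" "\<And>\<xi>. e \<xi> = 0 \<or> e \<xi> = 1"
  shows "\<omega> e \<in> \<real>\<^sub>\<ge>\<^sub>0"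
proof -
  have "(\<lambda>\<xi>. cnj (e \<xi>) * e \<xi>) = e"
  proof
    fix \<xi> show "cnj (e \<xi>) * e \<xi> = e \<xi>" using assms(3)[of \<xi>] by auto
  qed
  then show ?thesis using stateD(3)[OF assms(1,2)] by simp
qed

text \<open>The cut down functional is positive because \<open>e x\<^sup>* x = (e x)\<^sup>* (e x)\<close> for a projection \<open>e\<close>.\<close>

lemma state_cut:
  assumes \<omega>: "state (CX D) \<omega>" and e: "e \<in> carrier (CX D)" "\<And>\<xi>. e \<xi> = 0 \<or> e \<xi> = 1" and t: "\<omega> e = of_real t" "t > 0"
  shows "state (CX D) (\<lambda>x. \<omega> (\<lambda>\<xi>. e \<xi> * x \<xi>) / of_real t)"
  unfolding state_def CX_simps
proof (intro conjI ballI allI)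
  fix x y c assume x: "x \<in> carrier (CX D)" and y: "y \<in> carrier (CX D)"
  show "\<omega> (\<lambda>\<xi>. e \<xi> * (x \<xi> + y \<xi>)) / of_real t = \<omega> (\<lambda>\<xi>. e \<xi> * x \<xi>) / of_real t + \<omega> (\<lambda>\<xi>. e \<xi> * y \<xi>) / of_real t"
    using stateD(1)[OF \<omega> CX_mult[OF e(1) x] CX_mult[OF e(1) y]] by (simp add: distrib_left add_divide_distrib)
next
  fix x c assume x: "x \<in> carrier (CX D)"
  show "\<omega> (\<lambda>\<xi>. e \<xi> * (c * x \<xi>)) / of_real t = c * (\<omega> (\<lambda>\<xi>. e \<xi> * x \<xi>) / of_real t)"
    using stateD(2)[OF \<omega> CX_mult[OF e(1) x], of c] by (simp add: mult.left_commute)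
next
  fix x assume x: "x \<in> carrier (CX D)"
  have "(\<lambda>\<xi>. cnj (e \<xi> * x \<xi>) * (e \<xi> * x \<xi>)) = (\<lambda>\<xi>. e \<xi> * (cnj (x \<xi>) * x \<xi>))"
  proof
    fix \<xi> show "cnj (e \<xi> * x \<xi>) * (e \<xi> * x \<xi>) = e \<xi> * (cnj (x \<xi>) * x \<xi>)" using e(2)[of \<xi>] by auto
  qed
  then have "\<omega> (\<lambda>\<xi>. e \<xi> * (cnj (x \<xi>) * x \<xi>)) \<in> \<real>\<^sub>\<ge>\<^sub>0"
    using stateD(3)[OF \<omega> CX_mult[OF e(1) x]] by simp
  then show "\<omega> (\<lambda>\<xi>. e \<xi> * (cnj (x \<xi>) * x \<xi>)) / of_real t \<in> \<real>\<^sub>\<ge>\<^sub>0"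
    using t(2) by (intro nonneg_Reals_divide_I) auto
next
  have "(\<lambda>\<xi>. e \<xi> * of_bool (\<xi> \<in> X D)) = e" using CX_outside[OF e(1)] by (intro ext) auto
  then show "\<omega> (\<lambda>\<xi>. e \<xi> * of_bool (\<xi> \<in> X D)) / of_real t = 1" using t by simp
qed

text \<open>A projection \<open>e\<close> with \<open>0 < \<omega>(e) < 1\<close> would split \<open>\<omega>\<close> into the two states obtained by cutting
  down with \<open>e\<close> and \<open>1 - e\<close>.\<close>

lemma pure_state_projection:
  assumes pure: "pure_state (CX D) \<omega>" and e: "e \<in> carrier (CX D)" "\<And>\<xi>. e \<xi> = 0 \<or> e \<xi> = 1"
  shows "\<omega> e = 0 \<or> \<omega> e = 1"
proof (rule ccontr)
  assume not: "\<not> (\<omega> e = 0 \<or> \<omega> e = 1)"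
  have \<omega>: "state (CX D) \<omega>" using pure by (simp add: pure_state_def)
  define f where "f = (\<lambda>\<xi>. of_bool (\<xi> \<in> X D) - e \<xi>)"
  have f: "f \<in> carrier (CX D)" unfolding f_def by (rule CX_minus[OF CX_one e(1)])
  have f01: "f \<xi> = 0 \<or> f \<xi> = 1" for \<xi>
    using e(2)[of \<xi>] CX_outside[OF e(1), of \<xi>] by (cases "\<xi> \<in> X D") (auto simp: f_def)
  define t where "t = Re (\<omega> e)"
  have sum: "\<omega> e + \<omega> f = 1"
    using stateD(1)[OF \<omega> e(1) f] stateD(4)[OF \<omega> f] by (simp add: f_def)
  have te: "\<omega> e = of_real t" "t \<ge> 0" and tf: "Im (\<omega> f) = 0" "Re (\<omega> f) \<ge> 0"
    using state_projection_nonneg[OF \<omega> e] state_projection_nonneg[OF \<omega> f f01]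
    by (auto simp: t_def complex_nonneg_Reals_iff complex_eq_iff)
  have tf': "\<omega> f = of_real (1 - t)" using sum te(1) by (simp add: algebra_simps eq_diff_eq)
  then have "t \<le> 1" using tf(2) by simp
  then have t: "0 < t" "t < 1" using te not by auto
  let ?\<phi> = "\<lambda>x. \<omega> (\<lambda>\<xi>. e \<xi> * x \<xi>) / of_real t" and ?\<psi> = "\<lambda>x. \<omega> (\<lambda>\<xi>. f \<xi> * x \<xi>) / of_real (1 - t)"
  have states: "state (CX D) ?\<phi>" "state (CX D) ?\<psi>"
    using state_cut[of \<omega> e t, OF \<omega> e te(1) t(1)] state_cut[of \<omega> f "1 - t", OF \<omega> f f01 tf'] t by simp_all
  have split: "\<omega> x = of_real t * ?\<phi> x + of_real (1 - t) * ?\<psi> x" if x: "x \<in> carrier (CX D)" for x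
  proof -
    have "x = (\<lambda>\<xi>. e \<xi> * x \<xi> + f \<xi> * x \<xi>)" using CX_outside[OF x] by (intro ext) (auto simp: f_def algebra_simps)
    then have "\<omega> x = \<omega> (\<lambda>\<xi>. e \<xi> * x \<xi>) + \<omega> (\<lambda>\<xi>. f \<xi> * x \<xi>)"
      using stateD(1)[OF \<omega> CX_mult[OF e(1) x] CX_mult[OF f x]] by simp
    moreover have "(of_real (1 - t) :: complex) \<noteq> 0" "(of_real t :: complex) \<noteq> 0" using t by auto
    ultimately show ?thesis by (simp del: of_real_diff)
  qed
  have "?\<phi> e = \<omega> e"
  proof -
    have "\<forall>\<phi>\<^sub>1 \<phi>\<^sub>2. \<forall>t::real. state (CX D) \<phi>\<^sub>1 \<and> state (CX D) \<phi>\<^sub>2 \<and> 0 < t \<and> t < 1 \<and>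
        (\<forall>x\<in>carrier (CX D). \<omega> x = of_real t * \<phi>\<^sub>1 x + of_real (1 - t) * \<phi>\<^sub>2 x) \<longrightarrow>
        (\<forall>x\<in>carrier (CX D). \<phi>\<^sub>1 x = \<omega> x \<and> \<phi>\<^sub>2 x = \<omega> x)"
      using pure unfolding pure_state_def by (rule conjunct2)
    from this[THEN spec, THEN spec, THEN spec, of ?\<phi> ?\<psi> t]
    have "\<forall>x\<in>carrier (CX D). ?\<phi> x = \<omega> x \<and> ?\<psi> x = \<omega> x"
      by (rule mp) (intro conjI ballI states t split)
    then show ?thesis using e(1) by blast
  qed
  moreover have "(\<lambda>\<xi>. e \<xi> * e \<xi>) = e"
  proof
    fix \<xi> show "e \<xi> * e \<xi> = e \<xi>" using e(2)[of \<xi>] by auto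
  qed
  ultimately show False using te(1) t not by simp
qed

text \<open>The projections onto the sets \<open>\<xi>(a) = z\<close> are finitely many and sum to \<open>1\<close>, so a pure state is
  concentrated on one of them; on functions of \<open>hat a\<close> it is evaluation at that value.\<close>

lemma pure_state_value:
  assumes pure: "pure_state (CX D) \<omega>"
  shows "\<exists>z\<in>Kbar D. \<forall>h. \<omega> (\<lambda>\<xi>. if \<xi> \<in> X D then h (\<xi> a) else 0) = h z"
proof -
  have \<omega>: "state (CX D) \<omega>" using pure by (simp add: pure_state_def)
  define e :: "complex \<Rightarrow> ('a \<Rightarrow> complex) \<Rightarrow> complex" where "e = (\<lambda>z \<xi>. of_bool (\<xi> \<in> X D \<and> \<xi> a = z))"
  have e: "e z \<in> carrier (CX D)" for z
    by (rule CX_locally_constant) (auto simp: e_def intro!: exI[of _ "{a}"])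
  have eval: "\<omega> (\<lambda>\<xi>. if \<xi> \<in> X D then h (\<xi> a) else 0) = (\<Sum>z\<in>vals a. h z * \<omega> (e z))" for h
  proof -
    have "(if \<xi> \<in> X D then h (\<xi> a) else 0) = (\<Sum>z\<in>vals a. h z * e z \<xi>)" for \<xi>
    proof (cases "\<xi> \<in> X D")
      case True
      then have "\<xi> a \<in> vals a" using vals(3) X_iff by blast
      have "(\<Sum>z\<in>vals a. h z * e z \<xi>) = (\<Sum>z\<in>vals a. if z = \<xi> a then h z else 0)"
        using True by (intro sum.cong) (auto simp: e_def)
      then show ?thesis using True \<open>\<xi> a \<in> vals a\<close> vals(1) by simp
    qed (simp add: e_def)
    then have "\<omega> (\<lambda>\<xi>. if \<xi> \<in> X D then h (\<xi> a) else 0) = (\<Sum>z\<in>vals a. \<omega> (\<lambda>\<xi>. h z * e z \<xi>))"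
      using state_sum[OF \<omega>, of "vals a" "\<lambda>z \<xi>. h z * e z \<xi>"] CX_smult[OF e] by simp
    then show ?thesis by (simp add: stateD(2)[OF \<omega> e])
  qed
  have e01: "\<omega> (e z) = 0 \<or> \<omega> (e z) = 1" for z
    by (rule pure_state_projection[OF pure e]) (auto simp: e_def)
  have one: "(\<Sum>z\<in>vals a. \<omega> (e z)) = 1"
    using eval[of "\<lambda>_. 1"] stateD(4)[OF \<omega> CX_zero] by (simp add: of_bool_def)
  then obtain z where z: "z \<in> vals a" "\<omega> (e z) = 1"
    using e01 by (metis (mono_tags, lifting) sum.neutral zero_neq_one)
  have "\<omega> (e w) = 0" if w: "w \<in> vals a - {z}" for w
  proof -
    have "(\<Sum>z\<in>vals a. Re (\<omega> (e z))) = 1" using one by (metis Re_sum one_complex.sel(1))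
    then have "(\<Sum>w\<in>vals a - {z}. Re (\<omega> (e w))) = 0"
      using sum.remove[OF vals(1) z(1), of "\<lambda>z. Re (\<omega> (e z))"] z(2) by simp
    moreover have "Re (\<omega> (e w)) \<ge> 0" for w using e01[of w] by auto
    ultimately have "Re (\<omega> (e w)) = 0" using w vals(1) by (subst (asm) sum_nonneg_eq_0_iff) auto
    then show ?thesis using e01[of w] by auto
  qed
  then have "(\<Sum>w\<in>vals a. h w * \<omega> (e w)) = h z" for h
    using sum.remove[OF vals(1) z(1), of "\<lambda>w. h w * \<omega> (e w)"] z(2) by simp
  then show ?thesis using z(1) vals(2) eval by (intro bexI[of _ z]) auto
qed

lemma act_hat_apply:
  "\<alpha> \<in> carrier (Gal D) \<Longrightarrow> act_CX D (inv\<^bsub>Gal D\<^esub> \<alpha>) (hat D a) = (\<lambda>\<xi>. if \<xi> \<in> X D then \<alpha> (\<xi> a) else 0)"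
  using act_X_closed[of \<alpha>] by (auto simp: act_CX_def hat_def act_X_def)

text \<open>With the value \<open>z\<close> of the preceding lemma, \<open>\<omega>\<close> maps \<open>hat a\<close> to \<open>z\<close> and \<open>\<xi> \<mapsto> \<alpha>(\<xi>(a))\<close> to \<open>\<alpha>(z)\<close>.\<close>

theorem pure_state_galois:
  assumes "pure_state (CX D) \<omega>" "\<alpha> \<in> carrier (Gal D)"
  shows "\<omega> (hat D a) \<in> Kbar D" "\<alpha> (\<omega> (hat D a)) = \<omega> (act_CX D (inv\<^bsub>Gal D\<^esub> \<alpha>) (hat D a))"
proof -
  obtain z where z: "z \<in> Kbar D" "\<And>h. \<omega> (\<lambda>\<xi>. if \<xi> \<in> X D then h (\<xi> a) else 0) = h z"
    using pure_state_value[OF assms(1), of a] by blast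
  have "\<omega> (hat D a) = z" using z(2)[of "\<lambda>w. w"] by (simp add: hat_def)
  then show "\<omega> (hat D a) \<in> Kbar D" "\<alpha> (\<omega> (hat D a)) = \<omega> (act_CX D (inv\<^bsub>Gal D\<^esub> \<alpha>) (hat D a))"
    using z by (simp_all add: act_hat_apply[OF assms(2)])
qed

end

section \<open>Abelian extensions\<close>

context endomotive
begin

interpretation G: group "Gal D" by (rule group_Gal)

text \<open>A character of a product of fields factors through one of the factors: the units of the
  factors are idempotents with sum \<open>1\<close>, so one of them has value \<open>1\<close>.\<close>

lemma character_factors:
  fixes n :: nat
  assumes \<beta>: "\<beta> \<in> indices D" and \<xi>: "\<xi> \<in> X D"
    and L: "\<forall>j<n. abelian_extension \<sigma> (L j)"
    and bij: "bij_betw \<Phi> (level D \<beta>) (PiE {..<n} L)"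
    and hom: "\<forall>j<n. \<Phi> 1 j = 1 \<and>
           (\<forall>x\<in>level D \<beta>. \<forall>y\<in>level D \<beta>. \<Phi> (x + y) j = \<Phi> x j + \<Phi> y j \<and> \<Phi> (x * y) j = \<Phi> x j * \<Phi> y j) \<and>
           (\<forall>c. \<forall>x\<in>level D \<beta>. \<Phi> (scaleA D c x) j = \<sigma> c * \<Phi> x j)"
  shows "\<exists>j<n. \<exists>\<tau>. field_hom_on \<sigma> (L j) \<tau> \<and> (\<forall>b\<in>level D \<beta>. \<Phi> b j \<in> L j \<and> \<xi> b = \<tau> (\<Phi> b j))"
proof -
  define B where "B = level D \<beta>"
  note khom = \<xi>[unfolded X_iff]
  have B: "1 \<in> B" "0 \<in> B" "x \<in> B \<Longrightarrow> y \<in> B \<Longrightarrow> x + y \<in> B" "x \<in> B \<Longrightarrow> y \<in> B \<Longrightarrow> x * y \<in> B"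
    "x \<in> B \<Longrightarrow> scaleA D c x \<in> B" for x y c
    using \<beta> by (auto simp: B_def level_0 level_1 level_add level_mult level_scale)
  have mem: "\<Phi> x \<in> PiE {..<n} L" if "x \<in> B" for x
    using bij that by (auto simp: bij_betw_def B_def)
  have eqI: "x = y" if "x \<in> B" "y \<in> B" "\<And>j. j < n \<Longrightarrow> \<Phi> x j = \<Phi> y j" for x y
  proof -
    have "\<Phi> x = \<Phi> y" by (rule PiE_ext[OF mem mem]) (use that in auto)
    then show ?thesis using bij that by (auto simp: bij_betw_def B_def inj_on_def)
  qed
  have h: "\<Phi> 1 j = 1" "x \<in> B \<Longrightarrow> y \<in> B \<Longrightarrow> \<Phi> (x + y) j = \<Phi> x j + \<Phi> y j"
    "x \<in> B \<Longrightarrow> y \<in> B \<Longrightarrow> \<Phi> (x * y) j = \<Phi> x j * \<Phi> y j"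
    "x \<in> B \<Longrightarrow> \<Phi> (scaleA D c x) j = \<sigma> c * \<Phi> x j" if "j < n" for j x y c
    using hom that by (auto simp: B_def)
  have h0: "\<Phi> 0 j = 0" if "j < n" for j using h(2)[OF that B(2,2)] by simp
  define \<epsilon> where "\<epsilon> = (\<lambda>j z. inv_into B \<Phi> (\<lambda>k\<in>{..<n}. if k = j then z else 0))"
  have \<epsilon>: "\<epsilon> j z \<in> B" "k < n \<Longrightarrow> \<Phi> (\<epsilon> j z) k = (if k = j then z else 0)" if "j < n" "z \<in> L j" for j z k
  proof -
    have "(\<lambda>k\<in>{..<n}. if k = j then z else 0) \<in> PiE {..<n} L"
      using that L ext_0[OF embedding] by auto
    then have "(\<lambda>k\<in>{..<n}. if k = j then z else 0) \<in> \<Phi> ` B"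
      using bij by (simp add: bij_betw_def B_def)
    from inv_into_into[OF this] f_inv_into_f[OF this]
    show "\<epsilon> j z \<in> B" "k < n \<Longrightarrow> \<Phi> (\<epsilon> j z) k = (if k = j then z else 0)"
      by (simp_all add: \<epsilon>_def)
  qed
  have L1: "1 \<in> L j" if "j < n" for j using L that ext_1[OF embedding] by blast
  have sum: "(\<Sum>j\<in>J. \<epsilon> j 1) \<in> B \<and> (\<forall>k<n. \<Phi> (\<Sum>j\<in>J. \<epsilon> j 1) k = of_bool (k \<in> J))" if "J \<subseteq> {..<n}" for J
    using finite_subset[OF that finite_lessThan] that
  proof (induction J rule: finite_induct)
    case empty
    then show ?case by (simp add: B h0)
  next
    case (insert j J)
    then show ?case using \<epsilon>[of j 1] L1 by (auto simp: B h)
  qed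
  have "(\<Sum>j<n. \<epsilon> j 1) = 1"
    by (rule eqI) (use sum[of "{..<n}"] B h in auto)
  then have "(\<Sum>j<n. \<xi> (\<epsilon> j 1)) = 1"
    using khom_sum[OF khom, of "\<lambda>j. \<epsilon> j 1" "{..<n}"] khomD(1)[OF khom] by simp
  moreover have "(\<Sum>j<n. \<xi> (\<epsilon> j 1)) = 0" if "\<forall>j<n. \<xi> (\<epsilon> j 1) = 0"
    using that by (intro sum.neutral) simp
  ultimately obtain j where j: "j < n" "\<xi> (\<epsilon> j 1) \<noteq> 0" by fastforce
  have "\<epsilon> j 1 * \<epsilon> j 1 = \<epsilon> j 1"
    by (rule eqI) (use \<epsilon>[OF j(1) L1[OF j(1)]] h in \<open>auto simp: B\<close>)
  then have one: "\<xi> (\<epsilon> j 1) = 1" using khomD(3)[OF khom, of "\<epsilon> j 1" "\<epsilon> j 1"] j(2) by simp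
  define \<tau> where "\<tau> = (\<lambda>z. \<xi> (\<epsilon> j z))"
  have Lj: "abelian_extension \<sigma> (L j)" using L j(1) by blast
  note \<epsilon>j = \<epsilon>[OF j(1)]
  have "field_hom_on \<sigma> (L j) \<tau>"
    unfolding field_hom_on_def
  proof (intro conjI ballI allI)
    fix x y assume xy: "x \<in> L j" "y \<in> L j"
    have sum: "x + y \<in> L j" "x * y \<in> L j"
      using ext_add[OF embedding Lj xy] ext_mult[OF embedding Lj xy] by auto
    have "\<epsilon> j (x + y) = \<epsilon> j x + \<epsilon> j y"
      by (rule eqI) (use \<epsilon>j(1,2)[OF xy(1)] \<epsilon>j(1,2)[OF xy(2)] \<epsilon>j(1,2)[OF sum(1)] h in \<open>auto simp: B\<close>)
    then show "\<tau> (x + y) = \<tau> x + \<tau> y" by (simp add: \<tau>_def khomD(2)[OF khom])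
    have "\<epsilon> j (x * y) = \<epsilon> j x * \<epsilon> j y"
      by (rule eqI) (use \<epsilon>j(1,2)[OF xy(1)] \<epsilon>j(1,2)[OF xy(2)] \<epsilon>j(1,2)[OF sum(2)] h in \<open>auto simp: B\<close>)
    then show "\<tau> (x * y) = \<tau> x * \<tau> y" by (simp add: \<tau>_def khomD(3)[OF khom])
  next
    fix c
    note c = ext_base[OF embedding Lj, of c]
    have "\<epsilon> j (\<sigma> c) = scaleA D c (\<epsilon> j 1)"
      by (rule eqI) (use \<epsilon>j(1,2)[OF c] \<epsilon>j(1,2)[OF L1[OF j(1)]] h in \<open>auto simp: B\<close>)
    then show "\<tau> (\<sigma> c) = \<sigma> c" by (simp add: \<tau>_def khomD(4)[OF khom] one)
  qed
  moreover have "\<Phi> b j \<in> L j \<and> \<xi> b = \<tau> (\<Phi> b j)" if b: "b \<in> B" for b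
  proof
    show bj: "\<Phi> b j \<in> L j" using mem[OF b] j(1) by auto
    have "b * \<epsilon> j 1 = \<epsilon> j (\<Phi> b j)"
      by (rule eqI) (use \<epsilon>j(1,2)[OF bj] \<epsilon>j(1,2)[OF L1[OF j(1)]] h b in \<open>auto simp: B\<close>)
    then show "\<xi> b = \<tau> (\<Phi> b j)"
      using khomD(3)[OF khom, of b "\<epsilon> j 1"] one by (simp add: \<tau>_def)
  qed
  ultimately show ?thesis using j(1) by (auto simp: B_def)
qed

lemma Gal_hom_on:
  assumes "\<alpha> \<in> carrier (Gal D)" "abelian_extension \<sigma> L"
  shows "field_hom_on \<sigma> L \<alpha>"
proof -
  have "L \<subseteq> Kbar D" unfolding Kbar_def by (rule ext_algebraic[OF embedding assms(2)])
  then show ?thesis using GalD[OF assms(1)] unfolding field_hom_on_def by (meson subsetD)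
qed

context
  assumes abelian: "\<forall>\<beta>\<in>indices D. product_of_abelian_extensions D (level D \<beta>)"
begin

text \<open>On the factor \<open>L\<close> through which a character passes, the character and the elements of the
  Galois group act as elements of the abelian group of automorphisms of \<open>L\<close>. Therefore the action
  of \<open>\<alpha>\<close> on the values of the characters is that of an automorphism of the algebra.\<close>

lemma galois_descends:
  assumes \<alpha>: "\<alpha> \<in> carrier (Gal D)"
  shows "\<exists>b. \<forall>\<xi>\<in>X D. \<xi> b = \<alpha> (\<xi> a)"
    and "\<lbrakk>\<beta> \<in> carrier (Gal D); \<xi> \<in> X D\<rbrakk> \<Longrightarrow> \<alpha> (\<beta> (\<xi> a)) = \<beta> (\<alpha> (\<xi> a))"
proof -
  obtain i where i: "i \<in> indices D" "a \<in> level D i" by (rule in_level)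
  obtain n L \<Phi> where L: "\<forall>j<(n::nat). abelian_extension \<sigma> (L j)"
    and bij: "bij_betw \<Phi> (level D i) (PiE {..<n} L)"
    and hom: "\<forall>j<n. \<Phi> 1 j = 1 \<and>
           (\<forall>x\<in>level D i. \<forall>y\<in>level D i. \<Phi> (x + y) j = \<Phi> x j + \<Phi> y j \<and> \<Phi> (x * y) j = \<Phi> x j * \<Phi> y j) \<and>
           (\<forall>c. \<forall>x\<in>level D i. \<Phi> (scaleA D c x) j = \<sigma> c * \<Phi> x j)"
    using abelian i(1) unfolding product_of_abelian_extensions_def by blast
  note factors = character_factors[OF i(1) _ L bij hom]
  have mem: "\<Phi> a j \<in> L j" if "j < n" for j
    using bij i(2) that by (auto simp: bij_betw_def)
  have \<alpha>L: "field_hom_on \<sigma> (L j) \<alpha>" "abelian_extension \<sigma> (L j)" if "j < n" for j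
    using Gal_hom_on[OF \<alpha>] L that by auto
  define v where "v = (\<lambda>j\<in>{..<n}. \<alpha> (\<Phi> a j))"
  have "v \<in> PiE {..<n} L"
    using hom_closed[OF embedding \<alpha>L(2) \<alpha>L(1) mem] by (auto simp: v_def)
  then have "v \<in> \<Phi> ` level D i" using bij by (simp add: bij_betw_def)
  then obtain b where b: "b \<in> level D i" "\<Phi> b = v" by auto
  have "\<xi> b = \<alpha> (\<xi> a)" if \<xi>: "\<xi> \<in> X D" for \<xi>
  proof -
    obtain j \<tau> where j: "j < n" "field_hom_on \<sigma> (L j) \<tau>" "\<forall>b\<in>level D i. \<Phi> b j \<in> L j \<and> \<xi> b = \<tau> (\<Phi> b j)"
      using factors[OF \<xi>] by blast
    then have "\<xi> b = \<tau> (\<alpha> (\<Phi> a j))" using b by (simp add: v_def)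
    also have "\<dots> = \<alpha> (\<tau> (\<Phi> a j))"
      by (rule hom_commute[OF embedding \<alpha>L(2)[OF j(1)] j(2) \<alpha>L(1)[OF j(1)] mem[OF j(1)]])
    finally show ?thesis using j(3) i(2) by simp
  qed
  then show "\<exists>b. \<forall>\<xi>\<in>X D. \<xi> b = \<alpha> (\<xi> a)" by blast
  assume \<beta>: "\<beta> \<in> carrier (Gal D)" and \<xi>: "\<xi> \<in> X D"
  obtain j \<tau> where j: "j < n" "field_hom_on \<sigma> (L j) \<tau>" "\<forall>b\<in>level D i. \<Phi> b j \<in> L j \<and> \<xi> b = \<tau> (\<Phi> b j)"
    using factors[OF \<xi>] by blast
  note Lj = \<alpha>L(2)[OF j(1)]
  have "\<xi> a \<in> L j" using hom_closed[OF embedding Lj j(2) mem[OF j(1)]] j(3) i(2) by simp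
  then show "\<alpha> (\<beta> (\<xi> a)) = \<beta> (\<alpha> (\<xi> a))"
    by (rule hom_commute[OF embedding Lj \<alpha>L(1)[OF j(1)] Gal_hom_on[OF \<beta> Lj]])
qed

lemma act_hat:
  assumes "\<alpha> \<in> carrier (Gal D)"
  shows "\<exists>b. act_CX D \<alpha> (hat D a) = hat D b"
proof -
  obtain b where "\<forall>\<xi>\<in>X D. \<xi> b = (inv\<^bsub>Gal D\<^esub> \<alpha>) (\<xi> a)"
    using galois_descends(1)[of "inv\<^bsub>Gal D\<^esub> \<alpha>" a] assms by auto
  then have "act_CX D \<alpha> (hat D a) = hat D b"
    using act_hat_apply[of "inv\<^bsub>Gal D\<^esub> \<alpha>" a] assms by (auto simp: hat_def)
  then show ?thesis ..
qed

lemma act_hat_range: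
  assumes "\<alpha> \<in> carrier (Gal D)"
  shows "act_CX D \<alpha> ` range (hat D) = range (hat D)"
proof
  show "act_CX D \<alpha> ` range (hat D) \<subseteq> range (hat D)" using act_hat[OF assms] by fastforce
  show "range (hat D) \<subseteq> act_CX D \<alpha> ` range (hat D)"
  proof
    fix f assume "f \<in> range (hat D)"
    then obtain a where a: "f = hat D a" by blast
    obtain b where b: "act_CX D (inv\<^bsub>Gal D\<^esub> \<alpha>) (hat D a) = hat D b"
      using act_hat[of "inv\<^bsub>Gal D\<^esub> \<alpha>"] assms by auto
    then have "f = act_CX D \<alpha> (hat D b)"
      using act_CX_inverse(1)[OF assms hat_CX, of a] a by simp
    then show "f \<in> act_CX D \<alpha> ` range (hat D)" by blast
  qed
qed

lemma act_hat_commute: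
  assumes \<alpha>: "\<alpha> \<in> carrier (Gal D)" and \<beta>: "\<beta> \<in> carrier (Gal D)"
  shows "act_CX D (\<alpha> \<otimes>\<^bsub>Gal D\<^esub> \<beta>) (hat D a) = act_CX D (\<beta> \<otimes>\<^bsub>Gal D\<^esub> \<alpha>) (hat D a)"
proof -
  have "act_CX D (\<alpha> \<otimes>\<^bsub>Gal D\<^esub> \<beta>) (hat D a)
      = (\<lambda>\<xi>. if \<xi> \<in> X D then (inv\<^bsub>Gal D\<^esub> \<beta>) ((inv\<^bsub>Gal D\<^esub> \<alpha>) (\<xi> a)) else 0)"
    if "\<alpha> \<in> carrier (Gal D)" "\<beta> \<in> carrier (Gal D)" for \<alpha> \<beta>
    using act_hat_apply[of "inv\<^bsub>Gal D\<^esub> (\<alpha> \<otimes>\<^bsub>Gal D\<^esub> \<beta>)" a] that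
    by (auto simp: G.inv_mult_group Gal_mult X_Kbar)
  then show ?thesis
    using galois_descends(2)[of "inv\<^bsub>Gal D\<^esub> \<alpha>" "inv\<^bsub>Gal D\<^esub> \<beta>" _ a] \<alpha> \<beta> by (auto simp: fun_eq_iff)
qed

end

section \<open>The algebraic crossed product\<close>

abbreviation "alg_gens \<equiv> cp_gens (A_alg D) S"
abbreviation "alg_rel \<equiv> cp_relation (A_alg D) S (\<lambda>\<rho>. \<rho>)"
abbreviation "F \<equiv> free_algebra alg_gens"
abbreviation "I \<equiv> Idl\<^bsub>F\<^esub> (cp_relators (A_alg D) S (\<lambda>\<rho>. \<rho>))"

text \<open>The lift of \<open>alg_to_cstar\<close> to free algebras.\<close>

definition emb :: "(('a, 'a \<Rightarrow> 'a) cp_gen fword \<Rightarrow>\<^sub>0 'k) \<Rightarrow> 'a cp_free" where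
  "emb = subst_letters (map_cp_gen (hat D) id) \<sigma>"

lemma emb_simps:
  "emb (x + y) = emb x + emb y" "emb 0 = 0" "emb (gen g) = gen (map_cp_gen (hat D) id g)" "emb (scal c) = scal (\<sigma> c)"
  "emb 1 = 1" "emb (x * y) = emb x * emb y" "emb (- x) = - emb x" "emb (x - y) = emb x - emb y"
  by (simp_all add: emb_def subst_simps[OF \<sigma>_ring])

lemma alg_gens_iff [simp]: "Coef a \<in> alg_gens" "U \<rho> \<in> alg_gens \<longleftrightarrow> \<rho> \<in> S" "Ustar \<rho> \<in> alg_gens \<longleftrightarrow> \<rho> \<in> S"
  by (auto simp: cp_gens_def A_alg_def)

lemma emb_closed: "x \<in> free_carrier alg_gens \<Longrightarrow> emb x \<in> free_carrier gens"
  unfolding emb_def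
  by (rule subst_closed[OF \<sigma>_ring]) (auto simp: cp_gens_def hat_CX)

lemma hat_simps:
  "hat D (a + b) = (\<lambda>\<xi>. hat D a \<xi> + hat D b \<xi>)" "hat D (a * b) = (\<lambda>\<xi>. hat D a \<xi> * hat D b \<xi>)"
  "hat D (scaleA D c a) = (\<lambda>\<xi>. \<sigma> c * hat D a \<xi>)" "hat D 1 = (\<lambda>\<xi>. of_bool (\<xi> \<in> X D))"
  by (auto simp: hat_def X_iff khomD)

lemma alg_rel_closed:
  assumes "alg_rel x y"
  shows "x \<in> free_carrier alg_gens" "y \<in> free_carrier alg_gens"
  using assms by (cases; auto intro!: free_gen free_add free_mult endo_comp)+

lemma emb_rel:
  assumes "alg_rel x y"
  shows "rel (emb x) (emb y)"
proof -
  have A: "a \<oplus>\<^bsub>A_alg D\<^esub> b = a + b" "a \<otimes>\<^bsub>A_alg D\<^esub> b = a * b" "c \<odot>\<^bsub>A_alg D\<^esub> a = scaleA D c a" "\<one>\<^bsub>A_alg D\<^esub> = 1" for a b c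
    by (simp_all add: A_alg_def)
  have hats: "hat D (a + b) = hat D a \<oplus>\<^bsub>CX D\<^esub> hat D b" "hat D (a * b) = hat D a \<otimes>\<^bsub>CX D\<^esub> hat D b"
    "hat D (scaleA D c a) = \<sigma> c \<odot>\<^bsub>CX D\<^esub> hat D a" "hat D 1 = \<one>\<^bsub>CX D\<^esub>" for a b c
    by (simp_all add: hat_simps)
  from assms show ?thesis
    by cases (simp_all add: emb_simps A hats endo_CX_hat[symmetric] hat_CX cp_relation.intros del: CX_simps)
qed

lemma rel_P: "rel x y \<Longrightarrow> cp.P (x - y) = 0"
  by (rule cp.P_rel) (auto simp: cp_relators_def)

interpretation F: ring F by (rule ring_free_algebra)

lemma relators_subset: "cp_relators (A_alg D) S (\<lambda>\<rho>. \<rho>) \<subseteq> carrier F"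
  using alg_rel_closed by (auto simp: cp_relators_def intro!: free_diff)

interpretation I: ideal I F by (rule F.genideal_ideal[OF relators_subset])

lemma free_a_inv: "x \<in> carrier F \<Longrightarrow> \<ominus>\<^bsub>F\<^esub> x = - x"
  by (rule F.minus_equality) (auto simp: free_algebra_def[of alg_gens, THEN arg_cong[of _ _ add]] free_uminus,
    simp_all add: free_algebra_def)

text \<open>The elements whose image has seminorm \<open>0\<close> form an ideal containing the relators.\<close>

lemma ideal_vanishes:
  assumes "x \<in> I"
  shows "x \<in> carrier F" "cp.P (emb x) = 0"
proof -
  define J where "J = {x \<in> carrier F. cp.P (emb x) = 0}"
  have Jadd: "x + y \<in> J" if "x \<in> J" "y \<in> J" for x y
    using that cp.P_add[of "emb x" "emb y"] cp.P_nonneg[of "emb x + emb y"]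
    by (auto simp: J_def emb_simps emb_closed free_add)
  have Jmult: "x * y \<in> J" "y * x \<in> J" if "x \<in> J" "y \<in> carrier F" for x y
    using that cp.P_mult[of "emb x" "emb y"] cp.P_mult[of "emb y" "emb x"]
      cp.P_nonneg[of "emb x * emb y"] cp.P_nonneg[of "emb y * emb x"]
    by (auto simp: J_def emb_simps emb_closed free_mult)
  have Juminus: "- x \<in> J" if "x \<in> J" for x
    using Jmult(2)[OF that, of "- 1"] by (simp add: free_uminus)
  have "ideal J F"
  proof (rule idealI[OF F.ring_axioms])
    show "subgroup J (add_monoid F)"
    proof (rule F.add.subgroupI)
      show "J \<subseteq> carrier F" by (auto simp: J_def)
      show "J \<noteq> {}" by (auto simp: J_def emb_simps intro!: exI[of _ 0])
      show "\<ominus>\<^bsub>F\<^esub> x \<in> J" if "x \<in> J" for x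
        using Juminus[OF that] free_a_inv[of x] that by (auto simp: J_def)
      show "x \<oplus>\<^bsub>F\<^esub> y \<in> J" if "x \<in> J" "y \<in> J" for x y
        using Jadd[OF that] by (simp add: free_algebra_def)
    qed
  qed (use Jmult in \<open>simp_all add: free_algebra_def\<close>)
  moreover have "cp_relators (A_alg D) S (\<lambda>\<rho>. \<rho>) \<subseteq> J"
  proof
    fix r assume r: "r \<in> cp_relators (A_alg D) S (\<lambda>\<rho>. \<rho>)"
    then obtain x y where "r = x - y" "alg_rel x y" by (auto simp: cp_relators_def)
    then show "r \<in> J"
      using rel_P[OF emb_rel] subsetD[OF relators_subset r] by (simp add: J_def emb_simps)
  qed
  ultimately have "I \<subseteq> J" by (rule F.genideal_minimal)
  then show "x \<in> carrier F" "cp.P (emb x) = 0" using assms by (auto simp: J_def)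
qed

lemma cp_class_eq_iff:
  "x \<in> free_carrier gens \<Longrightarrow> y \<in> free_carrier gens \<Longrightarrow> cp_class D x = cp_class D y \<longleftrightarrow> cp.P (x - y) = 0"
  by (simp add: cp_class_eq cp.cls_const_eq_iff)

lemma alg_to_cstar_coset:
  assumes x: "x \<in> carrier F"
  shows "alg_to_cstar D (I +>\<^bsub>F\<^esub> x) = cp_class D (emb x)"
proof -
  have "cp_class D (emb y) = cp_class D (emb x)" if y: "y \<in> I +>\<^bsub>F\<^esub> x" for y
  proof -
    obtain h where h: "h \<in> I" "y = h + x"
      using y by (auto simp: a_r_coset_def' free_algebra_def)
    have "y \<in> carrier F" using h ideal_vanishes(1) x by (simp add: free_add)
    moreover have "cp.P (emb y - emb x) = 0" using h ideal_vanishes(2) by (simp add: emb_simps)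
    ultimately show ?thesis using x by (simp add: cp_class_eq_iff emb_closed)
  qed
  moreover have "x \<in> I +>\<^bsub>F\<^esub> x" by (rule I.a_rcos_self[OF x])
  ultimately have "(\<lambda>x. cp_class D (emb x)) ` (I +>\<^bsub>F\<^esub> x) = {cp_class D (emb x)}" by blast
  then show ?thesis by (simp add: alg_to_cstar_def emb_def)
qed

lemma alg_cp_carrier: "carrier (alg_cp D) = (\<lambda>x. I +>\<^bsub>F\<^esub> x) ` carrier F"
  by (auto simp: alg_cp_def Let_def FactRing_def A_RCOSETS_def' a_r_coset_def')

lemma alg_part_eq: "alg_part D = (\<lambda>x. cp_class D (emb x)) ` carrier F"
  unfolding alg_part_def alg_cp_carrier image_image
  by (rule image_cong) (simp_all add: alg_to_cstar_coset)

lemma cp_class_CP: "x \<in> free_carrier gens \<Longrightarrow> cp_class D x \<in> carrier CP"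
  by (simp add: cp_class_eq CP_eq cp.B_simps cp.C_const)

lemma alg_part_CP: "alg_part D \<subseteq> carrier CP"
  by (auto simp: alg_part_eq intro!: cp_class_CP emb_closed)

subsection \<open>Monomials\<close>

text \<open>Equality in the C*-crossed product, expressed for elements of the free algebra, where the
  products of generators can be rewritten directly.\<close>

definition eqv :: "'a cp_free \<Rightarrow> 'a cp_free \<Rightarrow> bool" (infix "\<doteq>" 50) where
  "x \<doteq> y \<longleftrightarrow> x \<in> free_carrier gens \<and> y \<in> free_carrier gens \<and> cp.P (x - y) = 0"

lemma eqv_refl: "x \<in> free_carrier gens \<Longrightarrow> x \<doteq> x"
  by (simp add: eqv_def)

lemma eqv_sym: "x \<doteq> y \<Longrightarrow> y \<doteq> x"
  using cp.P_diff_commute[of x y] by (simp add: eqv_def)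

lemma eqv_trans [trans]: "x \<doteq> y \<Longrightarrow> y \<doteq> z \<Longrightarrow> x \<doteq> z"
  using cp.P_diff_triangle[of x y z] cp.P_nonneg[of "x - z"] by (simp add: eqv_def free_diff)

lemma eqv_mult: "x \<doteq> x' \<Longrightarrow> y \<doteq> y' \<Longrightarrow> x * y \<doteq> x' * y'"
  using cp.P_mult_diff[of x y x' y'] cp.P_nonneg[of "x * y - x' * y'"] by (simp add: eqv_def free_mult free_diff)

lemma eqv_rel: "rel x y \<Longrightarrow> x \<doteq> y"
  by (simp add: eqv_def rel_closed rel_P)

lemma eqv_left: "x \<doteq> x' \<Longrightarrow> y \<in> free_carrier gens \<Longrightarrow> x * y \<doteq> x' * y"
  and eqv_right: "y \<doteq> y' \<Longrightarrow> x \<in> free_carrier gens \<Longrightarrow> x * y \<doteq> x * y'"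
  by (auto intro: eqv_mult eqv_refl)

abbreviation "hc a \<equiv> gen (Coef (hat D a)) :: 'a cp_free"
abbreviation "u \<rho> \<equiv> gen (U \<rho>) :: 'a cp_free"
abbreviation "us \<rho> \<equiv> gen (Ustar \<rho>) :: 'a cp_free"

lemma gens_free [simp]: "hc a \<in> free_carrier gens" "\<rho> \<in> S \<Longrightarrow> u \<rho> \<in> free_carrier gens" "\<rho> \<in> S \<Longrightarrow> us \<rho> \<in> free_carrier gens"
  by (simp_all add: free_gen hat_CX)

lemma eqv_rules:
  assumes "\<rho> \<in> S" "\<tau> \<in> S"
  shows "hc a * hc b \<doteq> hc (a * b)" "hc 1 \<doteq> 1" "us \<rho> * u \<rho> \<doteq> 1" "u \<rho> * us \<rho> \<doteq> hc (\<rho> 1)"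
    "u \<rho> * u \<tau> \<doteq> u (\<rho> \<circ> \<tau>)" "us \<rho> * us \<tau> \<doteq> us (\<tau> \<circ> \<rho>)" "u \<rho> * hc a \<doteq> hc (\<rho> a) * u \<rho>"
    "hc a * us \<rho> \<doteq> us \<rho> * hc (\<rho> a)"
proof -
  have one: "endo_CX D \<rho> \<one>\<^bsub>CX D\<^esub> = hat D (\<rho> 1)"
    using endo_CX_hat[OF assms(1), of 1] by (simp add: hat_simps)
  show "hc a * hc b \<doteq> hc (a * b)"
    using eqv_sym[OF eqv_rel[OF cp_relation.intros(2)[OF hat_CX hat_CX]], of a b] by (simp add: hat_simps)
  show "hc 1 \<doteq> 1" using eqv_rel[OF cp_relation.intros(4)] by (simp add: hat_simps)
  show "us \<rho> * u \<rho> \<doteq> 1" using assms by (intro eqv_rel cp_relation.intros)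
  show "u \<rho> * us \<rho> \<doteq> hc (\<rho> 1)" unfolding one[symmetric] using assms by (intro eqv_rel cp_relation.intros)
  show "u \<rho> * u \<tau> \<doteq> u (\<rho> \<circ> \<tau>)" "us \<rho> * us \<tau> \<doteq> us (\<tau> \<circ> \<rho>)"
    using assms by (auto intro!: eqv_sym[OF eqv_rel] cp_relation.intros)
  show "u \<rho> * hc a \<doteq> hc (\<rho> a) * u \<rho>" "hc a * us \<rho> \<doteq> us \<rho> * hc (\<rho> a)"
    unfolding endo_CX_hat[OF assms(1), symmetric] using assms by (auto intro!: eqv_rel cp_relation.intros hat_CX)
qed

text \<open>Commutativity of \<open>S\<close> enters through \<open>U\<^sub>\<tau> U\<^sub>\<kappa>\<^sup>* = U\<^sub>\<kappa>\<^sup>* U\<^sub>\<kappa> U\<^sub>\<tau> U\<^sub>\<kappa>\<^sup>*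
  = U\<^sub>\<kappa>\<^sup>* U\<^sub>\<tau> U\<^sub>\<kappa> U\<^sub>\<kappa>\<^sup>* = U\<^sub>\<kappa>\<^sup>* \<tau>(\<kappa>(1)) U\<^sub>\<tau>\<close>.\<close>

lemma u_us_swap:
  assumes \<tau>: "\<tau> \<in> S" and \<kappa>: "\<kappa> \<in> S"
  shows "u \<tau> * us \<kappa> \<doteq> us \<kappa> * hc (\<tau> (\<kappa> 1)) * u \<tau>"
proof -
  note free = \<tau> \<kappa> free_mult endo_comp free_one
  have "1 * (u \<tau> * us \<kappa>) \<doteq> us \<kappa> * u \<kappa> * (u \<tau> * us \<kappa>)"
    by (intro eqv_left eqv_sym[OF eqv_rules(3)[OF \<kappa> \<kappa>]]) (simp_all add: free)
  also have "us \<kappa> * u \<kappa> * (u \<tau> * us \<kappa>) = us \<kappa> * (u \<kappa> * u \<tau> * us \<kappa>)" by (simp add: mult.assoc)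
  also have "\<dots> \<doteq> us \<kappa> * (u (\<kappa> \<circ> \<tau>) * us \<kappa>)"
    by (intro eqv_right eqv_left eqv_rules(5)[OF \<kappa> \<tau>]) (simp_all add: free)
  also have "u (\<kappa> \<circ> \<tau>) = u (\<tau> \<circ> \<kappa>)" using endo_commute[OF \<kappa> \<tau>] by simp
  also have "us \<kappa> * (u (\<tau> \<circ> \<kappa>) * us \<kappa>) \<doteq> us \<kappa> * (u \<tau> * u \<kappa> * us \<kappa>)"
    by (intro eqv_right eqv_left eqv_sym[OF eqv_rules(5)[OF \<tau> \<kappa>]]) (simp_all add: free)
  also have "\<dots> = us \<kappa> * (u \<tau> * (u \<kappa> * us \<kappa>))" by (simp add: mult.assoc)
  also have "\<dots> \<doteq> us \<kappa> * (u \<tau> * hc (\<kappa> 1))"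
    by (intro eqv_right eqv_rules(4)[OF \<kappa> \<kappa>]) (simp_all add: free)
  also have "\<dots> \<doteq> us \<kappa> * (hc (\<tau> (\<kappa> 1)) * u \<tau>)"
    by (intro eqv_right eqv_rules(7)[OF \<tau> \<tau>]) (simp_all add: free)
  finally show ?thesis by (simp add: mult.assoc)
qed

text \<open>By induction on the word, multiplying from the right. The rules move \<open>U\<^sub>\<tau>\<close> past the new letter:
  \<open>U\<^sub>\<tau> b = \<tau>(b) U\<^sub>\<tau>\<close>, \<open>U\<^sub>\<tau> U\<^sub>\<kappa> = U\<^sub>\<tau>\<^sub>\<kappa>\<close>, and
  \<open>U\<^sub>\<rho>\<^sup>* a U\<^sub>\<tau> U\<^sub>\<kappa>\<^sup>* = U\<^sub>\<rho>\<^sup>* a U\<^sub>\<kappa>\<^sup>* \<tau>(\<kappa>(1)) U\<^sub>\<tau> = U\<^sub>\<kappa>\<^sub>\<rho>\<^sup>* \<kappa>(a) \<tau>(\<kappa>(1)) U\<^sub>\<tau>\<close>.\<close>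

lemma word_normal_form:
  assumes "set gs \<subseteq> alg_gens"
  shows "\<exists>\<rho>\<in>S. \<exists>\<tau>\<in>S. \<exists>a. emb (prod_list (map gen gs)) \<doteq> us \<rho> * hc a * u \<tau>"
  using assms
proof (induction gs rule: rev_induct)
  case Nil
  have "1 \<doteq> us id * u id" by (rule eqv_sym[OF eqv_rules(3)[OF endo_id endo_id]])
  also have "us id * u id = us id * 1 * u id" by simp
  also have "\<dots> \<doteq> us id * hc 1 * u id"
    by (intro eqv_left eqv_right eqv_sym[OF eqv_rules(2)[OF endo_id endo_id]]) (simp_all add: endo_id)
  finally show ?case using endo_id by (auto simp: emb_simps)
next
  case (snoc g gs)
  then obtain \<rho> \<tau> a where \<rho>: "\<rho> \<in> S" and \<tau>: "\<tau> \<in> S" and a: "emb (prod_list (map gen gs)) \<doteq> us \<rho> * hc a * u \<tau>"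
    by auto
  have g: "emb (gen g) \<in> free_carrier gens" using snoc by (intro emb_closed free_gen) simp
  note free = \<rho> \<tau> free_mult endo_comp
  have "emb (prod_list (map gen (gs @ [g]))) = emb (prod_list (map gen gs)) * emb (gen g)"
    by (simp add: emb_simps(6))
  also have "\<dots> \<doteq> us \<rho> * hc a * u \<tau> * emb (gen g)" using a g by (rule eqv_left)
  finally have start: "emb (prod_list (map gen (gs @ [g]))) \<doteq> us \<rho> * hc a * u \<tau> * emb (gen g)" .
  show ?case
  proof (cases g)
    case (Coef b)
    have "us \<rho> * hc a * u \<tau> * hc b = us \<rho> * hc a * (u \<tau> * hc b)" by (simp add: mult.assoc)
    also have "\<dots> \<doteq> us \<rho> * hc a * (hc (\<tau> b) * u \<tau>)"
      by (intro eqv_right eqv_rules(7)[OF \<tau> \<tau>]) (simp_all add: free)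
    also have "\<dots> = us \<rho> * (hc a * hc (\<tau> b)) * u \<tau>" by (simp add: mult.assoc)
    also have "\<dots> \<doteq> us \<rho> * hc (a * \<tau> b) * u \<tau>"
      by (intro eqv_left eqv_right eqv_rules(1)[OF \<rho> \<tau>]) (simp_all add: free)
    finally show ?thesis using eqv_trans[OF start] Coef \<rho> \<tau> by (auto simp: emb_simps)
  next
    case (U \<kappa>)
    then have \<kappa>: "\<kappa> \<in> S" using snoc by simp
    have "us \<rho> * hc a * u \<tau> * u \<kappa> = us \<rho> * hc a * (u \<tau> * u \<kappa>)" by (simp add: mult.assoc)
    also have "\<dots> \<doteq> us \<rho> * hc a * u (\<tau> \<circ> \<kappa>)"
      by (intro eqv_right eqv_rules(5)[OF \<tau> \<kappa>]) (simp_all add: free \<kappa>)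
    finally have step: "us \<rho> * hc a * u \<tau> * u \<kappa> \<doteq> us \<rho> * hc a * u (\<tau> \<circ> \<kappa>)" .
    have "emb (gen g) = u \<kappa>" by (simp add: U emb_simps)
    from eqv_trans[OF start[unfolded this] step] show ?thesis
      using \<rho> endo_comp[OF \<tau> \<kappa>] by blast
  next
    case (Ustar \<kappa>)
    then have \<kappa>: "\<kappa> \<in> S" using snoc by simp
    have "us \<rho> * hc a * u \<tau> * us \<kappa> = us \<rho> * hc a * (u \<tau> * us \<kappa>)" by (simp add: mult.assoc)
    also have "\<dots> \<doteq> us \<rho> * hc a * (us \<kappa> * hc (\<tau> (\<kappa> 1)) * u \<tau>)"
      by (intro eqv_right u_us_swap) (simp_all add: free \<kappa>)
    also have "\<dots> = us \<rho> * ((hc a * us \<kappa>) * (hc (\<tau> (\<kappa> 1)) * u \<tau>))" by (simp add: mult.assoc)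
    also have "\<dots> \<doteq> us \<rho> * ((us \<kappa> * hc (\<kappa> a)) * (hc (\<tau> (\<kappa> 1)) * u \<tau>))"
      by (intro eqv_right eqv_left eqv_rules(8)[OF \<kappa> \<tau>]) (simp_all add: free \<kappa>)
    also have "\<dots> = (us \<rho> * us \<kappa>) * (hc (\<kappa> a) * hc (\<tau> (\<kappa> 1)) * u \<tau>)" by (simp add: mult.assoc)
    also have "\<dots> \<doteq> us (\<kappa> \<circ> \<rho>) * (hc (\<kappa> a * \<tau> (\<kappa> 1)) * u \<tau>)"
      by (intro eqv_mult eqv_left eqv_rules(1)[OF \<rho> \<tau>] eqv_rules(6) \<rho> \<kappa>) (simp_all add: free)
    finally show ?thesis
      using eqv_trans[OF start] Ustar \<tau> endo_comp[OF \<kappa> \<rho>] by (auto simp: emb_simps mult.assoc)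
  qed
qed

subsection \<open>The conditional expectation on the algebraic part\<close>

lemma act_CX_scale: "act_CX D \<alpha> (\<lambda>\<xi>. c * f \<xi>) = (\<lambda>\<xi>. c * act_CX D \<alpha> f \<xi>)"
  and act_CX_plus: "act_CX D \<alpha> (\<lambda>\<xi>. f \<xi> + g \<xi>) = (\<lambda>\<xi>. act_CX D \<alpha> f \<xi> + act_CX D \<alpha> g \<xi>)"
  by (auto simp: act_CX_def)

lemma subst_closed_gens: "\<alpha> \<in> carrier (Gal D) \<Longrightarrow> x \<in> free_carrier gens \<Longrightarrow> cp.subst (act_gen \<alpha>) x \<in> free_carrier gens"
  by (rule cp.letter_map_closed[OF act_letter_map])

lemma expectation_monomial:
  assumes E: "canonical_expectation D E" and S: "\<rho> \<in> S" "\<tau> \<in> S" and f: "f \<in> carrier (CX D)"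
  shows "E (cp_class D (us \<rho> * gen (Coef f) * u \<tau>)) =
    (if \<rho> = \<tau> then inv_into (carrier (CX D)) (endo_CX D \<rho>) (\<lambda>\<xi>. hat D (\<rho> 1) \<xi> * f \<xi>) else (\<lambda>_. 0))"
proof -
  have free: "us \<rho> \<in> free_carrier gens" "(gen (Coef f) :: 'a cp_free) \<in> free_carrier gens" "u \<tau> \<in> free_carrier gens"
    using S f by (auto intro: free_gen)
  have monomial: "adj CP (isom D \<rho>) \<otimes>\<^bsub>CP\<^esub> \<iota> D f \<otimes>\<^bsub>CP\<^esub> isom D \<tau> = cp_class D (us \<rho> * gen (Coef f) * u \<tau>)"
    unfolding adj_isom[OF S(1)] unfolding \<iota>_def isom_def cp_class_eq CP_eq
    using free by (simp add: cp.B_simps cp.C_const free_mult)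
  have unit: "endo_CX D \<rho> \<one>\<^bsub>CX D\<^esub> = hat D (\<rho> 1)"
    using endo_CX_hat[OF S(1), of 1] by (simp add: hat_simps)
  have "E (adj CP (isom D \<rho>) \<otimes>\<^bsub>CP\<^esub> \<iota> D f \<otimes>\<^bsub>CP\<^esub> isom D \<tau>) =
      (if \<rho> = \<tau> then inv_into (carrier (CX D)) (endo_CX D \<rho>) (endo_CX D \<rho> \<one>\<^bsub>CX D\<^esub> \<otimes>\<^bsub>CX D\<^esub> f) else \<zero>\<^bsub>CX D\<^esub>)"
    using E S f unfolding canonical_expectation_def by blast
  then show ?thesis unfolding monomial unit unfolding CX_simps .
qed

text \<open>It suffices to consider a monomial \<open>U\<^sub>\<rho>\<^sup>* a U\<^sub>\<tau>\<close>. If \<open>\<rho> = \<tau>\<close>, its expectation is the \<open>b \<in> A\<close> with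
  \<open>\<rho>(b) = \<rho>(1) a\<close>, which exists because \<open>\<rho>\<close> maps onto the corner \<open>\<rho>(1) A \<rho>(1)\<close>. Since \<open>\<alpha>\<close> fixes
  \<open>\<rho>(1)\<close> and commutes with \<open>\<rho>\<close>, it maps this solution to the solution for \<open>\<alpha>(a)\<close>.\<close>

lemma expectation_galois:
  assumes E: "canonical_expectation D E" and \<alpha>: "\<alpha> \<in> carrier (Gal D)" and y: "y \<in> alg_part D"
  shows "\<exists>b. E y = hat D b \<and> E (\<Theta> \<alpha> y) = act_CX D \<alpha> (hat D b)"
proof -
  let ?ok = "\<lambda>x. \<exists>b. E (cp_class D (emb x)) = hat D b \<and>
      E (cp_class D (cp.subst (act_gen \<alpha>) (emb x))) = act_CX D \<alpha> (hat D b)"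
  have E_smult: "E (cp_class D (scal c * x)) = (\<lambda>\<xi>. c * E (cp_class D x) \<xi>)" if "x \<in> free_carrier gens" for c x
  proof -
    have "cp_class D (scal c * x) = c \<odot>\<^bsub>CP\<^esub> cp_class D x"
      unfolding cp_class_eq CP_eq using that by (simp add: cp.B_simps cp.C_const)
    then show ?thesis using E cp_class_CP[OF that] by (simp add: canonical_expectation_def)
  qed
  have E_add: "E (cp_class D (x + y)) = (\<lambda>\<xi>. E (cp_class D x) \<xi> + E (cp_class D y) \<xi>)"
    if "x \<in> free_carrier gens" "y \<in> free_carrier gens" for x y
  proof -
    have "cp_class D (x + y) = cp_class D x \<oplus>\<^bsub>CP\<^esub> cp_class D y"
      unfolding cp_class_eq CP_eq using that by (simp add: cp.B_simps cp.C_const)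
    then show ?thesis using E cp_class_CP that by (simp add: canonical_expectation_def)
  qed
  have ok: "?ok x" if "x \<in> carrier F" for x
    using that
  proof (induction x rule: free_induct)
    case (single w c)
    define m :: "('a, 'a \<Rightarrow> 'a) cp_gen fword \<Rightarrow>\<^sub>0 'k" where "m = prod_list (map gen (letters w))"
    have m: "emb m \<in> free_carrier gens"
      unfolding m_def using single by (intro emb_closed free_prod_list)
    obtain \<rho> \<tau> a where \<rho>: "\<rho> \<in> S" and \<tau>: "\<tau> \<in> S" and a: "emb m \<doteq> us \<rho> * hc a * u \<tau>"
      using word_normal_form[OF single] unfolding m_def by blast
    have cls: "cp_class D (emb m) = cp_class D (us \<rho> * hc a * u \<tau>)"
      using a by (simp add: eqv_def cp_class_eq_iff)
    have "cp.P (cp.subst (act_gen \<alpha>) (emb m) - cp.subst (act_gen \<alpha>) (us \<rho> * hc a * u \<tau>)) = 0"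
      using cp.P_subst_le[OF act_letter_map[OF \<alpha>], of "emb m - us \<rho> * hc a * u \<tau>"] a
        cp.P_nonneg[of "cp.subst (act_gen \<alpha>) (emb m) - cp.subst (act_gen \<alpha>) (us \<rho> * hc a * u \<tau>)"]
      by (simp add: eqv_def free_diff subst_closed_gens[OF \<alpha>] cp.sub_simps(8))
    then have "cp_class D (cp.subst (act_gen \<alpha>) (emb m)) = cp_class D (cp.subst (act_gen \<alpha>) (us \<rho> * hc a * u \<tau>))"
      using a by (simp add: eqv_def cp_class_eq_iff subst_closed_gens[OF \<alpha>])
    then have cls_act: "cp_class D (cp.subst (act_gen \<alpha>) (emb m))
        = cp_class D (us \<rho> * gen (Coef (act_CX D \<alpha> (hat D a))) * u \<tau>)"
      by (simp add: cp.sub_simps)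
    have "\<exists>b. E (cp_class D (emb m)) = hat D b \<and> E (cp_class D (cp.subst (act_gen \<alpha>) (emb m))) = act_CX D \<alpha> (hat D b)"
    proof (cases "\<rho> = \<tau>")
      case True
      have "\<rho> 1 * a * \<rho> 1 \<in> range \<rho>" using endo_corner[OF \<rho>] by (auto simp: bij_betw_def)
      then obtain b where b: "\<rho> b = \<rho> 1 * a * \<rho> 1" by (metis rangeE)
      moreover have "\<rho> 1 * \<rho> 1 = \<rho> 1" using endo_hom(2)[OF \<rho>, of 1 1] by simp
      ultimately have b': "\<rho> b = \<rho> 1 * a" by (metis mult.assoc mult.commute)
      then have endo: "endo_CX D \<rho> (hat D b) = (\<lambda>\<xi>. hat D (\<rho> 1) \<xi> * hat D a \<xi>)"
        by (simp add: endo_CX_hat[OF \<rho>] hat_simps)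
      have "endo_CX D \<rho> (act_CX D \<alpha> (hat D b)) = (\<lambda>\<xi>. hat D (\<rho> 1) \<xi> * act_CX D \<alpha> (hat D a) \<xi>)"
      proof -
        have "act_CX D \<alpha> (hat D (\<rho> 1)) = hat D (\<rho> 1)"
          using act_CX_endo[OF \<alpha> \<rho>, of "hat D 1"] act_X_closed[of "inv\<^bsub>Gal D\<^esub> \<alpha>"] \<alpha>
          by (auto simp: endo_CX_hat[OF \<rho>, symmetric] hat_simps act_CX_def intro!: arg_cong[of _ _ "endo_CX D \<rho>"])
        moreover have "act_CX D \<alpha> (\<lambda>\<xi>. hat D (\<rho> 1) \<xi> * hat D a \<xi>)
            = (\<lambda>\<xi>. act_CX D \<alpha> (hat D (\<rho> 1)) \<xi> * act_CX D \<alpha> (hat D a) \<xi>)"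
          by (auto simp: act_CX_def)
        ultimately show ?thesis using act_CX_endo[OF \<alpha> \<rho>, of "hat D b"] endo by simp
      qed
      note endo_act = this
      have "E (cp_class D (emb m)) = inv_into (carrier (CX D)) (endo_CX D \<rho>) (endo_CX D \<rho> (hat D b))"
        unfolding cls expectation_monomial[OF E \<rho> \<tau> hat_CX] endo using True by (rule if_P)
      moreover have "E (cp_class D (cp.subst (act_gen \<alpha>) (emb m)))
          = inv_into (carrier (CX D)) (endo_CX D \<rho>) (endo_CX D \<rho> (act_CX D \<alpha> (hat D b)))"
        unfolding cls_act expectation_monomial[OF E \<rho> \<tau> act_CX_closed[OF \<alpha> hat_CX]] endo_act
        using True by (rule if_P)
      ultimately show ?thesis
        using inv_into_f_f[OF endo_CX_inj[OF \<rho>] hat_CX, of b]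
          inv_into_f_f[OF endo_CX_inj[OF \<rho>] act_CX_closed[OF \<alpha> hat_CX], of b] by auto
    next
      case False
      have "hat D 0 = (\<lambda>_. 0)" by (auto simp: hat_def X_iff khom_0)
      moreover have "act_CX D \<alpha> (\<lambda>_. 0) = (\<lambda>_. 0)" by (auto simp: act_CX_def)
      ultimately show ?thesis using False
        by (intro exI[of _ 0])
          (simp add: cls cls_act expectation_monomial[OF E \<rho> \<tau>] hat_CX act_CX_closed[OF \<alpha>])
    qed
    then obtain b where b: "E (cp_class D (emb m)) = hat D b"
      "E (cp_class D (cp.subst (act_gen \<alpha>) (emb m))) = act_CX D \<alpha> (hat D b)" by blast
    have "emb (Poly_Mapping.single w c) = scal (\<sigma> c) * emb m"
      by (simp add: single_word_eq[of w c] m_def emb_simps)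
    then show ?case
      using b m subst_closed_gens[OF \<alpha> m]
      by (intro exI[of _ "scaleA D c b"]) (simp add: cp.sub_simps E_smult hat_simps act_CX_scale)
  next
    case (add x y)
    then obtain b b' where b: "E (cp_class D (emb x)) = hat D b"
      "E (cp_class D (cp.subst (act_gen \<alpha>) (emb x))) = act_CX D \<alpha> (hat D b)"
      "E (cp_class D (emb y)) = hat D b'"
      "E (cp_class D (cp.subst (act_gen \<alpha>) (emb y))) = act_CX D \<alpha> (hat D b')" by blast
    have free: "emb x \<in> free_carrier gens" "emb y \<in> free_carrier gens" using add by (simp_all add: emb_closed)
    show ?case
      using b free subst_closed_gens[OF \<alpha>] 
      by (intro exI[of _ "b + b'"]) (simp add: emb_simps cp.sub_simps E_add hat_simps act_CX_plus)
  qed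
  obtain x where x: "x \<in> carrier F" "y = cp_class D (emb x)" using y by (auto simp: alg_part_eq)
  then show ?thesis using ok[OF x(1)] \<Theta>_class[OF \<alpha> emb_closed[OF x(1)]] by simp
qed

end

section \<open>The action of the abelianized Galois group\<close>

text \<open>A homomorphism whose values commute kills the commutators.\<close>

lemma (in group) hom_const_on_derived_cosets:
  assumes R: "R \<in> hom G H" and H: "group H"
    and comm: "\<And>x y. x \<in> carrier G \<Longrightarrow> y \<in> carrier G \<Longrightarrow> R (x \<otimes> y) = R (y \<otimes> x)"
    and c: "c \<in> carrier (G Mod derived G (carrier G))" "x \<in> c" "y \<in> c"
  shows "R x = R y"
proof -
  interpret R: group_hom G H R using R H by (simp add: group_hom_def group_hom_axioms_def is_group)
  have "derived_set G (carrier G) \<subseteq> kernel G H R"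
  proof
    fix z assume "z \<in> derived_set G (carrier G)"
    then obtain h k where hk: "h \<in> carrier G" "k \<in> carrier G" "z = h \<otimes> k \<otimes> inv h \<otimes> inv k" by blast
    then have z: "z = (h \<otimes> k) \<otimes> inv (k \<otimes> h)" by (simp add: inv_mult_group m_assoc)
    have "R z = R (h \<otimes> k) \<otimes>\<^bsub>H\<^esub> inv\<^bsub>H\<^esub> R (k \<otimes> h)" unfolding z using hk by (simp del: R.hom_mult add: R.hom_mult[of "h \<otimes> k"])
    also have "\<dots> = \<one>\<^bsub>H\<^esub>" using comm[OF hk(1,2)] hk by (simp del: R.hom_mult)
    finally show "z \<in> kernel G H R" using hk by (simp add: kernel_def)
  qed
  then have derived: "derived G (carrier G) \<subseteq> kernel G H R"
    unfolding derived_def by (rule generate_subgroup_incl) (rule R.subgroup_kernel)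
  have "R z = R g" if "z \<in> derived G (carrier G) #> g" "g \<in> carrier G" for z g
    using that derived by (auto simp: r_coset_def kernel_def subset_iff)
  then show ?thesis using c by (auto simp: FactGroup_def RCOSETS_def)
qed

context endomotive
begin

interpretation G: group "Gal D" by (rule group_Gal)

lemma \<Theta>_one: "Y \<in> carrier CP \<Longrightarrow> \<Theta> \<one>\<^bsub>Gal D\<^esub> Y = Y"
proof -
  assume Y: "Y \<in> carrier CP"
  have Bij: "\<Theta> \<one>\<^bsub>Gal D\<^esub> \<in> Bij (carrier CP)"
    using \<Theta>_aut[OF G.one_closed] by (simp add: star_aut_group_def)
  then have "\<Theta> \<one>\<^bsub>Gal D\<^esub> Y \<in> carrier CP" using Y Bij_imp_funcset by blast
  moreover have "\<Theta> \<one>\<^bsub>Gal D\<^esub> (\<Theta> \<one>\<^bsub>Gal D\<^esub> Y) = \<Theta> \<one>\<^bsub>Gal D\<^esub> Y"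
    using \<Theta>_mult[OF G.one_closed G.one_closed Y] by simp
  ultimately show ?thesis using Bij Y by (auto simp: Bij_def bij_betw_def inj_on_def)
qed

lemma \<Theta>_inverse:
  assumes "\<alpha> \<in> carrier (Gal D)" "Y \<in> carrier CP"
  shows "\<Theta> \<alpha> (\<Theta> (inv\<^bsub>Gal D\<^esub> \<alpha>) Y) = Y" "\<Theta> (inv\<^bsub>Gal D\<^esub> \<alpha>) (\<Theta> \<alpha> Y) = Y"
  using \<Theta>_mult[of \<alpha> "inv\<^bsub>Gal D\<^esub> \<alpha>" Y] \<Theta>_mult[of "inv\<^bsub>Gal D\<^esub> \<alpha>" \<alpha> Y] \<Theta>_one assms by simp_all

lemma Gal_ab_rep:
  assumes "c \<in> carrier (Gal_ab D)"
  obtains \<alpha> where "\<alpha> \<in> carrier (Gal D)" "c = derived (Gal D) (carrier (Gal D)) #>\<^bsub>Gal D\<^esub> \<alpha>" "\<alpha> \<in> c"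
proof -
  obtain \<alpha> where \<alpha>: "\<alpha> \<in> carrier (Gal D)" "c = derived (Gal D) (carrier (Gal D)) #>\<^bsub>Gal D\<^esub> \<alpha>"
    using assms by (auto simp: Gal_ab_def FactGroup_def RCOSETS_def)
  moreover have "\<alpha> \<in> c"
    using G.rcos_self[OF \<alpha>(1) G.derived_is_subgroup] \<alpha>(2) by simp
  ultimately show thesis by (rule that)
qed

lemma Gal_ab_carrier:
  assumes "c \<in> carrier (Gal_ab D)" "\<alpha> \<in> c"
  shows "\<alpha> \<in> carrier (Gal D)"
proof -
  obtain \<beta> where "\<beta> \<in> carrier (Gal D)" "c = derived (Gal D) (carrier (Gal D)) #>\<^bsub>Gal D\<^esub> \<beta>"
    using Gal_ab_rep[OF assms(1)] by metis
  then show ?thesis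
    using G.r_coset_subset_G[OF G.derived_in_carrier] assms(2) by blast
qed

lemma Gal_ab_inv:
  assumes c: "c \<in> carrier (Gal_ab D)" and "\<alpha> \<in> c"
  shows "inv\<^bsub>Gal D\<^esub> \<alpha> \<in> inv\<^bsub>Gal_ab D\<^esub> c" "inv\<^bsub>Gal_ab D\<^esub> c \<in> carrier (Gal_ab D)"
proof -
  interpret N: normal "derived (Gal D) (carrier (Gal D))" "Gal D" by (rule G.derived_self_is_normal)
  show "inv\<^bsub>Gal D\<^esub> \<alpha> \<in> inv\<^bsub>Gal_ab D\<^esub> c"
    using assms N.inv_FactGroup[of c] by (auto simp: Gal_ab_def SET_INV_def)
  show "inv\<^bsub>Gal_ab D\<^esub> c \<in> carrier (Gal_ab D)"
    using c group.inv_closed[OF N.factorgroup_is_group] by (simp add: Gal_ab_def)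
qed

definition \<Theta>_alg :: "(complex \<Rightarrow> complex) \<Rightarrow> (nat \<Rightarrow> 'a cp_free) set \<Rightarrow> (nat \<Rightarrow> 'a cp_free) set" where
  "\<Theta>_alg \<alpha> = restrict (\<Theta> \<alpha>) (alg_part D)"

text \<open>All elements of a coset give the same map if the levels are products of abelian extensions.\<close>

definition \<Psi> :: "(complex \<Rightarrow> complex) set \<Rightarrow> (nat \<Rightarrow> 'a cp_free) set \<Rightarrow> (nat \<Rightarrow> 'a cp_free) set" where
  "\<Psi> c = \<Theta>_alg (SOME \<alpha>. \<alpha> \<in> c)"

context
  assumes abelian: "\<forall>\<beta>\<in>indices D. product_of_abelian_extensions D (level D \<beta>)"
begin

text \<open>\<open>\<alpha>\<close> acts on a word by replacing each coefficient \<open>a \<in> A\<close> by an element \<open>t(a) \<in> A\<close> and leaves the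
  scalars alone, so the result comes from the algebraic crossed product again.\<close>

lemma \<Theta>_alg_part_mem:
  assumes \<alpha>: "\<alpha> \<in> carrier (Gal D)" and y: "y \<in> alg_part D"
  shows "\<Theta> \<alpha> y \<in> alg_part D"
proof -
  obtain x where x: "x \<in> carrier F" "y = cp_class D (emb x)" using y by (auto simp: alg_part_eq)
  obtain t where t: "\<And>a. act_CX D \<alpha> (hat D a) = hat D (t a)" using act_hat[OF abelian \<alpha>] by metis
  define x' where "x' = subst_letters (map_cp_gen t id) (\<lambda>c. c) x"
  have x': "x' \<in> carrier F"
    unfolding x'_def by (rule subst_closed[OF ring_map_id x(1)]) (auto simp: cp_gens_def A_alg_def)
  have "cp.subst (act_gen \<alpha>) (emb x) = subst_letters (\<lambda>g. act_gen \<alpha> (map_cp_gen (hat D) id g)) \<sigma> x"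
    unfolding emb_def by (rule subst_comp[OF ring_map_id \<sigma>_ring x(1)]) auto
  moreover have "emb x' = subst_letters (\<lambda>g. act_gen \<alpha> (map_cp_gen (hat D) id g)) \<sigma> x"
    unfolding emb_def x'_def
  proof (rule subst_comp[OF \<sigma>_ring ring_map_id x(1)])
    show "map_cp_gen (hat D) id (map_cp_gen t id g) = act_gen \<alpha> (map_cp_gen (hat D) id g)" for g
      by (cases g) (simp_all add: t)
  qed auto
  ultimately have "\<Theta> \<alpha> y = cp_class D (emb x')"
    using x \<Theta>_class[OF \<alpha> emb_closed[OF x(1)]] by simp
  then show ?thesis using x' by (auto simp: alg_part_eq)
qed

lemma \<Theta>_alg_part_bij:
  assumes \<alpha>: "\<alpha> \<in> carrier (Gal D)"
  shows "bij_betw (\<Theta> \<alpha>) (alg_part D) (alg_part D)"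
  by (rule bij_betw_byWitness[where f' = "\<Theta> (inv\<^bsub>Gal D\<^esub> \<alpha>)"])
    (use \<alpha> alg_part_CP in \<open>auto simp: \<Theta>_inverse \<Theta>_alg_part_mem\<close>)

lemma \<Theta>_alg_Bij: "\<alpha> \<in> carrier (Gal D) \<Longrightarrow> \<Theta>_alg \<alpha> \<in> Bij (alg_part D)"
  using \<Theta>_alg_part_bij by (simp add: \<Theta>_alg_def Bij_def)

lemma \<Theta>_alg_hom: "\<Theta>_alg \<in> hom (Gal D) (BijGroup (alg_part D))"
proof (rule homI)
  show "\<Theta>_alg \<alpha> \<in> carrier (BijGroup (alg_part D))" if "\<alpha> \<in> carrier (Gal D)" for \<alpha>
    using \<Theta>_alg_Bij[OF that] by (simp add: BijGroup_def)
  fix \<alpha> \<beta> assume ab: "\<alpha> \<in> carrier (Gal D)" "\<beta> \<in> carrier (Gal D)"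
  have "\<Theta>_alg (\<alpha> \<otimes>\<^bsub>Gal D\<^esub> \<beta>) = compose (alg_part D) (\<Theta>_alg \<alpha>) (\<Theta>_alg \<beta>)"
    using ab alg_part_CP \<Theta>_alg_part_mem
    by (auto simp: \<Theta>_alg_def compose_def fun_eq_iff restrict_def \<Theta>_mult subset_iff)
  then show "\<Theta>_alg (\<alpha> \<otimes>\<^bsub>Gal D\<^esub> \<beta>) = \<Theta>_alg \<alpha> \<otimes>\<^bsub>BijGroup (alg_part D)\<^esub> \<Theta>_alg \<beta>"
    using ab by (simp add: BijGroup_def \<Theta>_alg_Bij)
qed

text \<open>Products in both orders replace the coefficients \<open>a \<in> A\<close> in the same way.\<close>

lemma \<Theta>_alg_commute:
  assumes "\<alpha> \<in> carrier (Gal D)" "\<beta> \<in> carrier (Gal D)"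
  shows "\<Theta>_alg (\<alpha> \<otimes>\<^bsub>Gal D\<^esub> \<beta>) = \<Theta>_alg (\<beta> \<otimes>\<^bsub>Gal D\<^esub> \<alpha>)"
proof -
  let ?c = "\<alpha> \<otimes>\<^bsub>Gal D\<^esub> \<beta>" and ?d = "\<beta> \<otimes>\<^bsub>Gal D\<^esub> \<alpha>"
  have cd: "?c \<in> carrier (Gal D)" "?d \<in> carrier (Gal D)" using assms by auto
  have "\<Theta> ?c (cp_class D (emb x)) = \<Theta> ?d (cp_class D (emb x))" if x: "x \<in> carrier F" for x
  proof -
    have "cp.subst (act_gen \<gamma>) (emb x) = subst_letters (\<lambda>g. act_gen ?c (map_cp_gen (hat D) id g)) \<sigma> x"
      if "\<gamma> = ?c \<or> \<gamma> = ?d" for \<gamma>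
      unfolding emb_def
    proof (rule subst_comp[OF ring_map_id \<sigma>_ring x])
      show "act_gen \<gamma> (map_cp_gen (hat D) id g) = act_gen ?c (map_cp_gen (hat D) id g)" for g
        using that act_hat_commute[OF abelian assms] by (cases g) auto
    qed auto
    then show ?thesis using \<Theta>_class[OF _ emb_closed[OF x]] cd by simp
  qed
  then show ?thesis by (auto simp: \<Theta>_alg_def alg_part_eq restrict_def fun_eq_iff)
qed

lemma \<Psi>_eq:
  assumes "c \<in> carrier (Gal_ab D)" "\<alpha> \<in> c"
  shows "\<Psi> c = \<Theta>_alg \<alpha>"
  unfolding \<Psi>_def
  by (rule G.hom_const_on_derived_cosets[OF \<Theta>_alg_hom group_BijGroup \<Theta>_alg_commute assms(1)[unfolded Gal_ab_def]])
    (use assms someI[of "\<lambda>\<alpha>. \<alpha> \<in> c" \<alpha>] in auto)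

lemma \<Psi>_hom: "\<Psi> \<in> hom (Gal_ab D) (BijGroup (alg_part D))"
proof (rule homI)
  interpret N: normal "derived (Gal D) (carrier (Gal D))" "Gal D" by (rule G.derived_self_is_normal)
  fix c assume c: "c \<in> carrier (Gal_ab D)"
  obtain \<alpha> where \<alpha>: "\<alpha> \<in> carrier (Gal D)" "c = derived (Gal D) (carrier (Gal D)) #>\<^bsub>Gal D\<^esub> \<alpha>" "\<alpha> \<in> c"
    by (rule Gal_ab_rep[OF c])
  show "\<Psi> c \<in> carrier (BijGroup (alg_part D))"
    using \<Theta>_alg_hom \<alpha>(1) by (auto simp: \<Psi>_eq[OF c \<alpha>(3)] hom_def)
  fix d assume d: "d \<in> carrier (Gal_ab D)"
  obtain \<beta> where \<beta>: "\<beta> \<in> carrier (Gal D)" "d = derived (Gal D) (carrier (Gal D)) #>\<^bsub>Gal D\<^esub> \<beta>" "\<beta> \<in> d"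
    by (rule Gal_ab_rep[OF d])
  have cd: "c \<otimes>\<^bsub>Gal_ab D\<^esub> d = derived (Gal D) (carrier (Gal D)) #>\<^bsub>Gal D\<^esub> (\<alpha> \<otimes>\<^bsub>Gal D\<^esub> \<beta>)"
    using N.rcos_sum[OF \<alpha>(1) \<beta>(1)] \<alpha>(2) \<beta>(2) by (simp add: Gal_ab_def FactGroup_def)
  have "\<alpha> \<otimes>\<^bsub>Gal D\<^esub> \<beta> \<in> c \<otimes>\<^bsub>Gal_ab D\<^esub> d" "c \<otimes>\<^bsub>Gal_ab D\<^esub> d \<in> carrier (Gal_ab D)"
    unfolding cd using G.rcos_self[OF _ G.derived_is_subgroup, of "\<alpha> \<otimes>\<^bsub>Gal D\<^esub> \<beta>"] \<alpha>(1) \<beta>(1)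
    by (auto simp: Gal_ab_def FactGroup_def RCOSETS_def)
  then show "\<Psi> (c \<otimes>\<^bsub>Gal_ab D\<^esub> d) = \<Psi> c \<otimes>\<^bsub>BijGroup (alg_part D)\<^esub> \<Psi> d"
    using \<Psi>_eq[OF c \<alpha>(3)] \<Psi>_eq[OF d \<beta>(3)] \<Psi>_eq[of "c \<otimes>\<^bsub>Gal_ab D\<^esub> d"] \<Theta>_alg_hom \<alpha>(1) \<beta>(1)
    by (simp add: hom_def)
qed

text \<open>The expectation reduces the claim to the pure state on \<open>C(X)\<close> and an element of \<open>A\<close>.\<close>

lemma induced_state_galois:
  assumes \<phi>: "induced_by_pure_state D \<phi>" and c: "c \<in> carrier (Gal_ab D)" "\<alpha> \<in> c" and a: "a \<in> carrier (alg_cp D)"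
  shows "\<phi> (alg_to_cstar D a) \<in> Kbar D"
    "\<alpha> (\<phi> (alg_to_cstar D a)) = \<phi> (\<Psi> (inv\<^bsub>Gal_ab D\<^esub> c) (alg_to_cstar D a))"
proof -
  obtain E \<omega> where E: "canonical_expectation D E" and \<omega>: "pure_state (CX D) \<omega>"
    and \<phi>E: "\<And>x. x \<in> carrier CP \<Longrightarrow> \<phi> x = \<omega> (E x)"
    using \<phi> by (auto simp: induced_by_pure_state_def)
  define y where "y = alg_to_cstar D a"
  have y: "y \<in> alg_part D" using a by (simp add: y_def alg_part_def)
  have \<alpha>: "\<alpha> \<in> carrier (Gal D)" by (rule Gal_ab_carrier[OF c])
  then have \<alpha>': "inv\<^bsub>Gal D\<^esub> \<alpha> \<in> carrier (Gal D)" by simp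
  obtain b where b: "E y = hat D b" "E (\<Theta> (inv\<^bsub>Gal D\<^esub> \<alpha>) y) = act_CX D (inv\<^bsub>Gal D\<^esub> \<alpha>) (hat D b)"
    using expectation_galois[OF E \<alpha>' y] by blast
  have "\<Psi> (inv\<^bsub>Gal_ab D\<^esub> c) y = \<Theta> (inv\<^bsub>Gal D\<^esub> \<alpha>) y"
    using \<Psi>_eq[OF Gal_ab_inv(2,1)[OF c]] y by (simp add: \<Theta>_alg_def)
  moreover have "\<Theta> (inv\<^bsub>Gal D\<^esub> \<alpha>) y \<in> carrier CP" "y \<in> carrier CP"
    using \<Theta>_alg_part_mem[OF \<alpha>' y] y alg_part_CP by auto
  ultimately show "\<phi> (alg_to_cstar D a) \<in> Kbar D"
    "\<alpha> (\<phi> (alg_to_cstar D a)) = \<phi> (\<Psi> (inv\<^bsub>Gal_ab D\<^esub> c) (alg_to_cstar D a))"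
    unfolding y_def[symmetric] using pure_state_galois[OF \<omega> \<alpha>, of b] by (simp_all add: \<phi>E b)
qed

end

end

theorem proposition3p1:
  fixes D :: "('k::field_char_0, 'a::comm_ring_1, 'i) endomotive_data"
  assumes "endomotive D"
  shows "\<exists>\<Theta>. canonical_action D \<Theta> \<and>
      (\<forall>\<Theta>'. canonical_action D \<Theta>' \<longrightarrow> (\<forall>\<alpha>\<in>carrier (Gal D). \<Theta>' \<alpha> = \<Theta> \<alpha>)) \<and>
      (\<forall>\<alpha>\<in>carrier (Gal D). \<Theta> \<alpha> ` (\<iota> D ` carrier (CX D)) = \<iota> D ` carrier (CX D)) \<and>
      (\<forall>\<phi>. pure_state (CX D) \<phi> \<longrightarrow> (\<forall>\<alpha>\<in>carrier (Gal D). \<forall>a.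
         \<phi> (hat D a) \<in> Kbar D \<and>
         \<alpha> (\<phi> (hat D a)) = \<phi> (act_CX D (inv\<^bsub>Gal D\<^esub> \<alpha>) (hat D a)))) \<and>
      ((\<forall>\<beta>\<in>indices D. product_of_abelian_extensions D (level D \<beta>)) \<longrightarrow>
         (\<forall>\<alpha>\<in>carrier (Gal D).
            act_CX D \<alpha> ` range (hat D) = range (hat D) \<and>
            \<Theta> \<alpha> ` alg_part D = alg_part D) \<and>
         (\<exists>\<Psi>\<in>hom (Gal_ab D) (BijGroup (alg_part D)).
            (\<forall>c\<in>carrier (Gal_ab D). \<forall>\<alpha>\<in>c. \<forall>x\<in>alg_part D. \<Psi> c x = \<Theta> \<alpha> x) \<and>
            (\<forall>\<phi>. induced_by_pure_state D \<phi> \<longrightarrow>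
               (\<forall>c\<in>carrier (Gal_ab D). \<forall>\<alpha>\<in>c. \<forall>a\<in>carrier (alg_cp D).
                  \<phi> (alg_to_cstar D a) \<in> Kbar D \<and>
                  \<alpha> (\<phi> (alg_to_cstar D a)) = \<phi> (\<Psi> (inv\<^bsub>Gal_ab D\<^esub> c) (alg_to_cstar D a))))))"
proof -
  interpret endomotive D by (rule assms)
  have part2: "(\<forall>\<alpha>\<in>carrier (Gal D). act_CX D \<alpha> ` range (hat D) = range (hat D) \<and> \<Theta> \<alpha> ` alg_part D = alg_part D) \<and>
         (\<exists>\<Psi>\<in>hom (Gal_ab D) (BijGroup (alg_part D)).
            (\<forall>c\<in>carrier (Gal_ab D). \<forall>\<alpha>\<in>c. \<forall>x\<in>alg_part D. \<Psi> c x = \<Theta> \<alpha> x) \<and>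
            (\<forall>\<phi>. induced_by_pure_state D \<phi> \<longrightarrow>
               (\<forall>c\<in>carrier (Gal_ab D). \<forall>\<alpha>\<in>c. \<forall>a\<in>carrier (alg_cp D).
                  \<phi> (alg_to_cstar D a) \<in> Kbar D \<and>
                  \<alpha> (\<phi> (alg_to_cstar D a)) = \<phi> (\<Psi> (inv\<^bsub>Gal_ab D\<^esub> c) (alg_to_cstar D a)))))"
    if ab: "\<forall>\<beta>\<in>indices D. product_of_abelian_extensions D (level D \<beta>)"
  proof (intro conjI ballI bexI[of _ \<Psi>] allI impI)
    fix \<alpha> assume \<alpha>: "\<alpha> \<in> carrier (Gal D)"
    show "act_CX D \<alpha> ` range (hat D) = range (hat D)" by (rule act_hat_range[OF ab \<alpha>])
    show "\<Theta> \<alpha> ` alg_part D = alg_part D"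
      using \<Theta>_alg_part_bij[OF ab \<alpha>] by (simp add: bij_betw_def)
  next
    fix c \<alpha> x assume "c \<in> carrier (Gal_ab D)" "\<alpha> \<in> c" "x \<in> alg_part D"
    then show "\<Psi> c x = \<Theta> \<alpha> x" using \<Psi>_eq[OF ab] by (simp add: \<Theta>_alg_def)
  qed (use \<Psi>_hom[OF ab] induced_state_galois[OF ab] in auto)
  show ?thesis
  proof (rule exI[of _ \<Theta>], intro conjI)
    show "canonical_action D \<Theta>" by (rule canonical_action_\<Theta>)
    show "\<forall>\<Theta>'. canonical_action D \<Theta>' \<longrightarrow> (\<forall>\<alpha>\<in>carrier (Gal D). \<Theta>' \<alpha> = \<Theta> \<alpha>)"
      by (intro allI impI ballI) (rule canonical_action_unique)
    show "\<forall>\<alpha>\<in>carrier (Gal D). \<Theta> \<alpha> ` (\<iota> D ` carrier (CX D)) = \<iota> D ` carrier (CX D)"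
      by (intro ballI) (rule \<Theta>_CX)
    show "\<forall>\<phi>. pure_state (CX D) \<phi> \<longrightarrow> (\<forall>\<alpha>\<in>carrier (Gal D). \<forall>a. \<phi> (hat D a) \<in> Kbar D \<and>
         \<alpha> (\<phi> (hat D a)) = \<phi> (act_CX D (inv\<^bsub>Gal D\<^esub> \<alpha>) (hat D a)))"
      by (intro allI impI ballI conjI pure_state_galois)
  qed (intro impI part2)
qed

end
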